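(* Let $\gamma\in[0,\pi)$, $\alpha\in(-\infty,-1]\cup[1,\infty)$ and $\beta\in(-1,1)$. Let $T_{\gamma,\alpha,\beta}$ be the self-adjoint realization of $\tau_{\alpha,\beta}$ in $L^2((-1,1);(1-x)^\alpha(1+x)^\beta dx)$ with domain $\{g\in\operatorname{dom}(T_{max,\alpha,\beta}):\sin(\gamma)\widetilde g^{\,\prime}(-1)+\cos(\gamma)\widetilde g(-1)=0\}$. Then its Weyl--Titchmarsh--Kodaira $m$-function is $$m_{\gamma,\alpha,\beta}(z)=\frac{-\sin(\gamma)+\cos(\gamma)m_{0,\alpha,\beta}(z)}{\cos(\gamma)+\sin(\gamma)m_{0,\alpha,\beta}(z)},\qquad z\in\rho(T_{\gamma,\alpha,\beta}),$$ where, with $\sigma=\sigma_{\alpha,\beta}(z)=[(1+\alpha+\beta)^2+4z]^{1/2}$, (i) for $\alpha\in[1,\infty)$, $\beta\in(-1,0)$: $m_{0,\alpha,\beta}(z)=2^{1+\alpha+\beta}\beta\frac{\Gamma(1+\beta)}{\Gamma(1-\beta)}\frac{\Gamma([1+\alpha-\beta+\sigma]/2)\Gamma([1+\alpha-\beta-\sigma]/2)}{\Gamma([1+\alpha+\beta+\sigma]/2)\Gamma([1+\alpha+\beta-\sigma]/2)}$; (ii) for $\alpha\in[1,\infty)$, $\beta=0$: $m_{0,\alpha,0}(z)=-2^{-\alpha-1}\{2\gamma_E+\psi([1+\alpha+\sigma]/2)+\psi([1+\alpha-\sigma]/2)\}$; (iii) for $\alpha\in[1,\infty)$, $\beta\in(0,1)$: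 $m_{0,\alpha,\beta}(z)=-\beta^{-1}2^{-1-\alpha-\beta}\frac{\Gamma(1-\beta)}{\Gamma(1+\beta)}\frac{\Gamma([1+\alpha+\beta+\sigma]/2)\Gamma([1+\alpha+\beta-\sigma]/2)}{\Gamma([1+\alpha-\beta+\sigma]/2)\Gamma([1+\alpha-\beta-\sigma]/2)}$; (iv) for $\alpha\in(-\infty,-1]$, $\beta\in(-1,0)$: $m_{0,\alpha,\beta}(z)=2^{1+\alpha+\beta}\beta\frac{\Gamma(1+\beta)}{\Gamma(1-\beta)}\frac{\Gamma([1-\alpha-\beta+\sigma]/2)\Gamma([1-\alpha-\beta-\sigma]/2)}{\Gamma([1+\beta-\alpha+\sigma]/2)\Gamma([1+\beta-\alpha-\sigma]/2)}$; (v) for $\alpha\in(-\infty,-1]$, $\beta=0$: $m_{0,\alpha,0}(z)=-2^{-\alpha-1}\{2\gamma_E+\psi([1-\alpha+\sigma]/2)+\psi([1-\alpha-\sigma]/2)\}$; (vi) for $\alpha\in(-\infty,-1]$, $\beta\in(0,1)$: $m_{0,\alpha,\beta}(z)=-\beta^{-1}2^{-1-\alpha-\beta}\frac{\Gamma(1-\beta)}{\Gamma(1+\beta)}\frac{\Gamma([1+\beta-\alpha+\sigma]/2)\Gamma([1+\beta-\alpha-\sigma]/2)}{\Gamma([1-\alpha-\beta+\sigma]/2)\Gamma([1-\alpha-\beta-\sigma]/2)}$. The (necessarily simple) poles of $m_{\gamma,\alpha,\beta}$ occur precisely at the (necessarily simple) eigenvalues of $T_{\gamma,\alpha,\beta}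$.
   Context: For $\alpha,\beta\in\mathbb{R}$, $\tau_{\alpha,\beta}f(x)=-(1-x)^{-\alpha}(1+x)^{-\beta}\frac{d}{dx}\big[(1-x)^{\alpha+1}(1+x)^{\beta+1}f'(x)\big]$ on $(-1,1)$, with weight $r_{\alpha,\beta}=(1-x)^\alpha(1+x)^\beta$ and quasi-derivative $f^{[1]}=(1-x)^{\alpha+1}(1+x)^{\beta+1}f'$. $T_{max,\alpha,\beta}$ acts as $\tau_{\alpha,\beta}$ on all $f\in L^2((-1,1);r_{\alpha,\beta}dx)$ with $f,f^{[1]}$ locally absolutely continuous and $\tau_{\alpha,\beta}f\in L^2((-1,1);r_{\alpha,\beta}dx)$. For $\alpha\notin(-1,1)$, $\tau_{\alpha,\beta}$ is in the limit point case at $1$ (no boundary condition there), and for $\beta\in(-1,1)$ it is regular or limit circle at $-1$. Generalized boundary values at $-1$ (for $g$ in the maximal domain or locally so near $-1$): if $\beta\in(-1,0)$: $\widetilde g(-1)=g(-1)$, $\widetilde g^{\,\prime}(-1)=g^{[1]}(-1)$; if $\beta=0$: $\widetilde g(-1)=-2^{\alpha+1}\lim_{x\downarrow-1}g(x)/\ln((1+x)/2)$, $\widetilde g^{\,\prime}(-1)=\lim_{x\downarrow-1}[g(x)+\widetilde g(-1)2^{-\alpha-1}\ln((1+x)/2)]$; if $\beta\in(0,1)$: $\widetilde g(-1)=\beta2^{\alpha+1}\lim_{x\downarrow-1}(1+x)^\beta g(x)$, $\widetilde g^{\,\prime}(-1)=\lim_{x\downarrow-1}[g(x)-\widetilde g(-1)2^{-\alpha-1}\beta^{-1}(1+x)^{-\beta}]$.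 Weyl--Titchmarsh--Kodaira $m$-function: let $\varphi_\gamma(z,\cdot),\vartheta_\gamma(z,\cdot)$ solve $\tau_{\alpha,\beta}u=zu$ with $\widetilde\varphi_\gamma(z,-1)=-\sin\gamma$, $\widetilde\varphi_\gamma^{\,\prime}(z,-1)=\cos\gamma$, $\widetilde\vartheta_\gamma(z,-1)=\cos\gamma$, $\widetilde\vartheta_\gamma^{\,\prime}(z,-1)=\sin\gamma$; $m_{\gamma,\alpha,\beta}(z)$ is the unique number with $\vartheta_\gamma(z,\cdot)+m_{\gamma,\alpha,\beta}(z)\varphi_\gamma(z,\cdot)\in L^2((c,1);r_{\alpha,\beta}dx)$ for $c\in(-1,1)$. Here $\psi=\Gamma'/\Gamma$ is the digamma function and $\gamma_E=-\psi(1)$ is Euler's constant; the displayed expressions are even in $\sigma$, so the branch of the square root is irrelevant. *)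

theory Defs
  imports "HOL-Complex_Analysis.Complex_Analysis"
begin

definition rw :: "real \<Rightarrow> real \<Rightarrow> real \<Rightarrow> real" where
  "rw a b x = (1 - x) powr a * (1 + x) powr b"

definition pw :: "real \<Rightarrow> real \<Rightarrow> real \<Rightarrow> real" where
  "pw a b x = (1 - x) powr (a + 1) * (1 + x) powr (b + 1)"

definition L2w :: "(real \<Rightarrow> real) \<Rightarrow> real set \<Rightarrow> (real \<Rightarrow> complex) \<Rightarrow> bool" where
  "L2w w S f \<longleftrightarrow> f measurable_on S \<and> (\<lambda>x. (cmod (f x))\<^sup>2 * w x) integrable_on S"

definition l2norm :: "(real \<Rightarrow> real) \<Rightarrow> real set \<Rightarrow> (real \<Rightarrow> complex) \<Rightarrow> real" where
  "l2norm w S f = sqrt (integral S (\<lambda>x. (cmod (f x))\<^sup>2 * w x))"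

definition sint :: "real \<Rightarrow> real \<Rightarrow> (real \<Rightarrow> complex) \<Rightarrow> complex" where
  "sint c x f = (if c \<le> x then integral {c..x} f else - integral {x..c} f)"

definition loc_int :: "(real \<Rightarrow> complex) \<Rightarrow> bool" where
  "loc_int f \<longleftrightarrow> (\<forall>u v. -1 < u \<and> v < 1 \<longrightarrow> f absolutely_integrable_on {u..v})"

text \<open>Maximal operator as a set of pairs (f, tau f): f and g = f^[1] locally absolutely
  continuous (written via integrals of locally integrable derivatives), f, tau f in L^2.\<close>
definition Tmax :: "real \<Rightarrow> real \<Rightarrow> ((real \<Rightarrow> complex) \<times> (real \<Rightarrow> complex)) set" where
  "Tmax a b = {(f, h). L2w (rw a b) {-1<..<1} f \<and> L2w (rw a b) {-1<..<1} h \<and>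
     (\<exists>g. loc_int (\<lambda>t. g t / of_real (pw a b t)) \<and> loc_int (\<lambda>t. of_real (rw a b t) * h t) \<and>
        (\<forall>x\<in>{-1<..<1}. f x = f 0 + sint 0 x (\<lambda>t. g t / of_real (pw a b t))) \<and>
        (\<forall>x\<in>{-1<..<1}. g x = g 0 - sint 0 x (\<lambda>t. of_real (rw a b t) * h t)))}"

definition qd :: "real \<Rightarrow> real \<Rightarrow> (real \<Rightarrow> complex) \<Rightarrow> real \<Rightarrow> complex" where
  "qd a b f x = of_real (pw a b x) * vector_derivative f (at x)"

text \<open>gbv a b g v0 v1: the generalized boundary values of g at -1 exist and equal
  v0 = g~(-1), v1 = g~'(-1) (for b in (-1,1)).\<close>
definition gbv :: "real \<Rightarrow> real \<Rightarrow> (real \<Rightarrow> complex) \<Rightarrow> complex \<Rightarrow> complex \<Rightarrow> bool" where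
  "gbv a b g v0 v1 \<longleftrightarrow>
    (if b < 0 then (g \<longlongrightarrow> v0) (at_right (-1)) \<and> (qd a b g \<longlongrightarrow> v1) (at_right (-1))
     else if b = 0 then
       ((\<lambda>x. - of_real (2 powr (a + 1)) * (g x / of_real (ln ((1 + x) / 2)))) \<longlongrightarrow> v0) (at_right (-1)) \<and>
       ((\<lambda>x. g x + v0 * of_real (2 powr (- a - 1) * ln ((1 + x) / 2))) \<longlongrightarrow> v1) (at_right (-1))
     else
       ((\<lambda>x. of_real (b * 2 powr (a + 1)) * (of_real ((1 + x) powr b) * g x)) \<longlongrightarrow> v0) (at_right (-1)) \<and>
       ((\<lambda>x. g x - v0 * of_real (2 powr (- a - 1) / b * (1 + x) powr (- b))) \<longlongrightarrow> v1) (at_right (-1)))"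

definition Tgam :: "real \<Rightarrow> real \<Rightarrow> real \<Rightarrow> ((real \<Rightarrow> complex) \<times> (real \<Rightarrow> complex)) set" where
  "Tgam gam a b = {(f, h) \<in> Tmax a b. \<exists>v0 v1. gbv a b f v0 v1 \<and>
       of_real (sin gam) * v1 + of_real (cos gam) * v0 = 0}"

text \<open>Resolvent set of an operator T (given as a set of pairs) in L^2((-1,1); w dx):
  T - z is bijective (up to a.e. equality) onto L^2 with bounded inverse.\<close>
definition rset :: "((real \<Rightarrow> complex) \<times> (real \<Rightarrow> complex)) set \<Rightarrow> (real \<Rightarrow> real) \<Rightarrow> complex set" where
  "rset T w = {z.
     (\<forall>h. L2w w {-1<..<1} h \<longrightarrow> (\<exists>f. (f, \<lambda>x. z * f x + h x) \<in> T)) \<and>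
     (\<forall>h f1 f2. (f1, \<lambda>x. z * f1 x + h x) \<in> T \<and> (f2, \<lambda>x. z * f2 x + h x) \<in> T \<longrightarrow>
         l2norm w {-1<..<1} (\<lambda>x. f1 x - f2 x) = 0) \<and>
     (\<exists>C. \<forall>h f. L2w w {-1<..<1} h \<and> (f, \<lambda>x. z * f x + h x) \<in> T \<longrightarrow>
         l2norm w {-1<..<1} f \<le> C * l2norm w {-1<..<1} h)}"

definition eigfun :: "((real \<Rightarrow> complex) \<times> (real \<Rightarrow> complex)) set \<Rightarrow> (real \<Rightarrow> real) \<Rightarrow> complex \<Rightarrow> (real \<Rightarrow> complex) \<Rightarrow> bool" where
  "eigfun T w z f \<longleftrightarrow> (f, \<lambda>x. z * f x) \<in> T \<and> l2norm w {-1<..<1} f \<noteq> 0"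

definition eigvals :: "((real \<Rightarrow> complex) \<times> (real \<Rightarrow> complex)) set \<Rightarrow> (real \<Rightarrow> real) \<Rightarrow> complex set" where
  "eigvals T w = {z. \<exists>f. eigfun T w z f}"

text \<open>u solves tau_{a,b} u = z u on (-1,1) (g is the quasi-derivative of u).\<close>
definition sol :: "real \<Rightarrow> real \<Rightarrow> complex \<Rightarrow> (real \<Rightarrow> complex) \<Rightarrow> bool" where
  "sol a b z u \<longleftrightarrow> (\<exists>g. \<forall>x\<in>{-1<..<1}.
      (u has_vector_derivative (g x / of_real (pw a b x))) (at x) \<and>
      (g has_vector_derivative (- of_real (rw a b x) * z * u x)) (at x))"

definition mfun :: "real \<Rightarrow> real \<Rightarrow> real \<Rightarrow> complex \<Rightarrow> complex" where
  "mfun gam a b z = (THE m. \<exists>\<phi> \<theta>. sol a b z \<phi> \<and> sol a b z \<theta> \<and>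
      gbv a b \<phi> (- of_real (sin gam)) (of_real (cos gam)) \<and>
      gbv a b \<theta> (of_real (cos gam)) (of_real (sin gam)) \<and>
      (\<forall>c\<in>{-1<..<1}. L2w (rw a b) {c<..<1} (\<lambda>x. \<theta> x + m * \<phi> x)))"

definition m0_formula :: "real \<Rightarrow> real \<Rightarrow> complex \<Rightarrow> complex" where
  "m0_formula a b z = (let s = csqrt (of_real ((1 + a + b)\<^sup>2) + 4 * z) in
    if 1 \<le> a then
      (if b < 0 then
         of_real (2 powr (1 + a + b) * b) * (Gamma (of_real (1 + b)) / Gamma (of_real (1 - b))) *
         (Gamma ((of_real (1 + a - b) + s) / 2) * Gamma ((of_real (1 + a - b) - s) / 2)) /
         (Gamma ((of_real (1 + a + b) + s) / 2) * Gamma ((of_real (1 + a + b) - s) / 2))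
       else if b = 0 then
         - of_real (2 powr (- a - 1)) *
         (2 * euler_mascheroni + Digamma ((of_real (1 + a) + s) / 2) + Digamma ((of_real (1 + a) - s) / 2))
       else
         - of_real (inverse b * 2 powr (- 1 - a - b)) * (Gamma (of_real (1 - b)) / Gamma (of_real (1 + b))) *
         (Gamma ((of_real (1 + a + b) + s) / 2) * Gamma ((of_real (1 + a + b) - s) / 2)) /
         (Gamma ((of_real (1 + a - b) + s) / 2) * Gamma ((of_real (1 + a - b) - s) / 2)))
    else
      (if b < 0 then
         of_real (2 powr (1 + a + b) * b) * (Gamma (of_real (1 + b)) / Gamma (of_real (1 - b))) *
         (Gamma ((of_real (1 - a - b) + s) / 2) * Gamma ((of_real (1 - a - b) - s) / 2)) /
         (Gamma ((of_real (1 + b - a) + s) / 2) * Gamma ((of_real (1 + b - a) - s) / 2))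
       else if b = 0 then
         - of_real (2 powr (- a - 1)) *
         (2 * euler_mascheroni + Digamma ((of_real (1 - a) + s) / 2) + Digamma ((of_real (1 - a) - s) / 2))
       else
         - of_real (inverse b * 2 powr (- 1 - a - b)) * (Gamma (of_real (1 - b)) / Gamma (of_real (1 + b))) *
         (Gamma ((of_real (1 + b - a) + s) / 2) * Gamma ((of_real (1 + b - a) - s) / 2)) /
         (Gamma ((of_real (1 - a - b) + s) / 2) * Gamma ((of_real (1 - a - b) - s) / 2))))"

end

theory Submission
  imports Defs "HOL-Real_Asymp.Real_Asymp"
begin

text \<open>Since $\alpha \notin (-1,1)$, the solution of $\tau u = z u$ that is square integrable near $1$ is
  unique up to a factor and explicit: with $\kappa = 0$ for $\alpha \ge 1$ and $\kappa = -\alpha$ for $\alpha \le -1$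
  it is $\psi_z(x) = (1-x)^\kappa F(A,B;1+|\alpha|;(1-x)/2)$ with $A,B = (1+|\alpha|+\beta \pm \sigma)/2$.
  The behaviour of $F$ at the argument $1$ (Gauss' sum for its value, a contiguous relation for the next
  term) gives the boundary values $P_0(z), P_1(z)$ of $\psi_z$ at $-1$ as products of values of $1/\Gamma$,
  which are entire in $z$. Rotating by $\gamma$, $m_\gamma = N/D$ with $D = \cos(\gamma) P_0 + \sin(\gamma) P_1$ and
  $N = \cos(\gamma) P_1 - \sin(\gamma) P_0$, which have no common zero. The eigenvalues are the zeros of $D$,
  with eigenfunction $\psi_z$. Lagrange's identity, with no contribution from the limit point end $1$, shows that
  $\mathrm{Im}\,z \cdot \mathrm{Im}(\overline{D}N) > 0$ off the real line, which forces the zeros of $D$ to be simple.\<close>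

section \<open>The hypergeometric series at the argument 1\<close>

text \<open>Three points go beyond the overview. First, the theorem splits cases by membership in
  the resolvent set of the operator with gamma = 0, which is a statement about an operator and not
  about P_0. If P_0(z) = 0, the eigenfunction contradicts uniqueness. If P_0(z) is nonzero and z is
  regular for gamma, a solution of the resolvent equation for gamma is corrected by a multiple of
  psi_z, a change of rank one, and Lagrange's identity bounds the multiplier. Where P_0 vanishes,
  the fraction is replaced by its limit cos/sin. Second, an element of the maximal domain has a
  quasi-derivative that is only an indefinite integral, and for beta >= 0 the boundary values say
  nothing directly about it. Lagrange's identity must be proved under this weak regularity, and the
  limit of the quasi-derivative at -1 must be derived. Third, beta = 0 is resonant: both terms of
  the expansion of F at 1 become infinite there. The logarithm is obtained by bounding the remainder
  uniformly in beta > 0 and letting beta tend to 0.\<close>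

definition disc_summable :: "(nat \<Rightarrow> complex) \<Rightarrow> bool" where
  "disc_summable f \<longleftrightarrow> (\<forall>t. norm t < 1 \<longrightarrow> summable (\<lambda>n. f n * t ^ n))"

definition psum :: "(nat \<Rightarrow> complex) \<Rightarrow> complex \<Rightarrow> complex" where
  "psum f t = (\<Sum>n. f n * t ^ n)"

lemma psum_sums: "disc_summable f \<Longrightarrow> norm t < 1 \<Longrightarrow> (\<lambda>n. f n * t ^ n) sums psum f t"
  unfolding disc_summable_def psum_def by (simp add: summable_sums)

lemma disc_summable_diffs: "disc_summable f \<Longrightarrow> disc_summable (diffs f)"
  unfolding disc_summable_def using termdiff_converges[of _ 1 f] by blast

lemma psum_has_field_derivative:
  assumes "disc_summable f" "norm t < 1"
  shows "(psum f has_field_derivative psum (diffs f) t) (at t)"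
proof -
  have "DERIV (\<lambda>t. \<Sum>n. f n * t ^ n) t :> (\<Sum>n. diffs f n * t ^ n)"
    using assms unfolding disc_summable_def by (intro termdiffs_strong'[of 1]) auto
  then show ?thesis unfolding psum_def .
qed

lemma psum_0 [simp]: "psum f 0 = f 0"
  unfolding psum_def by (rule powser_zero)

text \<open>The Euler operator t d/dt multiplies the n-th coefficient by n. This is what translates
  recurrences with polynomial coefficients in n into differential equations.\<close>

lemma psum_diffs_shift_sums:
  assumes "disc_summable f" "norm t < 1"
  shows "(\<lambda>n. of_nat n * f n * t ^ n) sums (t * psum (diffs f) t)"
proof -
  have "(\<lambda>n. diffs f n * t ^ n) sums psum (diffs f) t"
    using assms by (intro psum_sums disc_summable_diffs)
  then have "(\<lambda>n. t * (diffs f n * t ^ n)) sums (t * psum (diffs f) t)"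
    by (rule sums_mult)
  then have "(\<lambda>n. of_nat (Suc n) * f (Suc n) * t ^ Suc n) sums (t * psum (diffs f) t)"
    by (simp add: diffs_def mult_ac)
  then show ?thesis
    by (subst (asm) sums_Suc_iff) simp
qed

text \<open>Ratios up to any r > 1 are harmless because |t| < 1 leaves room for r|t| < 1. The
  majorant \<open>v\<close> is kept apart from \<open>f\<close> since the coefficients
  \<open>dcoef\<close> obey a ratio estimate only jointly with the hypergeometric ones.\<close>

lemma disc_summable_ratio:
  assumes "\<And>r. r > 1 \<Longrightarrow> eventually (\<lambda>n. v (Suc n) \<le> r * v n) sequentially"
    and "\<And>n. norm (f n) \<le> v n"
  shows "disc_summable f"
  unfolding disc_summable_def
proof (intro allI impI)
  fix t :: complex assume t: "norm t < 1"
  define q where "q = (1 + norm t) / 2"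
  have q: "norm t < q" "q < 1" "q > 0" using t by (auto simp: q_def) (smt (verit) norm_ge_zero)
  have v0: "v n \<ge> 0" for n using assms(2)[of n] norm_ge_zero order_trans by blast
  obtain r where r: "r > 1" "r * norm t \<le> q"
  proof (cases "norm t = 0")
    case True then show ?thesis using q that[of 2] by auto
  next
    case False then show ?thesis using q that[of "q / norm t"] by (auto simp: field_simps)
  qed
  from assms(1)[OF r(1)] obtain N where N: "\<And>n. n \<ge> N \<Longrightarrow> v (Suc n) \<le> r * v n"
    by (auto simp: eventually_sequentially)
  have "summable (\<lambda>n. v n * norm t ^ n)"
  proof (rule summable_ratio_test[OF q(2), of N])
    fix n assume n: "n \<ge> N"
    have "v (Suc n) * norm t ^ Suc n \<le> (r * v n) * norm t ^ Suc n"
      using N[OF n] by (intro mult_right_mono) auto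
    also have "\<dots> = (r * norm t) * (v n * norm t ^ n)" by simp
    also have "\<dots> \<le> q * (v n * norm t ^ n)" using r v0 by (intro mult_right_mono) auto
    finally show "norm (v (Suc n) * norm t ^ Suc n) \<le> q * norm (v n * norm t ^ n)"
      using v0 by (simp add: abs_mult)
  qed
  then show "summable (\<lambda>n. f n * t ^ n)"
    by (rule summable_comparison_test[rotated])
       (auto simp: norm_mult norm_power intro!: mult_right_mono assms)
qed

section \<open>Hypergeometric coefficients, contiguous relation and Euler's equation\<close>

text \<open>The lower parameter is typed as a real because it is a positive real in every use. Its
  Pochhammer symbols are then positive and increase with it, which makes domination arguments in
  this parameter possible.\<close>

definition hcoef :: "complex \<Rightarrow> complex \<Rightarrow> real \<Rightarrow> nat \<Rightarrow> complex" where
  "hcoef a b c n = pochhammer a n * pochhammer b n / (of_real (pochhammer c n) * fact n)"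

abbreviation hyp :: "complex \<Rightarrow> complex \<Rightarrow> real \<Rightarrow> complex \<Rightarrow> complex" where
  "hyp a b c \<equiv> psum (hcoef a b c)"

lemma hcoef_0 [simp]: "hcoef a b c 0 = 1"
  by (simp add: hcoef_def)

lemma of_real_add_of_nat_nonzero: "c > 0 \<Longrightarrow> complex_of_real c + of_nat n \<noteq> 0"
  using of_real_eq_0_iff[of "c + real n", where 'a = complex] by simp

lemma hcoef_Suc':
  "hcoef a b c (Suc n) =
    (a + of_nat n) * (b + of_nat n) / (of_nat (Suc n) * (of_real c + of_nat n)) * hcoef a b c n"
  by (simp add: hcoef_def pochhammer_Suc mult_ac)

lemma hcoef_Suc:
  assumes "c > 0"
  shows "of_nat (Suc n) * (of_real c + of_nat n) * hcoef a b c (Suc n)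
       = (a + of_nat n) * (b + of_nat n) * hcoef a b c n"
  using of_real_add_of_nat_nonzero[OF assms, of n] of_nat_neq_0[of n, where 'a = complex]
  unfolding hcoef_Suc' by simp

lemma hcoef_c_Suc:
  assumes "c > 0"
  shows "hcoef a b (c + 1) n * (of_real c + of_nat n) = of_real c * hcoef a b c n"
proof -
  have "pochhammer c (Suc n) = c * pochhammer (c + 1) n" by (rule pochhammer_rec)
  then have *: "pochhammer c n * (c + real n) = c * pochhammer (c + 1) n"
    by (simp add: pochhammer_Suc)
  have p: "pochhammer c n > 0" "pochhammer (c+1) n > 0" using assms by (auto intro: pochhammer_pos)
  have "hcoef a b (c + 1) n * of_real (c + real n) = pochhammer a n * pochhammer b n / fact n *
      of_real ((c + real n) / pochhammer (c+1) n)"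
    by (simp add: hcoef_def)
  also have "(c + real n) / pochhammer (c+1) n = c / pochhammer c n"
    using * p by (simp add: field_simps)
  finally show ?thesis by (simp add: hcoef_def mult_ac)
qed

lemma tendsto_add_of_nat_over:
  fixes x y :: complex
  shows "(\<lambda>n. (x + of_nat n) / (y + of_nat n)) \<longlonglongrightarrow> 1"
proof -
  have "(\<lambda>n. (x / of_nat n + 1) / (y / of_nat n + 1)) \<longlonglongrightarrow> (0 + 1) / (0 + 1)"
    by (intro tendsto_intros lim_const_over_n) auto
  moreover have "\<forall>\<^sub>F n in sequentially. (x / of_nat n + 1) / (y / of_nat n + 1) = (x + of_nat n) / (y + of_nat n)"
    using eventually_gt_at_top[of 0]
  proof eventually_elim
    case (elim n)
    then have "(x / of_nat n + 1) = (x + of_nat n) / of_nat n" "(y / of_nat n + 1) = (y + of_nat n) / of_nat n"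
      by (simp_all add: field_simps)
    with elim show ?case by simp
  qed
  ultimately show ?thesis using tendsto_cong by fastforce
qed

lemma hcoef_ratio_tendsto:
  "(\<lambda>n. (a + of_nat n) * (b + of_nat n) / (of_nat (Suc n) * (of_real c + of_nat n))) \<longlonglongrightarrow> (1::complex)"
proof -
  have "(\<lambda>n. (a + of_nat n) / (1 + of_nat n) * ((b + of_nat n) / (of_real c + of_nat n))) \<longlonglongrightarrow> (1::complex) * 1"
    by (intro tendsto_mult tendsto_add_of_nat_over)
  then show ?thesis by simp
qed

lemma disc_summable_hcoef [simp, intro]:
  assumes "c > 0"
  shows "disc_summable (hcoef a b c)"
proof (rule disc_summable_ratio)
  fix r :: real assume r: "r > 1"
  have "(\<lambda>n. norm ((a + of_nat n) * (b + of_nat n) / (of_nat (Suc n) * (of_real c + of_nat n)))) \<longlonglongrightarrow> norm (1::complex)"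
    by (intro tendsto_norm hcoef_ratio_tendsto)
  then have "\<forall>\<^sub>F n in sequentially. norm ((a + of_nat n) * (b + of_nat n) / (of_nat (Suc n) * (of_real c + of_nat n))) < r"
    using r by (intro order_tendstoD) auto
  then show "\<forall>\<^sub>F n in sequentially. norm (hcoef a b c (Suc n)) \<le> r * norm (hcoef a b c n)"
    by eventually_elim (simp only: hcoef_Suc' norm_mult[of _ "hcoef _ _ _ _"], intro mult_right_mono, auto)
qed auto

text \<open>The left-hand side is the n-th coefficient of (1-t)F' and it also telescopes. The first
  reading gives a first-order equation for F, the second a recursion in c for the values at
  1.\<close>

lemma hcoef_contiguous:
  assumes c: "c > 0"
  shows "of_nat (Suc n) * hcoef a b c (Suc n) - of_nat n * hcoef a b c n =
     (of_real c - a) * (of_real c - b) / of_real c * hcoef a b (c + 1) n + (a + b - of_real c) * hcoef a b c n"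
proof -
  let ?f = "hcoef a b c" and ?g = "hcoef a b (c + 1)" and ?d = "of_real c + of_nat n :: complex"
  have d: "?d \<noteq> 0" using c by (rule of_real_add_of_nat_nonzero)
  have g: "?g n = of_real c * ?f n / ?d" using hcoef_c_Suc[OF c, of a b n] d by (simp add: field_simps)
  have f: "of_nat (Suc n) * ?f (Suc n) = (a + of_nat n) * (b + of_nat n) * ?f n / ?d"
    using hcoef_Suc[OF c, of n a b] d by (simp add: field_simps)
  show ?thesis unfolding f g using d c by (simp add: divide_simps) (simp add: algebra_simps)
qed

lemma hyp_contiguous:
  assumes c: "c > 0" and t: "norm t < 1"
  shows "(1 - t) * psum (diffs (hcoef a b c)) t =
    (of_real c - a) * (of_real c - b) / of_real c * hyp a b (c + 1) t + (a + b - of_real c) * hyp a b c t"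
proof -
  let ?f = "hcoef a b c" and ?g = "hcoef a b (c + 1)"
  have 1: "(\<lambda>n. diffs ?f n * t ^ n - of_nat n * ?f n * t ^ n) sums (psum (diffs ?f) t - t * psum (diffs ?f) t)"
    using c t by (intro sums_diff psum_sums psum_diffs_shift_sums disc_summable_diffs) auto
  have 2: "(\<lambda>n. (of_real c - a) * (of_real c - b) / of_real c * (?g n * t ^ n) + (a + b - of_real c) * (?f n * t ^ n)) sums
     ((of_real c - a) * (of_real c - b) / of_real c * hyp a b (c + 1) t + (a + b - of_real c) * hyp a b c t)"
    using c t by (intro sums_add sums_mult psum_sums) auto
  have "(diffs ?f n - of_nat n * ?f n) * t ^ n =
     ((of_real c - a) * (of_real c - b) / of_real c * ?g n + (a + b - of_real c) * ?f n) * t ^ n" for n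
    using hcoef_contiguous[OF c, of n a b] by (simp add: diffs_def del: of_nat_Suc)
  then have "(\<lambda>n. diffs ?f n * t ^ n - of_nat n * ?f n * t ^ n) =
     (\<lambda>n. (of_real c - a) * (of_real c - b) / of_real c * (?g n * t ^ n) + (a + b - of_real c) * (?f n * t ^ n))"
    by (simp only: fun_eq_iff left_diff_distrib distrib_right mult.assoc simp_thms)
  from sums_unique2[OF 1 2[folded this]] show ?thesis by (simp only: left_diff_distrib mult_1)
qed

text \<open>Coefficients of the hypergeometric operator applied to an arbitrary power series. It is
  applied to \<open>hcoef\<close>, where the result is zero, and to \<open>dcoef\<close>, where it
  is the source term produced by the logarithm.\<close>

lemma psum_euler_sums:
  assumes f: "disc_summable f" and t: "norm t < 1"
  shows "(\<lambda>n. (of_nat (Suc n) * (c + of_nat n) * f (Suc n) - (a + of_nat n) * (b + of_nat n) * f n) * t ^ n) sums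
    (t * (1 - t) * psum (diffs (diffs f)) t + (c - (a + b + 1) * t) * psum (diffs f) t - a * b * psum f t)"
proof -
  note d = disc_summable_diffs[OF f]
  have S0: "(\<lambda>n. f n * t ^ n) sums psum f t" by (intro psum_sums f t)
  have S1: "(\<lambda>n. diffs f n * t ^ n) sums psum (diffs f) t" by (intro psum_sums d t)
  have S1': "(\<lambda>n. of_nat n * f n * t ^ n) sums (t * psum (diffs f) t)"
    by (intro psum_diffs_shift_sums f t)
  have S2: "(\<lambda>n. of_nat n * diffs f n * t ^ n) sums (t * psum (diffs (diffs f)) t)"
    by (intro psum_diffs_shift_sums d t)
  have "(\<lambda>n. t * (of_nat n * diffs f n * t ^ n)) sums (t * (t * psum (diffs (diffs f)) t))"
    by (intro sums_mult S2)
  then have "(\<lambda>n. (of_nat (Suc n) - 1) * of_nat (Suc n) * f (Suc n) * t ^ Suc n) sums (t * (t * psum (diffs (diffs f)) t))"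
    by (simp add: diffs_def mult_ac)
  then have S2': "(\<lambda>n. (of_nat n - 1) * of_nat n * f n * t ^ n) sums (t * (t * psum (diffs (diffs f)) t))"
    by (subst (asm) sums_Suc_iff) simp
  have "(\<lambda>n. of_nat n * diffs f n * t ^ n - (of_nat n - 1) * of_nat n * f n * t ^ n + c * (diffs f n * t ^ n)
     - (a + b + 1) * (of_nat n * f n * t ^ n) - a * b * (f n * t ^ n)) sums
     (t * psum (diffs (diffs f)) t - t * (t * psum (diffs (diffs f)) t) + c * psum (diffs f) t
      - (a + b + 1) * (t * psum (diffs f) t) - a * b * psum f t)"
    by (intro sums_add sums_diff sums_mult S0 S1 S1' S2 S2')
  then show ?thesis
    by (simp add: diffs_def algebra_simps)
qed

lemma hyp_ode:
  assumes "c > 0" "norm t < 1"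
  shows "t * (1 - t) * psum (diffs (diffs (hcoef a b c))) t
     + (of_real c - (a + b + 1) * t) * psum (diffs (hcoef a b c)) t - a * b * hyp a b c t = 0"
proof -
  have "(\<lambda>n. (of_nat (Suc n) * (of_real c + of_nat n) * hcoef a b c (Suc n) - (a + of_nat n) * (b + of_nat n) * hcoef a b c n) * t ^ n) sums
    (t * (1 - t) * psum (diffs (diffs (hcoef a b c))) t + (of_real c - (a + b + 1) * t) * psum (diffs (hcoef a b c)) t - a * b * hyp a b c t)"
    using assms by (intro psum_euler_sums) auto
  then show ?thesis using assms by (simp add: hcoef_Suc sums_iff del: of_nat_Suc)
qed

lemma norm_diff_le_of_deriv_le:
  fixes f :: "real \<Rightarrow> 'a :: real_normed_vector"
  assumes "a \<le> b"
    and "\<And>x. x \<in> {a..b} \<Longrightarrow> (f has_vector_derivative f' x) (at x)"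
    and "\<And>x. x \<in> {a..b} \<Longrightarrow> (\<phi> has_real_derivative \<phi>' x) (at x)"
    and "\<And>x. x \<in> {a..b} \<Longrightarrow> norm (f' x) \<le> \<phi>' x"
  shows "norm (f b - f a) \<le> \<phi> b - \<phi> a"
proof (cases "a = b")
  case False
  show ?thesis
  proof (rule differentiable_bound_general[of a b f \<phi> f' \<phi>'])
    show "continuous_on {a..b} f" "continuous_on {a..b} \<phi>"
      using assms(2,3) has_vector_derivative_continuous DERIV_isCont
      by (blast intro: continuous_at_imp_continuous_on)+
  qed (use assms False in \<open>auto simp: has_real_derivative_iff_has_vector_derivative\<close>)
qed auto

section \<open>Growth of the coefficients and Abelian theorems\<close>

text \<open>The coefficient is a quotient of four Gauss products for 1/Gamma, at a, b, c and 1, and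
  the exponentials left over combine to n^(c+1-a-b). The index is \<open>Suc n\<close> because
  \<open>rGamma_series\<close> contains n+1 factors. Working with \<open>rGamma\<close> admits the
  terminating series, where the limit is 0.\<close>

lemma hcoef_asymp:
  assumes c: "c > 0" and ab: "a + b = of_real (c + \<beta>)"
  shows "(\<lambda>n. of_real (real n powr (1 - \<beta>)) * hcoef a b c (Suc n)) \<longlonglongrightarrow>
           of_real (Gamma c) * rGamma a * rGamma b"
proof -
  have "(\<lambda>n. rGamma_series a n * rGamma_series b n / (rGamma_series (of_real c) n * rGamma_series 1 n))
    \<longlonglongrightarrow> rGamma a * rGamma b / (rGamma (of_real c) * rGamma (1 :: complex))"
    using c by (intro tendsto_intros) (auto simp: rGamma_complex_of_real rGamma_eq_zero_iff elim!: nonpos_Ints_cases)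
  moreover have "rGamma a * rGamma b / (rGamma (of_real c) * rGamma (1 :: complex)) = of_real (Gamma c) * rGamma a * rGamma b"
    by (simp add: Gamma_complex_of_real[symmetric] rGamma_inverse_Gamma field_simps)
  moreover have "\<forall>\<^sub>F n in sequentially. rGamma_series a n * rGamma_series b n / (rGamma_series (of_real c) n * rGamma_series 1 n)
     = of_real (real n powr (1 - \<beta>)) * hcoef a b c (Suc n)"
    using eventually_gt_at_top[of 0]
  proof eventually_elim
    case (elim n)
    let ?e = "\<lambda>z::complex. exp (z * of_real (ln (real n)))"
    have b: "b = of_real c + of_real \<beta> - a" using ab by (simp add: algebra_simps)
    have e: "?e (of_real c) * ?e 1 = ?e a * ?e b * of_real (real n powr (1 - \<beta>))"
      using elim unfolding b powr_def by (simp add: algebra_simps flip: exp_add exp_of_real)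
    have "rGamma_series a n * rGamma_series b n / (rGamma_series (of_real c) n * rGamma_series 1 n)
       = pochhammer a (Suc n) * pochhammer b (Suc n) * (?e (of_real c) * ?e 1) /
          (pochhammer (of_real c) (Suc n) * pochhammer 1 (Suc n) * (?e a * ?e b))"
      by (simp add: rGamma_series_def divide_simps del: pochhammer_Suc)
    also have "\<dots> = of_real (real n powr (1 - \<beta>)) * hcoef a b c (Suc n)"
      unfolding e by (simp add: hcoef_def pochhammer_of_real pochhammer_fact[symmetric] del: fact_Suc)
    finally show ?case .
  qed
  ultimately show ?thesis using tendsto_cong by force
qed

lemma hcoef_bound:
  assumes "c > 0" "a + b = of_real (c + \<beta>)"
  obtains C where "C > 0" "\<And>n. n > 0 \<Longrightarrow> norm (hcoef a b c (Suc n)) \<le> C * real n powr (\<beta> - 1)"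
proof -
  have "Bseq (\<lambda>n. of_real (real n powr (1 - \<beta>)) * hcoef a b c (Suc n))"
    using hcoef_asymp[OF assms] convergentI convergent_imp_Bseq by blast
  then obtain C where C: "C > 0" "\<And>n. norm (of_real (real n powr (1 - \<beta>)) * hcoef a b c (Suc n)) \<le> C"
    by (auto elim: BseqE)
  show ?thesis
  proof (rule that[OF C(1)])
    fix n :: nat assume n: "n > 0"
    have "real n powr (1 - \<beta>) * norm (hcoef a b c (Suc n)) \<le> C"
      using C(2)[of n] by (simp add: norm_mult)
    moreover have "real n powr (\<beta> - 1) * real n powr (1 - \<beta>) = 1"
      using n by (simp flip: powr_add)
    ultimately show "norm (hcoef a b c (Suc n)) \<le> C * real n powr (\<beta> - 1)"
    proof -
      assume 1: "real n powr (1 - \<beta>) * norm (hcoef a b c (Suc n)) \<le> C"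
        and 2: "real n powr (\<beta> - 1) * real n powr (1 - \<beta>) = 1"
      have "norm (hcoef a b c (Suc n)) = real n powr (\<beta> - 1) * (real n powr (1 - \<beta>) * norm (hcoef a b c (Suc n)))"
        using 2 by (simp flip: mult.assoc)
      also have "\<dots> \<le> real n powr (\<beta> - 1) * C" using 1 by (intro mult_left_mono) auto
      finally show ?thesis by (simp add: mult.commute)
    qed
  qed
qed

text \<open>The coefficients are O(n^(beta-1)). The extra weight n^delta is what later becomes the
  rate (1-t)^delta at the argument 1.\<close>

lemma summable_norm_hcoef_weighted:
  assumes "c > 0" "a + b = of_real (c + \<beta>)" "\<delta> \<ge> 0" "\<beta> + \<delta> < 0"
  shows "summable (\<lambda>n. norm (hcoef a b c n) * real n powr \<delta>)"
proof -
  obtain C where C: "C > 0" "\<And>n. n > 0 \<Longrightarrow> norm (hcoef a b c (Suc n)) \<le> C * real n powr (\<beta> - 1)"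
    using hcoef_bound[OF assms(1,2)] by metis
  have "summable (\<lambda>n. C * 2 powr \<delta> * real n powr (\<beta> - 1 + \<delta>))"
    using assms by (intro summable_mult) (subst summable_real_powr_iff, simp)
  then have "summable (\<lambda>n. norm (hcoef a b c (Suc n)) * real (Suc n) powr \<delta>)"
  proof (rule summable_comparison_test_ev[rotated])
    show "\<forall>\<^sub>F n in sequentially. norm (norm (hcoef a b c (Suc n)) * real (Suc n) powr \<delta>) \<le> C * 2 powr \<delta> * real n powr (\<beta> - 1 + \<delta>)"
      using eventually_gt_at_top[of 0]
    proof eventually_elim
      case (elim n)
      have "real (Suc n) powr \<delta> \<le> (2 * real n) powr \<delta>" using elim assms by (intro powr_mono2) auto
      also have "\<dots> = 2 powr \<delta> * real n powr \<delta>" by (simp add: powr_mult)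
      finally have "norm (hcoef a b c (Suc n)) * real (Suc n) powr \<delta> \<le> (C * real n powr (\<beta> - 1)) * (2 powr \<delta> * real n powr \<delta>)"
        using elim C by (intro mult_mono) auto
      then show ?case by (simp add: powr_add mult_ac)
    qed
  qed
  then show ?thesis by (subst (asm) summable_Suc_iff)
qed

lemma summable_norm_hcoef:
  assumes "c > 0" "a + b = of_real (c + \<beta>)" "\<beta> < 0"
  shows "summable (\<lambda>n. norm (hcoef a b c n))"
proof -
  have "summable (\<lambda>n. norm (hcoef a b c n) * real n powr 0)"
    using assms by (intro summable_norm_hcoef_weighted[of c a b \<beta> 0]) auto
  then have "summable (\<lambda>n. norm (hcoef a b c (Suc n)) * real (Suc n) powr 0)"
    by (subst summable_Suc_iff)
  then have "summable (\<lambda>n. norm (hcoef a b c (Suc n)))" by simp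
  then show ?thesis by (subst (asm) summable_Suc_iff)
qed

lemma psum_tendsto_suminf:
  assumes "summable (\<lambda>n. norm (f n))"
  shows "((\<lambda>t. psum f (of_real t)) \<longlongrightarrow> suminf f) (at_left 1)"
  unfolding psum_def
proof (rule tannerys_theorem[THEN conjunct2, THEN conjunct2])
  show "((\<lambda>t. f k * complex_of_real t ^ k) \<longlongrightarrow> f k) (at_left 1)" for k
    by (auto intro!: tendsto_eq_intros)
  have "\<forall>\<^sub>F t in at_left (1::real). 0 < t \<and> t < 1"
    by (intro eventually_at_leftI[of 0]) auto
  then have "\<forall>\<^sub>F (k::nat, t) in at_top \<times>\<^sub>F at_left (1::real). 0 < t \<and> t < 1"
    by (subst eventually_prod2) auto
  then show "\<forall>\<^sub>F (k, t) in at_top \<times>\<^sub>F at_left 1. norm (f k * complex_of_real t ^ k) \<le> norm (f k)"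
    by (rule eventually_mono) (auto simp: norm_mult norm_power mult_left_le power_le_one)
qed (use assms in auto)

lemma powr_binomial_sums:
  assumes "\<bar>t\<bar> < (1::real)"
  shows "(\<lambda>n. pochhammer y n / fact n * t ^ n) sums (1 - t) powr (- y)"
proof -
  have "(\<lambda>n. ((- y) gchoose n) * (- t) ^ n) sums (1 + (- t)) powr (- y)"
    using assms by (intro gen_binomial_real) auto
  moreover have "((- y) gchoose n) * (- t) ^ n = pochhammer y n / fact n * t ^ n" for n
  proof -
    have "(- 1) ^ n * (- t) ^ n = t ^ n" by (simp flip: power_mult_distrib)
    then show ?thesis by (simp add: gbinomial_pochhammer mult_ac)
  qed
  ultimately show ?thesis by simp
qed

text \<open>Abelian theorem with comparison series (1-t)^(-y). Its coefficients are positive and its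
  sum is unbounded near 1, so finitely many terms are lost after multiplication by (1-t)^y, while
  the tail differs from L times the comparison series by at most e/2 of it.\<close>

lemma psum_powr_tendsto:
  fixes f :: "nat \<Rightarrow> complex"
  assumes y: "y > 0" and f: "disc_summable f"
    and L: "(\<lambda>n. f n / of_real (pochhammer y n / fact n)) \<longlonglongrightarrow> L"
  shows "((\<lambda>t. of_real ((1 - t) powr y) * psum f (of_real t)) \<longlongrightarrow> L) (at_left 1)"
proof (rule tendstoI)
  fix e :: real assume e: "e > 0"
  define g where "g n = pochhammer y n / fact n" for n
  have g: "g n > 0" for n using y by (simp add: g_def pochhammer_pos)
  define h where "h n = f n - L * of_real (g n)" for n
  have "(\<lambda>n. f n / of_real (g n)) \<longlonglongrightarrow> L" using L by (simp add: g_def)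
  then have "\<forall>\<^sub>F n in sequentially. norm (f n / of_real (g n) - L) < e / 2"
    using e unfolding tendsto_iff dist_norm by (meson half_gt_zero)
  then obtain N where N: "\<And>n. n \<ge> N \<Longrightarrow> norm (f n / of_real (g n) - L) < e / 2"
    by (auto simp: eventually_sequentially)
  have hN: "norm (h n) \<le> e / 2 * g n + (if n \<in> {..<N} then norm (h n) else 0)" for n
  proof (cases "n < N")
    case False
    have "h n = (f n / of_real (g n) - L) * of_real (g n)" using g[of n] by (simp add: h_def field_simps)
    then have "norm (h n) = norm (f n / of_real (g n) - L) * g n" using g[of n] by (simp add: norm_mult)
    then show ?thesis using N[of n] False g[of n] by (auto intro!: mult_right_mono simp: less_imp_le)
  qed (use e g[of n] in \<open>auto simp: less_imp_le\<close>)
  define K where "K = (\<Sum>n<N. norm (h n))"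
  have bound: "norm (of_real ((1 - t) powr y) * psum f (of_real t) - L) \<le> K * (1 - t) powr y + e / 2"
    if t: "0 < t" "t < 1" for t
  proof -
    define G where "G = (1 - t) powr (- y)"
    have gs: "(\<lambda>n. g n * t ^ n) sums G" unfolding g_def G_def using t by (intro powr_binomial_sums) auto
    then have "(\<lambda>n. complex_of_real (g n * t ^ n)) sums of_real G" by (rule sums_of_real)
    then have "(\<lambda>n. f n * of_real t ^ n - L * of_real (g n * t ^ n)) sums (psum f (of_real t) - L * of_real G)"
      using t f by (intro sums_diff sums_mult psum_sums) auto
    then have hs: "(\<lambda>n. h n * of_real t ^ n) sums (psum f (of_real t) - L * of_real G)"
      by (simp add: h_def algebra_simps)
    have bs: "(\<lambda>n. e / 2 * (g n * t ^ n) + (if n \<in> {..<N} then norm (h n) else 0)) sums (e / 2 * G + K)"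
      unfolding K_def by (intro sums_add sums_mult gs sums_If_finite_set) auto
    have hb: "norm (h n * of_real t ^ n) \<le> e / 2 * (g n * t ^ n) + (if n \<in> {..<N} then norm (h n) else 0)" for n
    proof -
      have "norm (h n * of_real t ^ n) = norm (h n) * t ^ n" using t by (simp add: norm_mult norm_power)
      also have "\<dots> \<le> (e / 2 * g n + (if n \<in> {..<N} then norm (h n) else 0)) * t ^ n"
        using t hN[of n] by (intro mult_right_mono) auto
      also have "\<dots> \<le> e / 2 * (g n * t ^ n) + (if n \<in> {..<N} then norm (h n) else 0)"
      proof -
        have "(if n \<in> {..<N} then norm (h n) else 0) * t ^ n \<le> (if n \<in> {..<N} then norm (h n) else 0)"
          using t by (intro mult_left_le power_le_one) auto
        then show ?thesis by (simp only: distrib_right mult.assoc add_left_mono)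
      qed
      finally show ?thesis .
    qed
    have "norm (psum f (of_real t) - L * of_real G) \<le> e / 2 * G + K"
      using norm_suminf_le[OF hb sums_summable[OF bs]] hs bs by (simp add: sums_iff)
    then have "(1 - t) powr y * norm (psum f (of_real t) - L * of_real G) \<le> (1 - t) powr y * (e / 2 * G + K)"
      by (intro mult_left_mono) auto
    moreover have yG: "(1 - t) powr y * G = 1" using t by (simp add: G_def flip: powr_add)
    moreover have "of_real ((1 - t) powr y) * psum f (of_real t) - L =
       of_real ((1 - t) powr y) * (psum f (of_real t) - L * of_real G)"
    proof -
      have "complex_of_real ((1 - t) powr y) * of_real G = 1" by (simp only: yG flip: of_real_mult) simp
      then have "complex_of_real ((1 - t) powr y) * (L * of_real G) = L" by (metis mult.left_commute mult.right_neutral)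
      then show ?thesis by (simp only: right_diff_distrib)
    qed
    moreover have "(1 - t) powr y * (e / 2 * G + K) = e / 2 * ((1 - t) powr y * G) + K * (1 - t) powr y"
      by (simp add: algebra_simps)
    ultimately show ?thesis by (simp add: norm_mult)
  qed
  have "((\<lambda>t. K * (1 - t) powr y) \<longlongrightarrow> K * (1 - 1) powr y) (at_left 1)"
    using y by (intro tendsto_intros) (auto simp: eventually_at_filter)
  then have "\<forall>\<^sub>F t in at_left 1. K * (1 - t) powr y < e / 2"
    using e y by (intro order_tendstoD(2)) auto
  moreover have "\<forall>\<^sub>F t in at_left (1::real). 0 < t \<and> t < 1"
    by (intro eventually_at_leftI[of 0]) auto
  ultimately show "\<forall>\<^sub>F t in at_left 1. dist (of_real ((1 - t) powr y) * psum f (of_real t)) L < e"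
    unfolding dist_norm
  proof eventually_elim
    case (elim t)
    then show ?case using bound[of t] by simp
  qed
qed

lemma of_real_Gamma_rGamma: "x > 0 \<Longrightarrow> complex_of_real (Gamma x) * rGamma (of_real x) = 1"
proof -
  assume "x > 0"
  then have "Gamma x > 0" by (rule Gamma_real_pos)
  then have "Gamma x \<noteq> 0" by linarith
  then show ?thesis by (simp add: Gamma_complex_of_real rGamma_inverse_Gamma)
qed

lemma hyp_powr_tendsto:
  assumes c: "c > 0" and ab: "a + b = of_real (c + \<beta>)" and \<beta>: "\<beta> > 0"
  shows "((\<lambda>t. of_real ((1 - t) powr \<beta>) * hyp a b c (of_real t)) \<longlongrightarrow>
     of_real (Gamma c) * of_real (Gamma \<beta>) * rGamma a * rGamma b) (at_left 1)"
proof (rule psum_powr_tendsto[OF \<beta> disc_summable_hcoef[OF c]])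
  \<comment> \<open>The binomial coefficients of (1-t)^(-beta) are the hypergeometric ones with
    parameters beta, 1; 1 and have the same excess beta. One asymptotic law thus serves numerator
    and denominator, and the powers of n cancel.\<close>
  have g: "complex_of_real (pochhammer \<beta> n / fact n) = hcoef (of_real \<beta>) 1 1 n" for n
    by (simp add: hcoef_def pochhammer_of_real flip: pochhammer_fact)
  have "(\<lambda>n. (of_real (real n powr (1 - \<beta>)) * hcoef a b c (Suc n)) / (of_real (real n powr (1 - \<beta>)) * hcoef (of_real \<beta>) 1 1 (Suc n)))
     \<longlonglongrightarrow> (of_real (Gamma c) * rGamma a * rGamma b) / (of_real (Gamma 1) * rGamma (of_real \<beta>) * rGamma 1)"
    using c ab \<beta> by (intro tendsto_divide hcoef_asymp) (use of_real_Gamma_rGamma[of \<beta>] in auto)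
  also have "(of_real (Gamma c) * rGamma a * rGamma b) / (of_real (Gamma 1) * rGamma (of_real \<beta>) * rGamma 1) =
     of_real (Gamma c) * of_real (Gamma \<beta>) * rGamma a * rGamma b"
    using of_real_Gamma_rGamma[OF \<beta>] by (auto simp: divide_simps mult_ac)
  finally have *: "(\<lambda>n. (of_real (real n powr (1 - \<beta>)) * hcoef a b c (Suc n)) / (of_real (real n powr (1 - \<beta>)) * hcoef (of_real \<beta>) 1 1 (Suc n)))
     \<longlonglongrightarrow> of_real (Gamma c) * of_real (Gamma \<beta>) * rGamma a * rGamma b" .
  have "(\<lambda>n. hcoef a b c (Suc n) / hcoef (of_real \<beta>) 1 1 (Suc n)) \<longlonglongrightarrow> of_real (Gamma c) * of_real (Gamma \<beta>) * rGamma a * rGamma b"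
    by (rule Lim_transform_eventually[OF *], use eventually_gt_at_top[of 0] in eventually_elim) simp
  then show "(\<lambda>n. hcoef a b c n / of_real (pochhammer \<beta> n / fact n)) \<longlonglongrightarrow> of_real (Gamma c) * of_real (Gamma \<beta>) * rGamma a * rGamma b"
    unfolding g by (subst (asm) filterlim_sequentially_Suc)
qed

lemma diffs_hcoef:
  assumes "c > 0"
  shows "diffs (hcoef a b c) n = a * b / of_real c * hcoef (a + 1) (b + 1) (c + 1) n"
proof -
  have "pochhammer (c + 1) n > 0" using assms by (intro pochhammer_pos) auto
  then show ?thesis using assms of_nat_neq_0[of n, where 'a = complex]
    by (simp add: diffs_def hcoef_def pochhammer_rec field_simps del: of_nat_Suc)
qed

lemma psum_cmult: "disc_summable f \<Longrightarrow> norm t < 1 \<Longrightarrow> psum (\<lambda>n. k * f n) t = k * psum f t"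
  unfolding psum_def disc_summable_def by (simp add: suminf_mult mult.assoc)

text \<open>F' is ab/c times the series with all parameters raised by 1, whose excess is beta + 1.
  Hence beta > -1 is enough, and the factors a, b, 1/c are absorbed by the functional equation of
  Gamma.\<close>

lemma hyp_deriv_powr_tendsto:
  assumes c: "c > 0" and ab: "a + b = of_real (c + \<beta>)" and \<beta>: "\<beta> > - 1"
  shows "((\<lambda>t. of_real ((1 - t) powr (\<beta> + 1)) * psum (diffs (hcoef a b c)) (of_real t)) \<longlongrightarrow>
     of_real (Gamma c) * of_real (Gamma (\<beta> + 1)) * rGamma a * rGamma b) (at_left 1)"
proof -
  have lim: "((\<lambda>t. a * b / of_real c * (of_real ((1 - t) powr (\<beta> + 1)) * hyp (a + 1) (b + 1) (c + 1) (of_real t))) \<longlongrightarrow>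
     a * b / of_real c * (of_real (Gamma (c + 1)) * of_real (Gamma (\<beta> + 1)) * rGamma (a + 1) * rGamma (b + 1))) (at_left 1)"
    using assms by (intro tendsto_mult tendsto_const hyp_powr_tendsto) (auto simp: add_ac)
  have "Gamma (c + 1) = c * Gamma c" using c by (intro Gamma_plus1) (auto elim!: nonpos_Ints_cases)
  then have eq: "a * b / of_real c * (of_real (Gamma (c + 1)) * of_real (Gamma (\<beta> + 1)) * rGamma (a + 1) * rGamma (b + 1)) =
     of_real (Gamma c) * of_real (Gamma (\<beta> + 1)) * rGamma a * rGamma b"
    using c by (simp add: rGamma_plus1[of a, symmetric] rGamma_plus1[of b, symmetric])
  have "\<forall>\<^sub>F t in at_left (1::real). 0 < t \<and> t < 1"
    by (intro eventually_at_leftI[of 0]) auto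
  then have "\<forall>\<^sub>F t in at_left 1. a * b / of_real c * (of_real ((1 - t) powr (\<beta> + 1)) * hyp (a + 1) (b + 1) (c + 1) (of_real t))
     = of_real ((1 - t) powr (\<beta> + 1)) * psum (diffs (hcoef a b c)) (of_real t)"
  proof eventually_elim
    case (elim t)
    have "psum (diffs (hcoef a b c)) (of_real t) = a * b / of_real c * hyp (a + 1) (b + 1) (c + 1) (of_real t)"
      using c elim unfolding diffs_hcoef[OF c, abs_def] by (intro psum_cmult) auto
    then show ?case by simp
  qed
  with lim eq show ?thesis using Lim_transform_eventually by force
qed

section \<open>Gauss' summation theorem\<close>

lemma pochhammer_mono_pos:
  fixes x y :: real
  assumes "0 < x" "x \<le> y"
  shows "pochhammer x n \<le> pochhammer y n"
  unfolding pochhammer_prod using assms by (intro prod_mono) auto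

lemma norm_hcoef_antimono:
  assumes "0 < c" "c \<le> c'"
  shows "norm (hcoef a b c' n) \<le> norm (hcoef a b c n)"
proof -
  have "pochhammer c n \<le> pochhammer c' n" "pochhammer c n > 0" "pochhammer c' n > 0"
    using assms by (auto intro!: pochhammer_mono_pos pochhammer_pos)
  then show ?thesis
    unfolding hcoef_def norm_divide norm_mult norm_of_real by (intro divide_left_mono mult_right_mono) (auto intro!: mult_pos_pos)
qed

text \<open>Sum the contiguous relation over n. The left-hand side telescopes to 0, because n times
  the n-th coefficient is O(n^beta) and beta < 0.\<close>

lemma hcoef_sum_rec:
  assumes c: "c > 0" and ab: "a + b = of_real (c + \<beta>)" and \<beta>: "\<beta> < 0"
  shows "(of_real c - a) * (of_real c - b) / of_real c * suminf (hcoef a b (c + 1)) = - of_real \<beta> * suminf (hcoef a b c)"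
proof -
  obtain C where C: "C > 0" "\<And>n. n > 0 \<Longrightarrow> norm (hcoef a b c (Suc n)) \<le> C * real n powr (\<beta> - 1)"
    using hcoef_bound[OF c ab] by metis
  have "(\<lambda>n. of_nat (Suc n) * hcoef a b c (Suc n)) \<longlonglongrightarrow> 0"
  proof (rule Lim_null_comparison)
    show "\<forall>\<^sub>F n in sequentially. norm (of_nat (Suc n) * hcoef a b c (Suc n)) \<le> 2 * C * real n powr \<beta>"
      using eventually_gt_at_top[of 0]
    proof eventually_elim
      case (elim n)
      have "norm (of_nat (Suc n) * hcoef a b c (Suc n)) \<le> (2 * real n) * (C * real n powr (\<beta> - 1))"
        unfolding norm_mult norm_of_nat using elim C by (intro mult_mono) auto
      also have "\<dots> = 2 * C * (real n powr 1 * real n powr (\<beta> - 1))" using elim by simp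
      also have "\<dots> = 2 * C * real n powr \<beta>" by (simp only: powr_add[symmetric]) simp
      finally show ?case .
    qed
    have "((\<lambda>x::real. 2 * C * x powr \<beta>) \<longlongrightarrow> 2 * C * 0) at_top"
      using \<beta> by (intro tendsto_mult tendsto_const tendsto_neg_powr filterlim_ident) auto
    from filterlim_compose[OF this filterlim_real_sequentially] show "(\<lambda>n. 2 * C * real n powr \<beta>) \<longlonglongrightarrow> 0" by simp
  qed
  then have "(\<lambda>n. of_nat n * hcoef a b c n) \<longlonglongrightarrow> 0"
    by (subst (asm) filterlim_sequentially_Suc)
  then have T: "(\<lambda>n. of_nat (Suc n) * hcoef a b c (Suc n) - of_nat n * hcoef a b c n) sums (0 - of_nat 0 * hcoef a b c 0)"
    by (rule telescope_sums)
  have U: "(\<lambda>n. of_nat (Suc n) * hcoef a b c (Suc n) - of_nat n * hcoef a b c n) sums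
    ((of_real c - a) * (of_real c - b) / of_real c * suminf (hcoef a b (c + 1)) + (a + b - of_real c) * suminf (hcoef a b c))"
  proof -
    have "summable (hcoef a b c)" "summable (hcoef a b (c + 1))"
      using assms summable_norm_hcoef[of c a b \<beta>] summable_norm_hcoef[of "c + 1" a b "\<beta> - 1"]
      by (auto intro: summable_norm_cancel)
    then show ?thesis unfolding hcoef_contiguous[OF c] by (intro sums_add sums_mult summable_sums)
  qed
  have "a + b - of_real c = of_real \<beta>" using ab by simp
  with sums_unique2[OF T U] show ?thesis by (simp add: eq_neg_iff_add_eq_0)
qed

lemma hcoef_sum_pochhammer:
  assumes c: "c > 0" and ab: "a + b = of_real (c + \<beta>)" and \<beta>: "\<beta> < 0"
  shows "pochhammer (of_real c - a) m * pochhammer (of_real c - b) m * suminf (hcoef a b (c + real m)) =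
    pochhammer (of_real c) m * pochhammer (of_real (- \<beta>)) m * suminf (hcoef a b c)"
proof (induction m)
  case (Suc m)
  define c' where "c' = c + real m"
  have c': "c' > 0" using c by (simp add: c'_def)
  have "(of_real c' - a) * (of_real c' - b) / of_real c' * suminf (hcoef a b (c' + 1)) = - of_real (\<beta> - real m) * suminf (hcoef a b c')"
    using ab \<beta> by (intro hcoef_sum_rec c') (auto simp: c'_def)
  then have *: "(of_real c' - a) * (of_real c' - b) * suminf (hcoef a b (c' + 1)) = of_real c' * of_real (real m - \<beta>) * suminf (hcoef a b c')"
    using c' by (simp add: field_simps)
  have "pochhammer (of_real c - a) (Suc m) * pochhammer (of_real c - b) (Suc m) * suminf (hcoef a b (c + real (Suc m)))
     = pochhammer (of_real c - a) m * pochhammer (of_real c - b) m * ((of_real c' - a) * (of_real c' - b) * suminf (hcoef a b (c' + 1)))"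
    by (simp add: pochhammer_Suc c'_def add_ac algebra_simps)
  also have "\<dots> = (pochhammer (of_real c - a) m * pochhammer (of_real c - b) m * suminf (hcoef a b c')) * of_real c' * of_real (real m - \<beta>)"
    unfolding * by (simp add: mult_ac)
  also have "\<dots> = pochhammer (of_real c) m * pochhammer (of_real (- \<beta>)) m * suminf (hcoef a b c) * of_real c' * of_real (real m - \<beta>)"
    unfolding c'_def Suc by simp
  also have "\<dots> = pochhammer (of_real c) (Suc m) * pochhammer (of_real (- \<beta>)) (Suc m) * suminf (hcoef a b c)"
    by (simp add: pochhammer_Suc c'_def mult_ac)
  finally show ?case .
qed auto

text \<open>Every term but the first tends to 0 as the lower parameter grows, and the series for the
  smallest parameter dominates all others. This gives the anchor for the recursion in c.\<close>

lemma hcoef_sum_tendsto_1: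
  assumes c: "c > 0" and ab: "a + b = of_real (c + \<beta>)" and \<beta>: "\<beta> < 0"
  shows "(\<lambda>m. suminf (hcoef a b (c + real m))) \<longlonglongrightarrow> 1"
proof -
  have "(\<lambda>m. suminf (hcoef a b (c + real m))) \<longlonglongrightarrow> suminf (\<lambda>n. if n = 0 then 1 else 0)"
  proof (rule tannerys_theorem[THEN conjunct2, THEN conjunct2])
    show "(\<lambda>m. hcoef a b (c + real m) k) \<longlonglongrightarrow> (if k = 0 then 1 else 0)" for k
    proof (cases k)
      case (Suc j)
      have "(\<lambda>m. hcoef a b (c + real m) (Suc j)) \<longlonglongrightarrow> 0"
      proof (rule Lim_null_comparison)
        let ?K = "norm (pochhammer a (Suc j) * pochhammer b (Suc j))"
        show "\<forall>\<^sub>F m in sequentially. norm (hcoef a b (c + real m) (Suc j)) \<le> ?K / real m"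
          using eventually_gt_at_top[of 0]
        proof eventually_elim
          case (elim m)
          have "1 \<le> fact j * (1::real)" using fact_ge_1 by simp
          also have "fact j = pochhammer (1::real) j" by (simp add: pochhammer_fact)
          also have "\<dots> \<le> pochhammer (c + real m + 1) j" using c by (intro pochhammer_mono_pos) auto
          finally have "1 \<le> pochhammer (c + real m + 1) j" by simp
          then have "real m * 1 \<le> (c + real m) * pochhammer (c + real m + 1) j" using c by (intro mult_mono) auto
          also have "\<dots> = pochhammer (c + real m) (Suc j)" by (rule pochhammer_rec[symmetric])
          finally have p: "real m \<le> pochhammer (c + real m) (Suc j)" by simp
          have "real m * 1 \<le> pochhammer (c + real m) (Suc j) * fact (Suc j)"
            using p elim by (intro mult_mono) (auto intro: fact_ge_1 simp del: fact_Suc)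
          then have "?K / norm (complex_of_real (pochhammer (c + real m) (Suc j)) * fact (Suc j)) \<le> ?K / real m"
            using p elim by (intro divide_left_mono) (auto simp: norm_mult simp del: fact_Suc)
          then show ?case by (simp add: hcoef_def norm_divide del: fact_Suc)
        qed
      qed (rule lim_const_over_n)
      then show ?thesis using Suc by simp
    qed auto
    show "\<forall>\<^sub>F (k, m) in sequentially \<times>\<^sub>F sequentially. norm (hcoef a b (c + real m) k) \<le> norm (hcoef a b c k)"
      using c by (intro always_eventually) (auto intro!: norm_hcoef_antimono)
  qed (use summable_norm_hcoef[OF assms] in auto)
  also have "suminf (\<lambda>n. if n = 0 then 1 else 0 :: complex) = 1"
    using suminf_finite[of "{0::nat}" "\<lambda>n. if n = 0 then 1 else 0 :: complex"] by simp
  finally show ?thesis .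
qed

text \<open>Iterating the recursion relates the sum at c to the sum at c + m + 1, which tends to 1.
  The four Pochhammer symbols become Gauss products for 1/Gamma; the powers of m cancel because
  (c-a) + (c-b) = c - beta.\<close>

theorem gauss_hypergeometric_sum:
  assumes c: "c > 0" and ab: "a + b = of_real (c + \<beta>)" and \<beta>: "\<beta> < 0"
  shows "suminf (hcoef a b c) =
    of_real (Gamma c) * of_real (Gamma (- \<beta>)) * rGamma (of_real c - a) * rGamma (of_real c - b)"
proof -
  let ?a = "of_real c - a" and ?b = "of_real c - b"
  have "\<forall>\<^sub>F m in sequentially. rGamma_series ?a m * rGamma_series ?b m * suminf (hcoef a b (c + real (Suc m))) =
      rGamma_series (of_real c) m * rGamma_series (of_real (- \<beta>)) m * suminf (hcoef a b c)"
    using eventually_gt_at_top[of 0]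
  proof eventually_elim
    case (elim m)
    let ?e = "\<lambda>z::complex. exp (z * of_real (ln (real m)))"
    have "?a + ?b = of_real c + of_real (- \<beta>)" using ab by (simp add: algebra_simps)
    then have "?e (?a + ?b) = ?e (of_real c + of_real (- \<beta>))" by (rule arg_cong)
    then have e: "?e ?a * ?e ?b = ?e (of_real c) * ?e (of_real (- \<beta>))" by (simp only: exp_add distrib_right)
    have "rGamma_series ?a m * rGamma_series ?b m * suminf (hcoef a b (c + real (Suc m))) =
       (pochhammer ?a (Suc m) * pochhammer ?b (Suc m) * suminf (hcoef a b (c + real (Suc m)))) / (fact m * fact m * (?e ?a * ?e ?b))"
      by (simp add: rGamma_series_def mult_ac del: of_nat_Suc)
    also have "\<dots> = rGamma_series (of_real c) m * rGamma_series (of_real (- \<beta>)) m * suminf (hcoef a b c)"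
      unfolding hcoef_sum_pochhammer[OF assms] e by (simp add: rGamma_series_def mult_ac)
    finally show ?case .
  qed
  moreover have "(\<lambda>m. rGamma_series ?a m * rGamma_series ?b m * suminf (hcoef a b (c + real (Suc m)))) \<longlonglongrightarrow> rGamma ?a * rGamma ?b * 1"
    using LIMSEQ_Suc[OF hcoef_sum_tendsto_1[OF assms]] by (intro tendsto_intros)
  ultimately have L1: "(\<lambda>m. rGamma_series (of_real c) m * rGamma_series (of_real (- \<beta>)) m * suminf (hcoef a b c)) \<longlonglongrightarrow> rGamma ?a * rGamma ?b * 1"
    by (rule Lim_transform_eventually[rotated])
  have L2: "(\<lambda>m. rGamma_series (of_real c) m * rGamma_series (of_real (- \<beta>)) m * suminf (hcoef a b c)) \<longlonglongrightarrow>
      rGamma (of_real c) * rGamma (of_real (- \<beta>)) * suminf (hcoef a b c)"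
    by (intro tendsto_intros)
  from LIMSEQ_unique[OF L2 L1]
  have eq: "rGamma ?a * rGamma ?b = rGamma (of_real c) * rGamma (of_real (- \<beta>)) * suminf (hcoef a b c)"
    by (simp only: mult_1_right)
  have "of_real (Gamma c) * of_real (Gamma (- \<beta>)) * rGamma ?a * rGamma ?b =
     (of_real (Gamma c) * rGamma (of_real c)) * (of_real (Gamma (- \<beta>)) * rGamma (of_real (- \<beta>))) * suminf (hcoef a b c)"
    unfolding mult.assoc[of _ "rGamma ?a"] eq by (simp only: mult_ac)
  also have "\<dots> = suminf (hcoef a b c)"
    using of_real_Gamma_rGamma[OF c] of_real_Gamma_rGamma[of "- \<beta>"] \<beta> by (simp only: neg_0_less_iff_less mult_1)
  finally show ?thesis by (rule sym)
qed

section \<open>Two-term expansion at the argument 1, including the logarithmic case\<close>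

lemma notin_nonpos_Ints_between:
  assumes "-1 < (x::real)" "x < 0"
  shows "x \<notin> \<int>\<^sub>\<le>\<^sub>0"
proof
  assume "x \<in> \<int>\<^sub>\<le>\<^sub>0"
  then obtain n where n: "x = of_int n" by (elim nonpos_Ints_cases)
  with assms have "real_of_int (-1) < of_int n" "real_of_int n < of_int 0" by auto
  then have "-1 < n" "n < 0" by (simp_all only: of_int_less_iff)
  then show False by linarith
qed

lemma hyp_diff_value_at_1:
  assumes c: "c > 0" and ab: "a + b = of_real (c + \<beta>)" and \<delta>: "0 < \<delta>" "\<delta> \<le> 1" "\<beta> + \<delta> < 0"
    and t: "0 \<le> t" "t < 1"
  shows "norm (hyp a b c (of_real t) - suminf (hcoef a b c)) \<le> (\<Sum>n. norm (hcoef a b c n) * real n powr \<delta>) * (1 - t) powr \<delta>"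
proof -
  \<comment> \<open>Interpolation between two bounds: 1 - t^n is at most 1 and, by Bernoulli, at
    most n(1-t), hence at most the delta-th power of the latter.\<close>
  have pw: "1 - t ^ n \<le> real n powr \<delta> * (1 - t) powr \<delta>" for n
  proof (cases "n = 0")
    case False
    define x where "x = 1 - t ^ n"
    have x: "0 \<le> x" "x \<le> 1" using t by (auto simp: x_def power_le_one)
    have "1 + real n * (t - 1) \<le> (1 + (t - 1)) ^ n" using t by (intro Bernoulli_inequality) auto
    then have "x \<le> real n * (1 - t)" by (simp add: x_def algebra_simps)
    have "x \<le> x powr \<delta>"
    proof (cases "x = 0")
      case False
      then have "x powr 1 \<le> x powr \<delta>" using x \<delta> by (intro powr_mono') auto
      then show ?thesis using x by simp
    qed auto
    also have "\<dots> \<le> (real n * (1 - t)) powr \<delta>" using x \<delta> \<open>x \<le> real n * (1 - t)\<close> by (intro powr_mono2) auto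
    also have "\<dots> = real n powr \<delta> * (1 - t) powr \<delta>" using t by (intro powr_mult)
    finally show ?thesis by (simp add: x_def)
  qed auto
  have s: "summable (\<lambda>n. norm (hcoef a b c n) * real n powr \<delta>)"
    using assms by (intro summable_norm_hcoef_weighted[of c a b \<beta>]) auto
  have "(\<lambda>n. hcoef a b c n * of_real t ^ n - hcoef a b c n) sums (hyp a b c (of_real t) - suminf (hcoef a b c))"
    using assms by (intro sums_diff psum_sums summable_sums summable_norm_cancel[OF summable_norm_hcoef[of c a b \<beta>]]) auto
  then have "norm (hyp a b c (of_real t) - suminf (hcoef a b c)) \<le> (\<Sum>n. norm (hcoef a b c n) * real n powr \<delta> * (1 - t) powr \<delta>)"
  proof (subst sums_unique, assumption, intro norm_suminf_le)
    fix n
    have "hcoef a b c n * of_real t ^ n - hcoef a b c n = - hcoef a b c n * of_real (1 - t ^ n)"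
      by (simp add: algebra_simps)
    then have "norm (hcoef a b c n * of_real t ^ n - hcoef a b c n) = norm (hcoef a b c n) * (1 - t ^ n)"
      using t by (simp only: norm_mult norm_minus_cancel norm_of_real) (simp add: power_le_one)
    also have "\<dots> \<le> norm (hcoef a b c n) * (real n powr \<delta> * (1 - t) powr \<delta>)"
      by (intro mult_left_mono pw) auto
    finally show "norm (hcoef a b c n * of_real t ^ n - hcoef a b c n) \<le> norm (hcoef a b c n) * real n powr \<delta> * (1 - t) powr \<delta>"
      by (simp add: mult_ac)
  qed (use s in \<open>auto intro: summable_mult2\<close>)
  also have "\<dots> = (\<Sum>n. norm (hcoef a b c n) * real n powr \<delta>) * (1 - t) powr \<delta>"
    using s by (rule suminf_mult2[symmetric])
  finally show ?thesis .
qed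

lemma hyp_of_real_has_vector_derivative:
  assumes "c > 0" "\<bar>t\<bar> < 1"
  shows "((\<lambda>t. hyp a b c (of_real t)) has_vector_derivative psum (diffs (hcoef a b c)) (of_real t)) (at t)"
  using assms by (intro has_vector_derivative_real_field psum_has_field_derivative) auto

text \<open>Integrates a derivative bound up to the singular endpoint, where only the limit of the
  function is known. The comparison function is -(M/p)(1-t)^p, which vanishes there.\<close>

lemma norm_diff_limit_le:
  fixes \<Phi> :: "real \<Rightarrow> complex"
  assumes p: "p > 0" and M: "M \<ge> 0" and t0: "t0 < 1"
    and d: "\<And>t. t0 \<le> t \<Longrightarrow> t < 1 \<Longrightarrow> (\<Phi> has_vector_derivative \<Phi>' t) (at t)"
    and b: "\<And>t. t0 \<le> t \<Longrightarrow> t < 1 \<Longrightarrow> norm (\<Phi>' t) \<le> M * (1 - t) powr (p - 1)"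
    and lim: "(\<Phi> \<longlongrightarrow> k) (at_left 1)"
  shows "norm (k - \<Phi> t0) \<le> M / p * (1 - t0) powr p"
proof (rule tendsto_upperbound)
  show "((\<lambda>t. norm (\<Phi> t - \<Phi> t0)) \<longlongrightarrow> norm (k - \<Phi> t0)) (at_left 1)"
    using lim by (intro tendsto_intros)
  have "\<forall>\<^sub>F t in at_left (1::real). t0 < t \<and> t < 1"
    using t0 by (intro eventually_at_leftI[of t0]) auto
  then show "\<forall>\<^sub>F t in at_left 1. norm (\<Phi> t - \<Phi> t0) \<le> M / p * (1 - t0) powr p"
  proof eventually_elim
    case (elim t)
    have "norm (\<Phi> t - \<Phi> t0) \<le> - (M / p) * (1 - t) powr p - (- (M / p) * (1 - t0) powr p)"
    proof (rule norm_diff_le_of_deriv_le[of t0 t \<Phi> \<Phi>' "\<lambda>t. - (M / p) * (1 - t) powr p" "\<lambda>t. M * (1 - t) powr (p - 1)"])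
      fix x assume x: "x \<in> {t0..t}"
      show "((\<lambda>t. - (M / p) * (1 - t) powr p) has_real_derivative M * (1 - x) powr (p - 1)) (at x)"
        using x elim p by (auto intro!: derivative_eq_intros simp: powr_diff divide_simps)
    qed (use elim d b in auto)
    also have "\<dots> \<le> M / p * (1 - t0) powr p"
      using M p by simp
    finally show ?case .
  qed
qed auto

text \<open>For $\beta = a + b - c$ the contiguous relation reads
  $((1-t)^\beta (F - k_2))' = (1-t)^{\beta-1} \kappa (F_{c+1}(t) - F_{c+1}(1))$; the bound below does not
  depend on $\beta$ because the coefficients decrease in $c$.\<close>
lemma hyp_expansion_at_1_uniform:
  fixes a b :: complex and s \<beta>0 :: real
  defines "k1 \<equiv> \<lambda>\<beta>. of_real (Gamma (s - \<beta>)) * of_real (Gamma \<beta>) * rGamma a * rGamma b"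
    and "k2 \<equiv> \<lambda>\<beta>. of_real (Gamma (s - \<beta>)) * of_real (Gamma (- \<beta>)) * rGamma (of_real (s - \<beta>) - a) * rGamma (of_real (s - \<beta>) - b)"
  assumes ab: "a + b = of_real s" and \<beta>0: "0 < \<beta>0" "\<beta>0 < 1" "\<beta>0 < s"
  obtains C \<delta> where "\<delta> > 0" "\<And>\<beta> t. 0 < \<beta> \<Longrightarrow> \<beta> \<le> \<beta>0 \<Longrightarrow> 0 \<le> t \<Longrightarrow> t < 1 \<Longrightarrow>
      norm (hyp a b (s - \<beta>) (of_real t) - k2 \<beta> - k1 \<beta> * of_real ((1 - t) powr (- \<beta>))) \<le> C * (1 - t) powr \<delta>"
proof -
  \<comment> \<open>Half the distance of beta0 from 1, so that the shifted excess beta - 1 plus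
    delta stays negative for all beta up to beta0 and the weighted coefficient sum
    converges.\<close>
  define \<delta> where "\<delta> = (1 - \<beta>0) / 2"
  have \<delta>: "0 < \<delta>" "\<delta> \<le> 1" "\<beta>0 - 1 + \<delta> < 0" using \<beta>0 by (auto simp: \<delta>_def field_simps)
  define \<Sigma> where "\<Sigma> = (\<Sum>n. norm (hcoef a b (s - \<beta>0 + 1) n) * real n powr \<delta>)"
  have s0: "summable (\<lambda>n. norm (hcoef a b (s - \<beta>0 + 1) n) * real n powr \<delta>)"
    using ab \<beta>0 \<delta> by (intro summable_norm_hcoef_weighted[of _ a b "\<beta>0 - 1"]) auto
  have \<Sigma>: "\<Sigma> \<ge> 0" unfolding \<Sigma>_def by (intro suminf_nonneg s0) auto
  define K where "K = (s + norm a) * (s + norm b) / (s - \<beta>0)"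
  have K: "K \<ge> 0" using \<beta>0 by (simp add: K_def)
  show ?thesis
  proof (rule that[of \<delta> "K * \<Sigma> / \<delta>"])
    fix \<beta> t :: real assume \<beta>: "0 < \<beta>" "\<beta> \<le> \<beta>0" and t: "0 \<le> t" "t < 1"
    define c where "c = s - \<beta>"
    have c: "c > 0" and abc: "a + b = of_real (c + \<beta>)" using \<beta> \<beta>0 ab by (auto simp: c_def)
    have abc1: "a + b = of_real (c + 1 + (\<beta> - 1))" using abc by simp
    define \<kappa> where "\<kappa> = (of_real c - a) * (of_real c - b) / of_real c"
    define G where "G = suminf (hcoef a b (c + 1))"
    have \<kappa>: "norm \<kappa> \<le> K"
    proof -
      have "norm (complex_of_real c) \<le> s" using c \<beta> by (simp only: norm_of_real) (simp add: c_def)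
      then have "norm (of_real c - a) \<le> s + norm a" "norm (of_real c - b) \<le> s + norm b"
        using norm_triangle_ineq4[of "of_real c" a] norm_triangle_ineq4[of "of_real c" b] by linarith+
      then have "norm \<kappa> \<le> (s + norm a) * (s + norm b) / c"
        unfolding \<kappa>_def norm_divide norm_mult using c by (auto intro!: divide_right_mono mult_mono intro: order_trans[OF norm_ge_zero])
      also have "\<dots> \<le> K" unfolding K_def using \<beta> \<beta>0 c by (intro divide_left_mono mult_nonneg_nonneg) (auto simp: c_def)
      finally show ?thesis .
    qed
    have G: "G = of_real (Gamma (c + 1)) * of_real (Gamma (1 - \<beta>)) * rGamma (of_real c - a + 1) * rGamma (of_real c - b + 1)"
      using gauss_hypergeometric_sum[OF _ abc1] c \<beta> \<beta>0 by (simp add: G_def algebra_simps)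
    have g1: "Gamma (c + 1) = c * Gamma c" using c by (intro Gamma_plus1) (auto elim!: nonpos_Ints_cases)
    have g2: "Gamma (1 - \<beta>) = - \<beta> * Gamma (- \<beta>)"
    proof -
      have "- \<beta> \<notin> \<int>\<^sub>\<le>\<^sub>0" using \<beta> \<beta>0 by (intro notin_nonpos_Ints_between) auto
      from Gamma_plus1[OF this] show ?thesis by simp
    qed
    have k2: "\<kappa> * G + of_real \<beta> * k2 \<beta> = 0"
      using c unfolding \<kappa>_def G k2_def g1 g2 c_def[symmetric]
      by (simp add: rGamma_plus1[of "of_real c - a", symmetric] rGamma_plus1[of "of_real c - b", symmetric] del: rGamma_plus1)
    define \<Phi> where "\<Phi> x = of_real ((1 - x) powr \<beta>) * (hyp a b c (of_real x) - k2 \<beta>)" for x :: real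
    define \<Phi>' where "\<Phi>' x = of_real ((1 - x) powr (\<beta> - 1)) * (\<kappa> * (hyp a b (c + 1) (of_real x) - G))" for x :: real
    have der: "(\<Phi> has_vector_derivative \<Phi>' x) (at x)" if x: "0 \<le> x" "x < 1" for x
    proof -
      let ?d = "psum (diffs (hcoef a b c)) (of_real x)"
      have "((\<lambda>x. (1 - x) powr \<beta>) has_real_derivative (- \<beta> * (1 - x) powr (\<beta> - 1))) (at x)"
        using x by (auto intro!: derivative_eq_intros simp: powr_diff divide_simps)
      then have "((\<lambda>x. complex_of_real ((1 - x) powr \<beta>)) has_vector_derivative of_real (- \<beta> * (1 - x) powr (\<beta> - 1))) (at x)"
        by (rule has_vector_derivative_of_real) 
      moreover have "((\<lambda>x. hyp a b c (of_real x) - k2 \<beta>) has_vector_derivative ?d - 0) (at x)"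
        using x c by (intro has_vector_derivative_diff hyp_of_real_has_vector_derivative has_vector_derivative_const) auto
      ultimately have "(\<Phi> has_vector_derivative (of_real ((1 - x) powr \<beta>) * (?d - 0) + of_real (- \<beta> * (1 - x) powr (\<beta> - 1)) * (hyp a b c (of_real x) - k2 \<beta>))) (at x)"
        unfolding \<Phi>_def by (rule has_vector_derivative_mult)
      moreover have "(of_real ((1 - x) powr \<beta>) * (?d - 0) + of_real (- \<beta> * (1 - x) powr (\<beta> - 1)) * (hyp a b c (of_real x) - k2 \<beta>)) = \<Phi>' x"
      proof -
        have "(1 - x) powr \<beta> = (1 - x) powr (\<beta> - 1) * (1 - x)" using x by (simp add: powr_diff)
        then have 1: "complex_of_real ((1 - x) powr \<beta>) = of_real ((1 - x) powr (\<beta> - 1)) * (1 - of_real x)" by simp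
        have 2: "(1 - of_real x) * ?d = \<kappa> * hyp a b (c + 1) (of_real x) + of_real \<beta> * hyp a b c (of_real x)"
          using hyp_contiguous[OF c, of "of_real x" a b] x abc by (simp add: \<kappa>_def)
        have "of_real ((1 - x) powr \<beta>) * (?d - 0) + of_real (- \<beta> * (1 - x) powr (\<beta> - 1)) * (hyp a b c (of_real x) - k2 \<beta>)
          = of_real ((1 - x) powr (\<beta> - 1)) * ((1 - of_real x) * ?d - of_real \<beta> * (hyp a b c (of_real x) - k2 \<beta>))"
          unfolding 1 by (simp add: algebra_simps)
        also have "(1 - of_real x) * ?d - of_real \<beta> * (hyp a b c (of_real x) - k2 \<beta>) = \<kappa> * (hyp a b (c + 1) (of_real x) - G)"
          unfolding 2 using k2 by (simp add: algebra_simps)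
        finally show ?thesis by (simp add: \<Phi>'_def)
      qed
      ultimately show ?thesis by simp
    qed
    have bd: "norm (\<Phi>' x) \<le> (K * \<Sigma>) * (1 - x) powr (\<beta> + \<delta> - 1)" if x: "0 \<le> x" "x < 1" for x
    proof -
      have "norm (hyp a b (c + 1) (of_real x) - G) \<le> (\<Sum>n. norm (hcoef a b (c + 1) n) * real n powr \<delta>) * (1 - x) powr \<delta>"
        unfolding G_def using c abc1 \<beta> \<delta> x by (intro hyp_diff_value_at_1[of "c + 1" a b "\<beta> - 1"]) auto
      also have "\<dots> \<le> \<Sigma> * (1 - x) powr \<delta>"
        unfolding \<Sigma>_def using c abc1 \<beta> \<beta>0 \<delta>
        by (intro mult_right_mono suminf_le s0 summable_norm_hcoef_weighted[of "c + 1" a b "\<beta> - 1"] norm_hcoef_antimono) (auto simp: c_def)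
      finally have "norm (\<Phi>' x) \<le> (1 - x) powr (\<beta> - 1) * (K * (\<Sigma> * (1 - x) powr \<delta>))"
        unfolding \<Phi>'_def norm_mult using \<kappa> K by (intro mult_mono) auto
      then show ?thesis by (simp add: powr_add powr_diff mult_ac)
    qed
    have lim: "(\<Phi> \<longlongrightarrow> k1 \<beta>) (at_left 1)"
    proof -
      have "((\<lambda>x. (1 - x) powr \<beta>) \<longlongrightarrow> (1 - 1) powr \<beta>) (at_left (1::real))"
        using \<beta> by (intro tendsto_intros) (auto simp: eventually_at_filter)
      then have "((\<lambda>x. of_real ((1 - x) powr \<beta>) * hyp a b c (of_real x) - of_real ((1 - x) powr \<beta>) * k2 \<beta>) \<longlongrightarrow>
         k1 \<beta> - of_real ((1 - 1) powr \<beta>) * k2 \<beta>) (at_left 1)"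
        unfolding k1_def c_def[symmetric] using c abc \<beta> by (intro tendsto_diff hyp_powr_tendsto tendsto_mult tendsto_const tendsto_of_real)
      then show ?thesis using \<beta> by (simp add: \<Phi>_def[abs_def] right_diff_distrib)
    qed
    have "norm (k1 \<beta> - \<Phi> t) \<le> (K * \<Sigma>) / (\<beta> + \<delta>) * (1 - t) powr (\<beta> + \<delta>)"
      using \<beta> \<delta> K \<Sigma> t der bd lim by (intro norm_diff_limit_le[of "\<beta> + \<delta>" _ t \<Phi> \<Phi>']) auto
    also have "\<dots> \<le> (K * \<Sigma>) / \<delta> * (1 - t) powr (\<beta> + \<delta>)"
      using \<beta> \<delta> K \<Sigma> by (intro mult_right_mono divide_left_mono) auto
    finally have "(1 - t) powr (- \<beta>) * norm (k1 \<beta> - \<Phi> t) \<le> (1 - t) powr (- \<beta>) * ((K * \<Sigma>) / \<delta> * (1 - t) powr (\<beta> + \<delta>))"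
      by (intro mult_left_mono) auto
    also have "(1 - t) powr (- \<beta>) * ((K * \<Sigma>) / \<delta> * (1 - t) powr (\<beta> + \<delta>)) = (K * \<Sigma>) / \<delta> * ((1 - t) powr (- \<beta>) * (1 - t) powr (\<beta> + \<delta>))"
      by (simp only: mult_ac)
    also have "(1 - t) powr (- \<beta>) * (1 - t) powr (\<beta> + \<delta>) = (1 - t) powr \<delta>" by (simp flip: powr_add)
    also have "(1 - t) powr (- \<beta>) * norm (k1 \<beta> - \<Phi> t) = norm (hyp a b (s - \<beta>) (of_real t) - k2 \<beta> - k1 \<beta> * of_real ((1 - t) powr (- \<beta>)))"
    proof -
      have "(1 - t) powr (- \<beta>) * (1 - t) powr \<beta> = 1" using t by (simp flip: powr_add)
      then have 1: "complex_of_real ((1 - t) powr (- \<beta>)) * of_real ((1 - t) powr \<beta>) = 1" by (metis of_real_mult of_real_1)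
      have "complex_of_real ((1 - t) powr (- \<beta>)) * \<Phi> t = hyp a b c (of_real t) - k2 \<beta>"
        unfolding \<Phi>_def mult.assoc[symmetric] 1 by simp
      then have "hyp a b c (of_real t) - k2 \<beta> - k1 \<beta> * of_real ((1 - t) powr (- \<beta>)) = - (of_real ((1 - t) powr (- \<beta>)) * (k1 \<beta> - \<Phi> t))"
        by (simp add: algebra_simps)
      then show ?thesis by (simp add: norm_mult c_def)
    qed
    finally show "norm (hyp a b (s - \<beta>) (of_real t) - k2 \<beta> - k1 \<beta> * of_real ((1 - t) powr (- \<beta>))) \<le> K * \<Sigma> / \<delta> * (1 - t) powr \<delta>" .
  qed (use \<delta> in auto)
qed

lemma powr_tendsto_0_at_left_1: "\<delta> > 0 \<Longrightarrow> ((\<lambda>t. C * (1 - t) powr \<delta>) \<longlongrightarrow> 0) (at_left (1::real))"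
proof -
  assume "\<delta> > 0"
  then have "((\<lambda>t. C * (1 - t) powr \<delta>) \<longlongrightarrow> C * (1 - 1) powr \<delta>) (at_left (1::real))"
    by (intro tendsto_intros) (auto simp: eventually_at_filter)
  then show ?thesis by simp
qed

lemma eventually_at_left_1_01: "\<forall>\<^sub>F t in at_left (1::real). 0 < t \<and> t < 1"
  by (intro eventually_at_leftI[of 0]) auto

lemma hyp_expansion_at_1_pos:
  assumes c: "c > 0" and ab: "a + b = of_real (c + \<beta>)" and \<beta>: "0 < \<beta>" "\<beta> < 1"
  shows "((\<lambda>t. hyp a b c (of_real t) - of_real (Gamma c) * of_real (Gamma \<beta>) * rGamma a * rGamma b * of_real ((1 - t) powr (- \<beta>)))
     \<longlongrightarrow> of_real (Gamma c) * of_real (Gamma (- \<beta>)) * rGamma (of_real c - a) * rGamma (of_real c - b)) (at_left 1)"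
proof -
  obtain C \<delta> where \<delta>: "\<delta> > 0" and *: "\<And>\<beta>' t. 0 < \<beta>' \<Longrightarrow> \<beta>' \<le> \<beta> \<Longrightarrow> 0 \<le> t \<Longrightarrow> t < 1 \<Longrightarrow>
      norm (hyp a b (c + \<beta> - \<beta>') (of_real t) - 
       (of_real (Gamma (c + \<beta> - \<beta>')) * of_real (Gamma (- \<beta>')) * rGamma (of_real (c + \<beta> - \<beta>') - a) * rGamma (of_real (c + \<beta> - \<beta>') - b)) -
       (of_real (Gamma (c + \<beta> - \<beta>')) * of_real (Gamma \<beta>') * rGamma a * rGamma b) * of_real ((1 - t) powr (- \<beta>'))) \<le> C * (1 - t) powr \<delta>"
    using hyp_expansion_at_1_uniform[OF ab \<beta>] c by (metis less_add_same_cancel2)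
  show ?thesis
    apply (rule LIM_zero_cancel, rule Lim_null_comparison[OF _ powr_tendsto_0_at_left_1[OF \<delta>, of C]])
    using eventually_at_left_1_01
  proof eventually_elim
    case (elim t)
    then show ?case using *[of \<beta> t] \<beta> by (simp add: diff_diff_eq add.commute)
  qed
qed

text \<open>At fixed t, beta tends to 0 in the uniform expansion. The constants \<open>k1\<close>
  and \<open>k2\<close> each blow up like 1/beta, but together they form a difference quotient at 0,
  and its limit contains both the logarithm and the derivatives of 1/Gamma.\<close>

lemma hyp_expansion_at_1_zero:
  assumes c: "c > 0" and ab: "a + b = of_real c"
  shows "((\<lambda>t. hyp a b c (of_real t) + of_real (Gamma c) * rGamma a * rGamma b * of_real (ln (1 - t)))
     \<longlongrightarrow> of_real (Gamma c) * (deriv rGamma a * rGamma b + rGamma a * deriv rGamma b - 2 * euler_mascheroni * rGamma a * rGamma b)) (at_left 1)"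
    (is "(_ \<longlongrightarrow> ?L) _")
proof -
  define \<beta>0 where "\<beta>0 = min (1/2) (c/2)"
  have \<beta>0: "0 < \<beta>0" "\<beta>0 < 1" "\<beta>0 < c" using c by (auto simp: \<beta>0_def)
  define k1 k2 where "k1 \<beta> = of_real (Gamma (c - \<beta>)) * of_real (Gamma \<beta>) * rGamma a * rGamma b" 
    and "k2 \<beta> = of_real (Gamma (c - \<beta>)) * of_real (Gamma (- \<beta>)) * rGamma (of_real (c - \<beta>) - a) * rGamma (of_real (c - \<beta>) - b)" for \<beta>
  obtain C \<delta> where \<delta>: "\<delta> > 0" and *: "\<And>\<beta> t. 0 < \<beta> \<Longrightarrow> \<beta> \<le> \<beta>0 \<Longrightarrow> 0 \<le> t \<Longrightarrow> t < 1 \<Longrightarrow>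
      norm (hyp a b (c - \<beta>) (of_real t) - k2 \<beta> - k1 \<beta> * of_real ((1 - t) powr (- \<beta>))) \<le> C * (1 - t) powr \<delta>"
    using hyp_expansion_at_1_uniform[OF ab \<beta>0] unfolding k1_def k2_def by metis
  have ev: "\<forall>\<^sub>F \<beta> in at_right (0::real). 0 < \<beta> \<and> \<beta> \<le> \<beta>0"
    using \<beta>0 by (intro eventually_at_rightI[of 0 \<beta>0]) auto
  have key: "norm (hyp a b c (of_real t) + of_real (Gamma c) * rGamma a * rGamma b * of_real (ln (1 - t)) - ?L) \<le> C * (1 - t) powr \<delta>"
    if t: "0 < t" "t < 1" for t
  proof -
    have l1: "((\<lambda>\<beta>. hyp a b (c - \<beta>) (of_real t)) \<longlongrightarrow> hyp a b c (of_real t)) (at_right 0)"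
      unfolding psum_def
    proof (rule tannerys_theorem[THEN conjunct2, THEN conjunct2])
      fix k
      have "((\<lambda>\<beta>. pochhammer (c - \<beta>) k) \<longlongrightarrow> pochhammer (c - 0) k) (at_right 0)"
        by (intro isCont_tendsto_compose[OF isCont_pochhammer] tendsto_intros)
      then have "((\<lambda>\<beta>. pochhammer (c - \<beta>) k) \<longlongrightarrow> pochhammer c k) (at_right 0)" by simp
      moreover have "pochhammer c k > 0" using c by (rule pochhammer_pos)
      ultimately show "((\<lambda>\<beta>. hcoef a b (c - \<beta>) k * complex_of_real t ^ k) \<longlongrightarrow> hcoef a b c k * complex_of_real t ^ k) (at_right 0)"
        unfolding hcoef_def by (intro tendsto_intros) auto
    next
      have "\<forall>\<^sub>F (k::nat, \<beta>) in at_top \<times>\<^sub>F at_right (0::real). 0 < \<beta> \<and> \<beta> \<le> \<beta>0"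
        using ev by (subst eventually_prod2) auto
      then show "\<forall>\<^sub>F (k, \<beta>) in sequentially \<times>\<^sub>F at_right 0. norm (hcoef a b (c - \<beta>) k * complex_of_real t ^ k) \<le> norm (hcoef a b (c - \<beta>0) k) * t ^ k"
        using \<beta>0 t by (elim eventually_mono) (auto simp: norm_mult norm_power intro!: mult_right_mono norm_hcoef_antimono)
      have "summable (\<lambda>n. hcoef a b (c - \<beta>0) n * of_real ((1 + t) / 2) ^ n)"
        using disc_summable_hcoef[of "c - \<beta>0" a b] \<beta>0 t unfolding disc_summable_def
        by (auto simp del: of_real_add of_real_divide)
      from powser_insidea[OF this, of "of_real t"] show "summable (\<lambda>k. norm (hcoef a b (c - \<beta>0) k) * t ^ k)"
        using t by (simp add: norm_mult norm_power del: of_real_add of_real_divide)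
    qed auto
    \<comment> \<open>Up to the factor Gamma(c - beta), u(beta)/beta is \<open>k2\<close> plus
      \<open>k1\<close> times (1-t)^(-beta); the poles of Gamma(beta) and Gamma(-beta) are removed
      by the functional equation. Since u(0) = 0, the quotient converges to u'(0). The two Gamma
      factors contribute Gamma'(1) each, that is twice minus Euler's constant.\<close>
    define u :: "complex \<Rightarrow> complex" where
      "u w = Gamma (1 + w) * rGamma a * rGamma b * exp (- w * of_real (ln (1 - t))) - Gamma (1 - w) * rGamma (a - w) * rGamma (b - w)" for w
    have dr: "(rGamma has_field_derivative deriv rGamma z) (at z)" for z :: complex
      using DERIV_deriv_iff_field_differentiable field_differentiable_rGamma by blast
    define ra rb where "ra w = rGamma (a - w)" and "rb w = rGamma (b - w)" for w
    have "(ra has_field_derivative deriv rGamma a * (0 - 1)) (at 0)" "(rb has_field_derivative deriv rGamma b * (0 - 1)) (at 0)"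
      unfolding ra_def rb_def by (rule DERIV_chain2[OF _ DERIV_diff[OF DERIV_const DERIV_ident]], simp add: dr)+
    note d = this
    have "(u has_field_derivative (- 2 * euler_mascheroni * rGamma a * rGamma b - rGamma a * rGamma b * of_real (ln (1 - t))
        + (deriv rGamma a * rGamma b + rGamma a * deriv rGamma b))) (at 0)"
      unfolding u_def ra_def[symmetric] rb_def[symmetric]
      by (auto intro!: derivative_eq_intros d simp: algebra_simps) (simp_all add: ra_def rb_def algebra_simps)
    then have "((\<lambda>w. u w / w) \<longlongrightarrow> (- 2 * euler_mascheroni * rGamma a * rGamma b - rGamma a * rGamma b * of_real (ln (1 - t))
        + (deriv rGamma a * rGamma b + rGamma a * deriv rGamma b))) (at 0)"
      by (simp add: has_field_derivative_iff u_def)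
    moreover have "filterlim complex_of_real (at 0) (at_right 0)"
      unfolding filterlim_at by (auto intro!: tendsto_eq_intros simp: eventually_at_filter)
    ultimately have l2: "((\<lambda>\<beta>. u (of_real \<beta>) / of_real \<beta>) \<longlongrightarrow> (- 2 * euler_mascheroni * rGamma a * rGamma b - rGamma a * rGamma b * of_real (ln (1 - t))
        + (deriv rGamma a * rGamma b + rGamma a * deriv rGamma b))) (at_right 0)"
      by (rule filterlim_compose)
    have "((\<lambda>\<beta>. Gamma (c - \<beta>)) \<longlongrightarrow> Gamma (c - 0)) (at_right 0)"
      using c by (intro tendsto_intros) (auto elim!: nonpos_Ints_cases)
    then have l3: "((\<lambda>\<beta>. complex_of_real (Gamma (c - \<beta>)) * (u (of_real \<beta>) / of_real \<beta>)) \<longlongrightarrow> of_real (Gamma c) *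
       (- 2 * euler_mascheroni * rGamma a * rGamma b - rGamma a * rGamma b * of_real (ln (1 - t))
        + (deriv rGamma a * rGamma b + rGamma a * deriv rGamma b))) (at_right 0)"
      by (intro tendsto_mult l2 tendsto_of_real) simp
    have ku: "k2 \<beta> + k1 \<beta> * of_real ((1 - t) powr (- \<beta>)) = of_real (Gamma (c - \<beta>)) * (u (of_real \<beta>) / of_real \<beta>)"
      if \<beta>: "0 < \<beta>" "\<beta> \<le> \<beta>0" for \<beta>
    proof -
      have n1: "\<beta> \<notin> \<int>\<^sub>\<le>\<^sub>0" using \<beta> by (auto elim!: nonpos_Ints_cases)
      have n2: "- \<beta> \<notin> \<int>\<^sub>\<le>\<^sub>0" using \<beta> \<beta>0 by (intro notin_nonpos_Ints_between) auto
      have g1: "Gamma (1 + complex_of_real \<beta>) = of_real \<beta> * of_real (Gamma \<beta>)"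
        using Gamma_plus1[OF n1] Gamma_complex_of_real[of "\<beta> + 1"] by (simp add: add.commute)
      have g2: "Gamma (1 - complex_of_real \<beta>) = - of_real \<beta> * of_real (Gamma (- \<beta>))"
        using Gamma_plus1[OF n2] Gamma_complex_of_real[of "- \<beta> + 1"] by simp
      have b: "of_real (c - \<beta>) - a = b - of_real \<beta>" "of_real (c - \<beta>) - b = a - of_real \<beta>"
        using ab by (simp_all add: algebra_simps)
      have e: "complex_of_real ((1 - t) powr (- \<beta>)) = exp (- of_real \<beta> * of_real (ln (1 - t)))"
        using t by (simp add: powr_def exp_of_real[symmetric])
      show ?thesis unfolding k1_def k2_def u_def b e g1 g2 using \<beta> by (simp add: field_simps)
    qed
    have "((\<lambda>\<beta>. norm (hyp a b (c - \<beta>) (of_real t) - complex_of_real (Gamma (c - \<beta>)) * (u (of_real \<beta>) / of_real \<beta>))) \<longlongrightarrow>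
      norm (hyp a b c (of_real t) - of_real (Gamma c) * (- 2 * euler_mascheroni * rGamma a * rGamma b - rGamma a * rGamma b * of_real (ln (1 - t))
        + (deriv rGamma a * rGamma b + rGamma a * deriv rGamma b)))) (at_right 0)"
      by (intro tendsto_norm tendsto_diff l1 l3)
    then have "norm (hyp a b c (of_real t) - of_real (Gamma c) * (- 2 * euler_mascheroni * rGamma a * rGamma b - rGamma a * rGamma b * of_real (ln (1 - t))
        + (deriv rGamma a * rGamma b + rGamma a * deriv rGamma b))) \<le> C * (1 - t) powr \<delta>"
    proof (rule tendsto_upperbound)
      show "\<forall>\<^sub>F \<beta> in at_right 0. norm (hyp a b (c - \<beta>) (of_real t) - complex_of_real (Gamma (c - \<beta>)) * (u (of_real \<beta>) / of_real \<beta>)) \<le> C * (1 - t) powr \<delta>"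
        using ev
      proof eventually_elim
        case (elim \<beta>)
        then show ?case using *[of \<beta> t] ku[of \<beta>] t by (simp add: diff_diff_eq)
      qed
    qed auto
    then show ?thesis by (simp add: algebra_simps)
  qed
  show ?thesis
    apply (rule LIM_zero_cancel, rule Lim_null_comparison[OF _ powr_tendsto_0_at_left_1[OF \<delta>, of C]])
    using eventually_at_left_1_01 by eventually_elim (use key in auto)
qed

section \<open>Solutions near the endpoint -1\<close>

text \<open>The equation tau y = z y with the derivative carried out and the weight divided off. Its
  coefficients are polynomials in x, so changes of variable reduce to polynomial identities.\<close>

definition ode2 :: "real \<Rightarrow> real \<Rightarrow> complex \<Rightarrow> (real \<Rightarrow> complex) \<Rightarrow> (real \<Rightarrow> complex) \<Rightarrow> (real \<Rightarrow> complex) \<Rightarrow> bool" where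
  "ode2 a b z y y1 y2 \<longleftrightarrow> (\<forall>x\<in>{-1<..<1}. (y has_vector_derivative y1 x) (at x) \<and> (y1 has_vector_derivative y2 x) (at x) \<and>
     of_real (1 - x\<^sup>2) * y2 x + of_real (b - a - (a + b + 2) * x) * y1 x + z * y x = 0)"

definition solg :: "real \<Rightarrow> real \<Rightarrow> complex \<Rightarrow> (real \<Rightarrow> complex) \<Rightarrow> (real \<Rightarrow> complex) \<Rightarrow> bool" where
  "solg a b z u g \<longleftrightarrow> (\<forall>x\<in>{-1<..<1}.
      (u has_vector_derivative (g x / of_real (pw a b x))) (at x) \<and>
      (g has_vector_derivative (- of_real (rw a b x) * z * u x)) (at x))"

lemma sol_iff: "sol a b z u \<longleftrightarrow> (\<exists>g. solg a b z u g)"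
  by (simp add: sol_def solg_def)

lemma pw_pos: "-1 < x \<Longrightarrow> x < 1 \<Longrightarrow> pw a b x > 0"
  by (simp add: pw_def)

lemma rw_pos: "-1 < x \<Longrightarrow> x < 1 \<Longrightarrow> rw a b x > 0"
  by (simp add: rw_def)

lemma pw_rw: "-1 < x \<Longrightarrow> x < 1 \<Longrightarrow> pw a b x = rw a b x * (1 - x\<^sup>2)"
  by (simp add: pw_def rw_def powr_add power2_eq_square algebra_simps)

lemma has_real_derivative_pw:
  assumes "-1 < x" "x < 1"
  shows "(pw a b has_real_derivative rw a b x * (b - a - (a + b + 2) * x)) (at x)"
proof -
  have "((\<lambda>y. y powr (a + 1)) has_real_derivative (a + 1) * (1 - x) powr (a + 1 - 1)) (at (1 - x))"
    "((\<lambda>y. y powr (b + 1)) has_real_derivative (b + 1) * (1 + x) powr (b + 1 - 1)) (at (1 + x))"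
    by (rule has_real_derivative_powr, use assms in simp)+
  note p = this
  have d1: "((\<lambda>x. (1 - x) powr (a + 1)) has_real_derivative - ((a + 1) * (1 - x) powr a)) (at x)"
    by (rule DERIV_cong[OF DERIV_chain2[OF p(1) DERIV_diff[OF DERIV_const DERIV_ident]]]) simp
  have d2: "((\<lambda>x. (1 + x) powr (b + 1)) has_real_derivative (b + 1) * (1 + x) powr b) (at x)"
    by (rule DERIV_cong[OF DERIV_chain2[OF p(2) DERIV_add[OF DERIV_const DERIV_ident]]]) simp
  have "(1 - x) powr (a + 1) = (1 - x) powr a * (1 - x)" "(1 + x) powr (b + 1) = (1 + x) powr b * (1 + x)"
    using assms by (simp_all add: powr_add)
  note e = this
  show ?thesis
    unfolding pw_def[abs_def] rw_def
    by (rule DERIV_cong[OF DERIV_mult[OF d1 d2]]) (simp only: e, simp add: algebra_simps)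
qed

lemma has_vector_derivative_of_real_mult:
  fixes v :: "real \<Rightarrow> complex"
  assumes "(k has_real_derivative k') (at x)" "(v has_vector_derivative v') (at x)"
  shows "((\<lambda>x. of_real (k x) * v x) has_vector_derivative (of_real (k x) * v' + of_real k' * v x)) (at x)"
  using has_vector_derivative_of_real[OF assms(1)] assms(2) by (rule has_vector_derivative_mult)

lemma ode2_solg:
  assumes "ode2 a b z y y1 y2"
  shows "solg a b z y (\<lambda>x. of_real (pw a b x) * y1 x)"
  unfolding solg_def
proof (intro ballI conjI)
  fix x :: real assume "x \<in> {-1<..<1}"
  then have x: "-1 < x" "x < 1" by auto
  note y = assms[unfolded ode2_def, rule_format, OF \<open>x \<in> _\<close>]
  show "(y has_vector_derivative of_real (pw a b x) * y1 x / of_real (pw a b x)) (at x)"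
    using y pw_pos[OF x, of a b] by simp
  have "((\<lambda>x. of_real (pw a b x) * y1 x) has_vector_derivative
     (of_real (pw a b x) * y2 x + of_real (rw a b x * (b - a - (a + b + 2) * x)) * y1 x)) (at x)"
    using y by (intro has_vector_derivative_of_real_mult has_real_derivative_pw x) auto
  also have "of_real (pw a b x) * y2 x + of_real (rw a b x * (b - a - (a + b + 2) * x)) * y1 x
    = of_real (rw a b x) * (of_real (1 - x\<^sup>2) * y2 x + of_real (b - a - (a + b + 2) * x) * y1 x)"
    by (simp only: pw_rw[OF x] of_real_mult distrib_left mult.assoc)
  also have "of_real (1 - x\<^sup>2) * y2 x + of_real (b - a - (a + b + 2) * x) * y1 x = - (z * y x)"
    using y by (simp only: add_eq_0_iff2)
  finally show "((\<lambda>x. of_real (pw a b x) * y1 x) has_vector_derivative - of_real (rw a b x) * z * y x) (at x)"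
    by (simp add: mult.assoc)
qed

text \<open>The substitution x -> -x exchanges the endpoints together with alpha and beta. Series
  are therefore expanded only at 1, and those at -1 are reflections.\<close>

lemma ode2_reflect:
  assumes "ode2 a b z y y1 y2"
  shows "ode2 b a z (\<lambda>x. y (- x)) (\<lambda>x. - y1 (- x)) (\<lambda>x. y2 (- x))"
  unfolding ode2_def
proof (intro ballI conjI)
  fix x :: real assume x: "x \<in> {-1<..<1}"
  then have "- x \<in> {-1<..<1}" by auto
  note y = assms[unfolded ode2_def, rule_format, OF this]
  have m: "((\<lambda>x. - x) has_vector_derivative (- 1)) (at x)" for x :: real
    by (auto intro!: derivative_eq_intros)
  show "((\<lambda>x. y (- x)) has_vector_derivative - y1 (- x)) (at x)"
    using vector_diff_chain_at[OF m, of y "y1 (- x)" x] y by (simp add: o_def)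
  show "((\<lambda>x. - y1 (- x)) has_vector_derivative y2 (- x)) (at x)"
    using has_vector_derivative_minus[OF vector_diff_chain_at[OF m, of y1 "y2 (- x)" x]] y by (simp add: o_def)
  show "of_real (1 - x\<^sup>2) * y2 (- x) + of_real (a - b - (b + a + 2) * x) * - y1 (- x) + z * y (- x) = 0"
    using y by (simp add: algebra_simps)
qed

text \<open>Splitting off (1-x)^(-a), the second Frobenius factor at 1, leads back to the same type
  of equation with a replaced by -a and a shifted spectral parameter. This yields the solution
  distinguished at 1 when a <= -1 and, after reflection, the singular solution at -1 when b is
  nonzero.\<close>

lemma ode2_gauge:
  assumes "ode2 (- a) b (z + of_real (a * (b + 1))) v v1 v2"
  shows "ode2 a b z (\<lambda>x. of_real ((1 - x) powr (- a)) * v x)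
     (\<lambda>x. of_real ((1 - x) powr (- a)) * (v1 x + of_real (a / (1 - x)) * v x))
     (\<lambda>x. of_real ((1 - x) powr (- a)) * (v2 x + of_real (2 * a / (1 - x)) * v1 x + of_real (a * (a + 1) / (1 - x)\<^sup>2) * v x))"
  unfolding ode2_def
proof (intro ballI conjI)
  fix x :: real assume x: "x \<in> {-1<..<1}"
  note v = assms[unfolded ode2_def, rule_format, OF x]
  define K where "K = (1 - x) powr (- a)"
  \<comment> \<open>With w for 1/(1-x), the claim becomes a polynomial identity modulo the single
    relation w(1-x) = 1.\<close>
  define w where "w = 1 / (1 - x)"
  have w: "w * (1 - x) = 1" using x by (simp add: w_def)
  have k: "((\<lambda>x. (1 - x) powr (- a)) has_real_derivative K * (a * w)) (at x)"
    using x by (auto intro!: derivative_eq_intros simp: K_def w_def powr_diff field_simps)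
  have h: "((\<lambda>x. a / (1 - x)) has_real_derivative a * w\<^sup>2) (at x)"
    using x by (auto intro!: derivative_eq_intros simp: w_def power2_eq_square)
  show "((\<lambda>x. of_real ((1 - x) powr (- a)) * v x) has_vector_derivative
     of_real ((1 - x) powr (- a)) * (v1 x + of_real (a / (1 - x)) * v x)) (at x)"
    using has_vector_derivative_of_real_mult[OF k, of v "v1 x"] v
    by (simp add: K_def[symmetric] w_def algebra_simps)
  have "((\<lambda>x. v1 x + of_real (a / (1 - x)) * v x) has_vector_derivative
     v2 x + (of_real (a / (1 - x)) * v1 x + of_real (a * w\<^sup>2) * v x)) (at x)"
    using v by (intro has_vector_derivative_add has_vector_derivative_of_real_mult h) auto
  from has_vector_derivative_of_real_mult[OF k this]
  show "((\<lambda>x. of_real ((1 - x) powr (- a)) * (v1 x + of_real (a / (1 - x)) * v x)) has_vector_derivative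
     of_real ((1 - x) powr (- a)) * (v2 x + of_real (2 * a / (1 - x)) * v1 x + of_real (a * (a + 1) / (1 - x)\<^sup>2) * v x)) (at x)"
    by (simp add: K_def[symmetric] w_def algebra_simps power2_eq_square add_divide_distrib)
  have e: "a / (1 - x) = a * w" "2 * a / (1 - x) = 2 * a * w" "a * (a + 1) / (1 - x)\<^sup>2 = a * (a + 1) * w\<^sup>2"
    by (simp_all add: w_def power_divide)
  have wc: "of_real w * (1 - of_real x) = (1 :: complex)" using w by (metis of_real_1 of_real_diff of_real_mult)
  have "of_real (1 - x\<^sup>2) * (v2 x + of_real (2 * a * w) * v1 x + of_real (a * (a + 1) * w\<^sup>2) * v x)
     + of_real (b - a - (a + b + 2) * x) * (v1 x + of_real (a * w) * v x) + z * v x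
     = of_real (1 - x\<^sup>2) * v2 x + of_real (b - (- a) - (- a + b + 2) * x) * v1 x + (z + of_real (a * (b + 1))) * v x"
    using wc unfolding of_real_mult of_real_add of_real_diff of_real_minus of_real_power of_real_1 of_real_numeral by algebra
  also have "\<dots> = 0" using v by simp
  finally have "of_real K * (of_real (1 - x\<^sup>2) * (v2 x + of_real (2 * a * w) * v1 x + of_real (a * (a + 1) * w\<^sup>2) * v x)
     + of_real (b - a - (a + b + 2) * x) * (v1 x + of_real (a * w) * v x) + z * v x) = 0" by simp
  then show "of_real (1 - x\<^sup>2) * (of_real ((1 - x) powr (- a)) * (v2 x + of_real (2 * a / (1 - x)) * v1 x + of_real (a * (a + 1) / (1 - x)\<^sup>2) * v x))
     + of_real (b - a - (a + b + 2) * x) * (of_real ((1 - x) powr (- a)) * (v1 x + of_real (a / (1 - x)) * v x))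
     + z * (of_real ((1 - x) powr (- a)) * v x) = 0"
    unfolding e K_def[symmetric] by algebra
qed

lemma ode2_hypergeometric:
  assumes "\<And>t. 0 < t \<Longrightarrow> t < 1 \<Longrightarrow> (Y has_vector_derivative Y1 t) (at t)"
    and "\<And>t. 0 < t \<Longrightarrow> t < 1 \<Longrightarrow> (Y1 has_vector_derivative Y2 t) (at t)"
    and "\<And>t. 0 < t \<Longrightarrow> t < 1 \<Longrightarrow> of_real (t * (1 - t)) * Y2 t + of_real (1 + a - (a + b + 2) * t) * Y1 t + z * Y t = 0"
  shows "ode2 a b z (\<lambda>x. Y ((1 - x) / 2)) (\<lambda>x. - Y1 ((1 - x) / 2) / 2) (\<lambda>x. Y2 ((1 - x) / 2) / 4)"
  unfolding ode2_def
proof (intro ballI conjI)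
  fix x :: real assume x: "x \<in> {-1<..<1}"
  define t where "t = (1 - x) / 2"
  have t: "0 < t" "t < 1" using x by (auto simp: t_def)
  have m: "((\<lambda>x. (1 - x) / 2) has_vector_derivative (- 1 / 2)) (at x)"
    by (auto intro!: derivative_eq_intros)
  show "((\<lambda>x. Y ((1 - x) / 2)) has_vector_derivative - Y1 ((1 - x) / 2) / 2) (at x)"
    using vector_diff_chain_at[OF m, of Y "Y1 t"] assms(1)[OF t] by (simp add: o_def t_def scaleR_conv_of_real)
  have "((\<lambda>x. Y1 ((1 - x) / 2)) has_vector_derivative (- 1 / 2) *\<^sub>R Y2 t) (at x)"
    using vector_diff_chain_at[OF m, of Y1 "Y2 t"] assms(2)[OF t] by (simp add: o_def t_def)
  from has_vector_derivative_mult_right[OF this, of "- 1 / 2"]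
  show "((\<lambda>x. - Y1 ((1 - x) / 2) / 2) has_vector_derivative Y2 ((1 - x) / 2) / 4) (at x)"
    by (simp add: t_def scaleR_conv_of_real)
  have "x = 1 - 2 * t" by (simp add: t_def field_simps)
  then have x: "of_real x = 1 - 2 * complex_of_real t" by simp
  show "of_real (1 - x\<^sup>2) * (Y2 ((1 - x) / 2) / 4) + of_real (b - a - (a + b + 2) * x) * (- Y1 ((1 - x) / 2) / 2) + z * Y ((1 - x) / 2) = 0"
  proof -
    have "of_real (1 - x\<^sup>2) * (Y2 t / 4) + of_real (b - a - (a + b + 2) * x) * (- Y1 t / 2) + z * Y t =
       of_real (t * (1 - t)) * Y2 t + of_real (1 + a - (a + b + 2) * t) * Y1 t + z * Y t"
      unfolding of_real_diff of_real_power of_real_mult of_real_add of_real_1 of_real_numeral x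
      by (simp add: field_simps power2_eq_square)
    then show ?thesis using assms(3)[OF t] by (simp only: t_def[symmetric])
  qed
qed

lemma ode2_hyp:
  assumes a: "a > - 1" and AB: "A + B = of_real (1 + a + b)" "A * B = - z"
  shows "ode2 a b z (\<lambda>x. hyp A B (1 + a) (of_real ((1 - x) / 2)))
    (\<lambda>x. - psum (diffs (hcoef A B (1 + a))) (of_real ((1 - x) / 2)) / 2)
    (\<lambda>x. psum (diffs (diffs (hcoef A B (1 + a)))) (of_real ((1 - x) / 2)) / 4)"
proof (rule ode2_hypergeometric)
  fix t :: real assume t: "0 < t" "t < 1"
  have s: "disc_summable (hcoef A B (1 + a))" using a by auto
  show "((\<lambda>t. hyp A B (1 + a) (of_real t)) has_vector_derivative psum (diffs (hcoef A B (1 + a))) (of_real t)) (at t)"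
    using t s by (intro has_vector_derivative_real_field psum_has_field_derivative) auto
  show "((\<lambda>t. psum (diffs (hcoef A B (1 + a))) (of_real t)) has_vector_derivative psum (diffs (diffs (hcoef A B (1 + a)))) (of_real t)) (at t)"
    using t s by (intro has_vector_derivative_real_field psum_has_field_derivative disc_summable_diffs) auto
  have "A + B + 1 = of_real (a + b + 2)" using AB by simp
  then show "of_real (t * (1 - t)) * psum (diffs (diffs (hcoef A B (1 + a)))) (of_real t) +
     of_real (1 + a - (a + b + 2) * t) * psum (diffs (hcoef A B (1 + a))) (of_real t) + z * hyp A B (1 + a) (of_real t) = 0"
    using hyp_ode[of "1 + a" "of_real t" A B] a t AB by (simp add: add_ac)
qed

text \<open>Coefficients of the power series accompanying the logarithm in the second solution
  $\ln t \cdot F(A,B;1;t) + \sum_n d_n t^n$ of the resonant case.\<close>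
fun dcoef :: "complex \<Rightarrow> complex \<Rightarrow> nat \<Rightarrow> complex" where
  "dcoef A B 0 = 0"
| "dcoef A B (Suc n) = ((A + of_nat n) * (B + of_nat n) * dcoef A B n + (A + B + 2 * of_nat n) * hcoef A B 1 n
      - 2 * of_nat (Suc n) * hcoef A B 1 (Suc n)) / (of_nat (Suc n))\<^sup>2"

text \<open>The recurrence has source terms in \<open>hcoef\<close>, so the ratio test is applied to
  the sum of both norms. Its ratio \<open>q\<close> tends to 1, since the source terms carry a
  factor of order 1/n.\<close>

lemma disc_summable_dcoef: "disc_summable (dcoef A B)"
proof (rule disc_summable_ratio[where v = "\<lambda>n. norm (dcoef A B n) + norm (hcoef A B 1 n)"])
  define \<rho> where "\<rho> n = (A + of_nat n) * (B + of_nat n) / (of_nat (Suc n) * (of_real 1 + of_nat n))" for n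
  define q where "q n = norm (\<rho> n) * (1 + 2 / real (Suc n)) + (norm (A + B) / real (Suc n) + 2) / real (Suc n)" for n
  have "\<rho> \<longlonglongrightarrow> 1" unfolding \<rho>_def by (rule hcoef_ratio_tendsto)
  moreover have "(\<lambda>n. 2 / real (Suc n)) \<longlonglongrightarrow> 0" "(\<lambda>n. norm (A + B) / real (Suc n)) \<longlonglongrightarrow> 0" "(\<lambda>n. 1 / real (Suc n)) \<longlonglongrightarrow> 0"
    by (rule LIMSEQ_Suc[OF lim_const_over_n])+
  ultimately have "(\<lambda>n. norm (\<rho> n) * (1 + 2 / real (Suc n)) + (norm (A + B) / real (Suc n) + 2) * (1 / real (Suc n))) \<longlonglongrightarrow>
     norm (1 :: complex) * (1 + 0) + (0 + 2) * 0"
    by (intro tendsto_intros)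
  then have q: "q \<longlonglongrightarrow> 1" by (simp add: q_def[abs_def])
  have step: "norm (dcoef A B (Suc n)) + norm (hcoef A B 1 (Suc n)) \<le> q n * (norm (dcoef A B n) + norm (hcoef A B 1 n))" for n
  proof -
    let ?N = "of_nat (Suc n) :: complex" and ?d = "dcoef A B n" and ?c = "hcoef A B 1 n"
    have N: "?N \<noteq> 0" by (rule of_nat_neq_0)
    have N1: "of_real 1 + of_nat n = ?N" by simp
    have h: "hcoef A B 1 (Suc n) = \<rho> n * ?c" unfolding \<rho>_def by (rule hcoef_Suc')
    have "dcoef A B (Suc n) = \<rho> n * ?d + ((A + B) / ?N + 2 * of_nat n / ?N) / ?N * ?c - 2 / ?N * (\<rho> n * ?c)"
      unfolding dcoef.simps h unfolding \<rho>_def N1 using N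
      by (simp add: field_simps power2_eq_square del: of_nat_Suc)
    then have "norm (dcoef A B (Suc n)) \<le> norm (\<rho> n * ?d) + norm (((A + B) / ?N + 2 * of_nat n / ?N) / ?N * ?c) + norm (2 / ?N * (\<rho> n * ?c))"
      by (simp only:) (rule order_trans[OF norm_triangle_ineq4 add_right_mono[OF norm_triangle_ineq]])
    also have "norm (((A + B) / ?N + 2 * of_nat n / ?N) / ?N * ?c) \<le> (norm (A + B) / real (Suc n) + 2) / real (Suc n) * norm ?c"
    proof -
      have "norm ((A + B) / ?N + 2 * of_nat n / ?N) \<le> norm ((A + B) / ?N) + norm (2 * of_nat n / ?N)" by (rule norm_triangle_ineq)
      also have "\<dots> \<le> norm (A + B) / real (Suc n) + 2"
        by (simp add: norm_divide norm_mult divide_simps del: of_nat_Suc)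
      finally show ?thesis
        unfolding norm_mult norm_divide[of _ ?N] norm_of_nat by (intro mult_right_mono divide_right_mono) (auto simp del: of_nat_Suc)
    qed
    also have "norm (2 / ?N * (\<rho> n * ?c)) = 2 / real (Suc n) * norm (\<rho> n) * norm ?c"
      by (simp add: norm_mult norm_divide del: of_nat_Suc)
    finally have "norm (dcoef A B (Suc n)) + norm (hcoef A B 1 (Suc n)) \<le> norm (\<rho> n) * norm ?d + q n * norm ?c"
      unfolding h q_def by (simp add: norm_mult algebra_simps del: of_nat_Suc)
    also have "norm (\<rho> n) * norm ?d \<le> q n * norm ?d"
      unfolding q_def by (intro mult_right_mono) (auto simp: algebra_simps simp del: of_nat_Suc intro!: add_nonneg_nonneg)
    finally show ?thesis by (simp add: distrib_left)
  qed
  fix r :: real assume "r > 1"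
  with q have "\<forall>\<^sub>F n in sequentially. q n < r" by (intro order_tendstoD) auto
  then show "\<forall>\<^sub>F n in sequentially. norm (dcoef A B (Suc n)) + norm (hcoef A B 1 (Suc n)) \<le> r * (norm (dcoef A B n) + norm (hcoef A B 1 n))"
    by eventually_elim (rule order_trans[OF step], intro mult_right_mono, auto)
qed auto

text \<open>Applied to ln t times F, the hypergeometric operator leaves 2(1-t)F' - (A+B)F: the terms
  with ln t vanish by the equation for F and those with 1/t cancel. The recurrence of
  \<open>dcoef\<close> makes the power series produce the opposite.\<close>

lemma ode2_log_solution:
  assumes AB: "A + B = of_real (1 + b)" "A * B = - z"
  obtains y1 y2 where "ode2 0 b z (\<lambda>x. of_real (ln ((1 - x) / 2)) * hyp A B 1 (of_real ((1 - x) / 2)) + psum (dcoef A B) (of_real ((1 - x) / 2))) y1 y2"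
proof -
  let ?F = "\<lambda>t. hyp A B 1 (of_real t)" and ?F1 = "\<lambda>t. psum (diffs (hcoef A B 1)) (of_real t)"
  let ?F2 = "\<lambda>t. psum (diffs (diffs (hcoef A B 1))) (of_real t)"
  let ?D = "\<lambda>t. psum (dcoef A B) (of_real t)" and ?D1 = "\<lambda>t. psum (diffs (dcoef A B)) (of_real t)"
  let ?D2 = "\<lambda>t. psum (diffs (diffs (dcoef A B))) (of_real t)"
  let ?L = "\<lambda>t. complex_of_real (ln t)" and ?i = "\<lambda>t. complex_of_real (1 / t)"
  have s: "disc_summable (hcoef A B 1)" "disc_summable (dcoef A B)"
    by (auto intro: disc_summable_dcoef)
  have "ode2 0 b z (\<lambda>x. ?L ((1 - x) / 2) * ?F ((1 - x) / 2) + ?D ((1 - x) / 2))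
     (\<lambda>x. - (?L ((1 - x) / 2) * ?F1 ((1 - x) / 2) + ?i ((1 - x) / 2) * ?F ((1 - x) / 2) + ?D1 ((1 - x) / 2)) / 2)
     (\<lambda>x. ((?L ((1 - x) / 2) * ?F2 ((1 - x) / 2) + ?i ((1 - x) / 2) * ?F1 ((1 - x) / 2)) +
           (?i ((1 - x) / 2) * ?F1 ((1 - x) / 2) + of_real (- (1 / ((1 - x) / 2)\<^sup>2)) * ?F ((1 - x) / 2)) + ?D2 ((1 - x) / 2)) / 4)"
  proof (rule ode2_hypergeometric)
    fix t :: real assume t: "0 < t" "t < 1"
    have n: "norm (complex_of_real t) < 1" using t by simp
    have F: "(?F has_vector_derivative ?F1 t) (at t)" "(?F1 has_vector_derivative ?F2 t) (at t)"
      "(?D has_vector_derivative ?D1 t) (at t)" "(?D1 has_vector_derivative ?D2 t) (at t)"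
      by (intro has_vector_derivative_real_field psum_has_field_derivative disc_summable_diffs s n)+
    have L: "(ln has_real_derivative 1 / t) (at t)" "((\<lambda>t. 1 / t) has_real_derivative - (1 / t\<^sup>2)) (at t)"
      using t by (auto intro!: derivative_eq_intros simp: power2_eq_square divide_simps)
    show "((\<lambda>t. ?L t * ?F t + ?D t) has_vector_derivative ?L t * ?F1 t + ?i t * ?F t + ?D1 t) (at t)"
      by (intro has_vector_derivative_add has_vector_derivative_of_real_mult L F)
    show "((\<lambda>t. ?L t * ?F1 t + ?i t * ?F t + ?D1 t) has_vector_derivative
       (?L t * ?F2 t + ?i t * ?F1 t) + (?i t * ?F1 t + of_real (- (1 / t\<^sup>2)) * ?F t) + ?D2 t) (at t)"
      by (intro has_vector_derivative_add has_vector_derivative_of_real_mult L F)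
    define T where "T = complex_of_real t"
    have T: "T \<noteq> 0" using t by (simp add: T_def)
    have odeF: "T * (1 - T) * ?F2 t + (1 - (A + B + 1) * T) * ?F1 t - A * B * ?F t = 0"
      using hyp_ode[of 1 T A B] n by (simp add: T_def)
    have "(\<lambda>n. (of_nat (Suc n) * (1 + of_nat n) * dcoef A B (Suc n) - (A + of_nat n) * (B + of_nat n) * dcoef A B n) * T ^ n) sums
      (T * (1 - T) * ?D2 t + (1 - (A + B + 1) * T) * ?D1 t - A * B * ?D t)"
      unfolding T_def by (intro psum_euler_sums s n)
    moreover have "(\<lambda>n. (of_nat (Suc n) * (1 + of_nat n) * dcoef A B (Suc n) - (A + of_nat n) * (B + of_nat n) * dcoef A B n) * T ^ n)
      = (\<lambda>n. (A + B) * (hcoef A B 1 n * T ^ n) + 2 * (of_nat n * hcoef A B 1 n * T ^ n) - 2 * (diffs (hcoef A B 1) n * T ^ n))"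
    proof
      fix n
      have N: "of_nat (Suc n) \<noteq> (0 :: complex)" by (rule of_nat_neq_0)
      have "of_nat (Suc n) * (1 + of_nat n) * dcoef A B (Suc n) = (of_nat (Suc n))\<^sup>2 * dcoef A B (Suc n)"
        by (simp add: power2_eq_square)
      also have "\<dots> = (A + of_nat n) * (B + of_nat n) * dcoef A B n + (A + B + 2 * of_nat n) * hcoef A B 1 n - 2 * of_nat (Suc n) * hcoef A B 1 (Suc n)"
        using N by (simp del: of_nat_Suc)
      finally have e: "of_nat (Suc n) * (1 + of_nat n) * dcoef A B (Suc n) - (A + of_nat n) * (B + of_nat n) * dcoef A B n =
         (A + B + 2 * of_nat n) * hcoef A B 1 n - 2 * of_nat (Suc n) * hcoef A B 1 (Suc n)"
        by (simp only: diff_eq_eq) (simp only: algebra_simps)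
      show "(of_nat (Suc n) * (1 + of_nat n) * dcoef A B (Suc n) - (A + of_nat n) * (B + of_nat n) * dcoef A B n) * T ^ n =
         (A + B) * (hcoef A B 1 n * T ^ n) + 2 * (of_nat n * hcoef A B 1 n * T ^ n) - 2 * (diffs (hcoef A B 1) n * T ^ n)"
        unfolding e by (simp add: diffs_def algebra_simps del: of_nat_Suc)
    qed
    moreover have "(\<lambda>n. (A + B) * (hcoef A B 1 n * T ^ n) + 2 * (of_nat n * hcoef A B 1 n * T ^ n) - 2 * (diffs (hcoef A B 1) n * T ^ n)) sums
      ((A + B) * ?F t + 2 * (T * ?F1 t) - 2 * ?F1 t)"
      unfolding T_def by (intro sums_add sums_diff sums_mult psum_sums psum_diffs_shift_sums disc_summable_diffs s n)
    ultimately have odeD: "T * (1 - T) * ?D2 t + (1 - (A + B + 1) * T) * ?D1 t - A * B * ?D t = (A + B) * ?F t + 2 * (T * ?F1 t) - 2 * ?F1 t"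
      using sums_unique2 by (simp only:) blast
    define w where "w = 1 / T"
    have w: "w * T = 1" "?i t = w" "complex_of_real (- (1 / t\<^sup>2)) = - w\<^sup>2" using T by (simp_all add: w_def T_def power_divide)
    have s: "of_real (1 + 0 - (0 + b + 2) * t) = 1 - (A + B + 1) * T" "of_real (t * (1 - t)) = T * (1 - T)" "z = - (A * B)"
      using AB by (simp_all add: T_def)
    show "of_real (t * (1 - t)) * ((?L t * ?F2 t + ?i t * ?F1 t) + (?i t * ?F1 t + of_real (- (1 / t\<^sup>2)) * ?F t) + ?D2 t) +
      of_real (1 + 0 - (0 + b + 2) * t) * (?L t * ?F1 t + ?i t * ?F t + ?D1 t) + z * (?L t * ?F t + ?D t) = 0"
      unfolding s w(2,3) using odeF odeD w(1) by algebra
  qed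
  then show ?thesis by (rule that)
qed

text \<open>The singular function in the boundary values: $f \sim \widetilde f(-1)\, \ell + \widetilde f^{\,\prime}(-1)$ for $\beta \ge 0$.
  It lets the cases $\beta = 0$ and $\beta > 0$ be treated together.\<close>
definition ell :: "real \<Rightarrow> real \<Rightarrow> real \<Rightarrow> real" where
  "ell a b x = (if b = 0 then - (2 powr (- a - 1) * ln ((1 + x) / 2)) else 2 powr (- a - 1) / b * (1 + x) powr (- b))"

section \<open>Boundary values at -1 for a function paired with its quasi-derivative\<close>

definition bv :: "real \<Rightarrow> real \<Rightarrow> (real \<Rightarrow> complex) \<Rightarrow> (real \<Rightarrow> complex) \<Rightarrow> complex \<Rightarrow> complex \<Rightarrow> bool" where
  "bv a b f g v0 v1 \<longleftrightarrow>
    (if b < 0 then (f \<longlongrightarrow> v0) (at_right (-1)) \<and> (g \<longlongrightarrow> v1) (at_right (-1))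
     else ((\<lambda>x. f x - v0 * of_real (ell a b x)) \<longlongrightarrow> v1) (at_right (-1)))"

definition qpair :: "real \<Rightarrow> real \<Rightarrow> (real \<Rightarrow> complex) \<Rightarrow> (real \<Rightarrow> complex) \<Rightarrow> bool" where
  "qpair a b f g \<longleftrightarrow> (\<forall>x\<in>{-1<..<1}. (f has_vector_derivative g x / of_real (pw a b x)) (at x))"

lemma solg_qpair: "solg a b z u g \<Longrightarrow> qpair a b u g"
  by (simp add: solg_def qpair_def)

lemma eventually_at_right_m1: "\<forall>\<^sub>F x in at_right (-1::real). -1 < x \<and> x < 1"
  by (intro eventually_at_rightI[of "-1" 1]) auto

lemma tendsto_1_plus_powr_0: "e > 0 \<Longrightarrow> ((\<lambda>x. (1 + x) powr e) \<longlongrightarrow> 0) (at_right (-1::real))"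
proof -
  assume e: "e > 0"
  then have "((\<lambda>x. (1 + x) powr e) \<longlongrightarrow> (1 + - 1) powr e) (at_right (-1::real))"
    by (intro tendsto_intros) (auto simp: eventually_at_filter)
  then show ?thesis using e by simp
qed

lemma ell_powr_tendsto_0:
  assumes "b \<ge> 0" "e > b"
  shows "((\<lambda>x. (1 + x) powr e * ell a b x) \<longlongrightarrow> 0) (at_right (-1))"
proof (cases "b = 0")
  case True
  with assms have e: "e > 0" by simp
  have "((\<lambda>x. x powr e * ln x) \<longlongrightarrow> 0) (at_right (0::real))"
    using e by real_asymp
  moreover have "filterlim (\<lambda>x. (1 + x) / 2) (at_right 0) (at_right (-1::real))"
    unfolding filterlim_at by (auto intro!: tendsto_eq_intros simp: eventually_at_filter)
  ultimately have "((\<lambda>x. ((1 + x) / 2) powr e * ln ((1 + x) / 2)) \<longlongrightarrow> 0) (at_right (-1))"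
    by (rule filterlim_compose)
  from tendsto_mult_left[OF this, of "- (2 powr e * 2 powr (- a - 1))"]
  have "((\<lambda>x. - (2 powr e * 2 powr (- a - 1)) * (((1 + x) / 2) powr e * ln ((1 + x) / 2))) \<longlongrightarrow> 0) (at_right (-1))" by (simp only: mult_zero_right)
  then show ?thesis
  proof (rule Lim_transform_eventually)
    show "\<forall>\<^sub>F x in at_right (-1). - (2 powr e * 2 powr (- a - 1)) * (((1 + x) / 2) powr e * ln ((1 + x) / 2)) = (1 + x) powr e * ell a b x"
      using eventually_at_right_m1
      by eventually_elim (use True in \<open>simp add: ell_def powr_divide\<close>)
  qed
next
  case False
  have "((\<lambda>x. 2 powr (- a - 1) / b * (1 + x) powr (e - b)) \<longlongrightarrow> 2 powr (- a - 1) / b * 0) (at_right (-1))"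
    using assms by (intro tendsto_intros tendsto_1_plus_powr_0) auto
  then have "((\<lambda>x. 2 powr (- a - 1) / b * (1 + x) powr (e - b)) \<longlongrightarrow> 0) (at_right (-1))" by simp
  then show ?thesis
  proof (rule Lim_transform_eventually)
    show "\<forall>\<^sub>F x in at_right (-1). 2 powr (- a - 1) / b * (1 + x) powr (e - b) = (1 + x) powr e * ell a b x"
      using eventually_at_right_m1
      by eventually_elim (use False in \<open>simp add: ell_def powr_diff powr_minus divide_simps\<close>)
  qed
qed

lemma ell_mult_tendsto_0:
  assumes "b \<ge> 0" "b < 1"
  shows "((\<lambda>x. (1 + x) * ell a b x) \<longlongrightarrow> 0) (at_right (-1))"
proof -
  have "((\<lambda>x. (1 + x) powr 1 * ell a b x) \<longlongrightarrow> 0) (at_right (-1))"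
    using assms by (intro ell_powr_tendsto_0) auto
  then show ?thesis
    by (rule Lim_transform_eventually) (use eventually_at_right_m1 in eventually_elim, simp)
qed

text \<open>For b >= 0 the first limit in \<open>gbv\<close> follows from the second: divide by
  \<open>ell\<close>, which is unbounded at -1. For b < 0 the derivative in \<open>qd\<close> is
  identified with g by the pairing.\<close>

lemma gbv_iff_bv:
  assumes "qpair a b f g"
  shows "gbv a b f v0 v1 \<longleftrightarrow> bv a b f g v0 v1"
proof -
  consider "b < 0" | "b = 0" | "b > 0" by linarith
  then show ?thesis
  proof cases
    case 1
    have "\<forall>\<^sub>F x in at_right (-1). qd a b f x = g x"
      using eventually_at_right_m1
    proof eventually_elim
      case (elim x)
      then have "(f has_vector_derivative g x / of_real (pw a b x)) (at x)" using assms by (auto simp: qpair_def)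
      then show ?case using pw_pos[of x a b] elim by (simp add: qd_def vector_derivative_at)
    qed
    then have "(qd a b f \<longlongrightarrow> v1) (at_right (-1)) \<longleftrightarrow> (g \<longlongrightarrow> v1) (at_right (-1))" by (rule tendsto_cong)
    with 1 show ?thesis by (simp add: gbv_def bv_def)
  next
    case 2
    have eq: "(\<lambda>x. f x + v0 * of_real (2 powr (- a - 1) * ln ((1 + x) / 2))) = (\<lambda>x. f x - v0 * of_real (ell a b x))"
      using 2 by (simp add: ell_def)
    have "((\<lambda>x. - of_real (2 powr (a + 1)) * (f x / of_real (ln ((1 + x) / 2)))) \<longlongrightarrow> v0) (at_right (-1))"
      if l: "((\<lambda>x. f x - v0 * of_real (ell a b x)) \<longlongrightarrow> v1) (at_right (-1))"
    proof -
      have "((\<lambda>x. - (2 powr (a + 1)) / ln ((1 + x) / 2)) \<longlongrightarrow> 0) (at_right (-1::real))"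
        by real_asymp
      then have "((\<lambda>x. complex_of_real (- (2 powr (a + 1)) / ln ((1 + x) / 2))) \<longlongrightarrow> of_real 0) (at_right (-1))"
        by (rule tendsto_of_real)
      from tendsto_add[OF tendsto_mult[OF this l] tendsto_const[of v0]]
      have "((\<lambda>x. of_real (- (2 powr (a + 1)) / ln ((1 + x) / 2)) * (f x - v0 * of_real (ell a b x)) + v0) \<longlongrightarrow> v0) (at_right (-1))" by simp
      then show ?thesis
      proof (rule Lim_transform_eventually)
        show "\<forall>\<^sub>F x in at_right (-1). of_real (- (2 powr (a + 1)) / ln ((1 + x) / 2)) * (f x - v0 * of_real (ell a b x)) + v0 =
           - of_real (2 powr (a + 1)) * (f x / of_real (ln ((1 + x) / 2)))"
          using eventually_at_right_m1
        proof eventually_elim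
          case (elim x)
          have n: "ln ((1 + x) / 2) \<noteq> 0" using elim by simp
          have "- (2 powr (a + 1)) / ln ((1 + x) / 2) * ell a b x = 2 powr (a + 1) * 2 powr (- a - 1)"
            using n 2 by (simp add: ell_def)
          also have "\<dots> = 1" by (simp flip: powr_add)
          finally have "complex_of_real (- (2 powr (a + 1)) / ln ((1 + x) / 2)) * of_real (ell a b x) = 1"
            by (simp only: flip: of_real_mult) simp
          then have "complex_of_real (- (2 powr (a + 1)) / ln ((1 + x) / 2)) * (v0 * of_real (ell a b x)) = v0"
            by (simp only: mult.left_commute[of _ v0]) simp
          then show ?case unfolding right_diff_distrib by simp
        qed
      qed
    qed
    then show ?thesis using 2 unfolding gbv_def bv_def eq by auto
  next
    case 3
    have eq: "(\<lambda>x. f x - v0 * of_real (2 powr (- a - 1) / b * (1 + x) powr (- b))) = (\<lambda>x. f x - v0 * of_real (ell a b x))"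
      using 3 by (simp add: ell_def)
    have "((\<lambda>x. of_real (b * 2 powr (a + 1)) * (of_real ((1 + x) powr b) * f x)) \<longlongrightarrow> v0) (at_right (-1))"
      if l: "((\<lambda>x. f x - v0 * of_real (ell a b x)) \<longlongrightarrow> v1) (at_right (-1))"
    proof -
      have "((\<lambda>x. b * 2 powr (a + 1) * (1 + x) powr b) \<longlongrightarrow> b * 2 powr (a + 1) * 0) (at_right (-1::real))"
        using 3 by (intro tendsto_intros tendsto_1_plus_powr_0)
      then have "((\<lambda>x. complex_of_real (b * 2 powr (a + 1) * (1 + x) powr b)) \<longlongrightarrow> of_real 0) (at_right (-1))"
        by (intro tendsto_of_real) simp
      from tendsto_add[OF tendsto_mult[OF this l] tendsto_const[of v0]]
      have "((\<lambda>x. of_real (b * 2 powr (a + 1) * (1 + x) powr b) * (f x - v0 * of_real (ell a b x)) + v0) \<longlongrightarrow> v0) (at_right (-1))" by simp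
      then show ?thesis
      proof (rule Lim_transform_eventually)
        show "\<forall>\<^sub>F x in at_right (-1). of_real (b * 2 powr (a + 1) * (1 + x) powr b) * (f x - v0 * of_real (ell a b x)) + v0 =
           of_real (b * 2 powr (a + 1)) * (of_real ((1 + x) powr b) * f x)"
          using eventually_at_right_m1
        proof eventually_elim
          case (elim x)
          have "(b * 2 powr (a + 1) * (1 + x) powr b) * ell a b x = (2 powr (a + 1) * 2 powr (- a - 1)) * ((1 + x) powr b * (1 + x) powr (- b))"
            using 3 by (simp add: ell_def)
          also have "\<dots> = 1" using elim by (simp flip: powr_add)
          finally have "complex_of_real (b * 2 powr (a + 1) * (1 + x) powr b) * of_real (ell a b x) = 1"
            by (simp only: flip: of_real_mult) simp
          then have "complex_of_real (b * 2 powr (a + 1) * (1 + x) powr b) * (v0 * of_real (ell a b x)) = v0"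
            by (simp only: mult.left_commute[of _ v0]) simp
          then show ?case unfolding right_diff_distrib by (simp add: mult.assoc)
        qed
      qed
    qed
    then show ?thesis using 3 unfolding gbv_def bv_def eq by auto
  qed
qed

lemma bv_add:
  assumes "bv a b f g v0 v1" "bv a b f' g' w0 w1"
  shows "bv a b (\<lambda>x. f x + f' x) (\<lambda>x. g x + g' x) (v0 + w0) (v1 + w1)"
proof (cases "b < 0")
  case False
  with assms have "((\<lambda>x. (f x - v0 * of_real (ell a b x)) + (f' x - w0 * of_real (ell a b x))) \<longlongrightarrow> v1 + w1) (at_right (-1))"
    by (intro tendsto_add) (auto simp: bv_def)
  then show ?thesis using False by (simp add: bv_def algebra_simps)
qed (use assms in \<open>auto simp: bv_def intro: tendsto_add\<close>)

lemma bv_cmult: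
  assumes "bv a b f g v0 v1"
  shows "bv a b (\<lambda>x. k * f x) (\<lambda>x. k * g x) (k * v0) (k * v1)"
proof (cases "b < 0")
  case False
  with assms have "((\<lambda>x. k * (f x - v0 * of_real (ell a b x))) \<longlongrightarrow> k * v1) (at_right (-1))"
    by (intro tendsto_mult_left) (auto simp: bv_def)
  then show ?thesis using False by (simp add: bv_def algebra_simps)
qed (use assms in \<open>auto simp: bv_def intro: tendsto_mult_left\<close>)

lemma qpair_add:
  assumes "qpair a b f g" "qpair a b f' g'"
  shows "qpair a b (\<lambda>x. f x + f' x) (\<lambda>x. g x + g' x)"
  using assms unfolding qpair_def by (auto simp: add_divide_distrib intro!: has_vector_derivative_add)

lemma qpair_cmult:
  assumes "qpair a b f g"
  shows "qpair a b (\<lambda>x. k * f x) (\<lambda>x. k * g x)"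
  using assms has_vector_derivative_mult_right[of f _ _ k] unfolding qpair_def times_divide_eq_right[symmetric] by blast

lemma solg_add:
  assumes "solg a b z u g" "solg a b z u' g'"
  shows "solg a b z (\<lambda>x. u x + u' x) (\<lambda>x. g x + g' x)"
  unfolding solg_def
proof (intro ballI conjI)
  fix x :: real assume x: "x \<in> {-1<..<1}"
  show "((\<lambda>x. u x + u' x) has_vector_derivative (g x + g' x) / of_real (pw a b x)) (at x)"
    unfolding add_divide_distrib using assms x by (intro has_vector_derivative_add) (auto simp: solg_def)
  show "((\<lambda>x. g x + g' x) has_vector_derivative - of_real (rw a b x) * z * (u x + u' x)) (at x)"
    unfolding distrib_left using assms x by (intro has_vector_derivative_add) (auto simp: solg_def)
qed

lemma solg_cmult:
  assumes "solg a b z u g"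
  shows "solg a b z (\<lambda>x. k * u x) (\<lambda>x. k * g x)"
  unfolding solg_def
proof (intro ballI conjI)
  fix x :: real assume x: "x \<in> {-1<..<1}"
  show "((\<lambda>x. k * u x) has_vector_derivative k * g x / of_real (pw a b x)) (at x)"
    unfolding times_divide_eq_right[symmetric] using assms x by (intro has_vector_derivative_mult_right) (auto simp: solg_def)
  have "((\<lambda>x. k * g x) has_vector_derivative k * (- of_real (rw a b x) * z * u x)) (at x)"
    using assms x by (intro has_vector_derivative_mult_right) (auto simp: solg_def)
  then show "((\<lambda>x. k * g x) has_vector_derivative - of_real (rw a b x) * z * (k * u x)) (at x)"
    by (simp add: mult_ac)
qed

lemma filterlim_half_at_right_m1: "filterlim (\<lambda>x. complex_of_real ((1 + x) / 2)) (at 0) (at_right (-1))"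
proof -
  have "((\<lambda>x. complex_of_real ((1 + x) / 2)) \<longlongrightarrow> of_real ((1 + - 1) / 2)) (at_right (-1))"
    by (intro tendsto_intros) auto
  moreover have "\<forall>\<^sub>F x in at_right (-1). complex_of_real ((1 + x) / 2) \<noteq> 0"
    using eventually_at_right_m1
  proof eventually_elim
    case (elim x)
    then have "(1 + x) / 2 \<noteq> 0" by (simp add: add_eq_0_iff)
    then show ?case unfolding of_real_eq_0_iff .
  qed
  ultimately show ?thesis unfolding filterlim_at by (auto elim: eventually_mono)
qed

lemma psum_at_m1_tendsto:
  assumes "disc_summable f"
  shows "((\<lambda>x. psum f (of_real ((1 + x) / 2))) \<longlongrightarrow> f 0) (at_right (-1))"
proof -
  have "isCont (psum f) 0" using psum_has_field_derivative[OF assms, of 0] by (auto intro: DERIV_isCont)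
  then have "(psum f \<longlongrightarrow> psum f 0) (at 0)" by (simp add: isCont_def)
  then show ?thesis using filterlim_compose[OF _ filterlim_half_at_right_m1] by fastforce
qed

text \<open>The difference is O(1+x) by differentiability at the centre. With h = \<open>ell\<close>
  it follows that only the constant term of a series multiplying the singular function is seen by
  the boundary values.\<close>

lemma psum_at_m1_diff_tendsto_0:
  assumes f: "disc_summable f" and h: "((\<lambda>x. (1 + x) * h x) \<longlongrightarrow> 0) (at_right (-1))"
  shows "((\<lambda>x. of_real (h x) * (psum f (of_real ((1 + x) / 2)) - f 0)) \<longlongrightarrow> 0) (at_right (-1))"
proof -
  have "((\<lambda>w. (psum f w - psum f 0) / (w - 0)) \<longlongrightarrow> psum (diffs f) 0) (at 0)"
    using psum_has_field_derivative[OF f, of 0] by (simp add: has_field_derivative_iff)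
  from filterlim_compose[OF this filterlim_half_at_right_m1]
  have 1: "((\<lambda>x. (psum f (of_real ((1 + x) / 2)) - f 0) / of_real ((1 + x) / 2)) \<longlongrightarrow> psum (diffs f) 0) (at_right (-1))"
    by simp
  have "((\<lambda>x. (1 + x) * h x / 2) \<longlongrightarrow> 0 / 2) (at_right (-1))" by (intro tendsto_intros h) auto
  from tendsto_mult[OF 1 tendsto_of_real[OF this]]
  have "((\<lambda>x. (psum f (of_real ((1 + x) / 2)) - f 0) / of_real ((1 + x) / 2) * of_real ((1 + x) * h x / 2)) \<longlongrightarrow> 0) (at_right (-1))"
    by simp
  then show ?thesis
  proof (rule Lim_transform_eventually)
    show "\<forall>\<^sub>F x in at_right (-1). (psum f (of_real ((1 + x) / 2)) - f 0) / of_real ((1 + x) / 2) * of_real ((1 + x) * h x / 2) =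
       of_real (h x) * (psum f (of_real ((1 + x) / 2)) - f 0)"
      using eventually_at_right_m1
    proof eventually_elim
      case (elim x)
      define s where "s = (1 + x) / 2"
      have "s \<noteq> 0" using elim by (simp add: s_def)
      then have "complex_of_real s \<noteq> 0" unfolding of_real_eq_0_iff .
      moreover have "(1 + x) * h x / 2 = s * h x" by (simp add: s_def)
      ultimately have s: "complex_of_real s \<noteq> 0" "(1 + x) * h x / 2 = s * h x" .
      show ?case unfolding s_def[symmetric] s(2) using s(1) by simp
    qed
  qed
qed

lemma exists_sum_prod: "\<exists>A B :: complex. A + B = S \<and> A * B = P"
proof (intro exI conjI)
  show "(S + csqrt (S\<^sup>2 - 4 * P)) / 2 + (S - csqrt (S\<^sup>2 - 4 * P)) / 2 = S" by (simp add: field_simps)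
  have "(S + csqrt (S\<^sup>2 - 4 * P)) / 2 * ((S - csqrt (S\<^sup>2 - 4 * P)) / 2) = (S\<^sup>2 - (csqrt (S\<^sup>2 - 4 * P))\<^sup>2) / 4"
    by (simp add: field_simps power2_eq_square)
  then show "(S + csqrt (S\<^sup>2 - 4 * P)) / 2 * ((S - csqrt (S\<^sup>2 - 4 * P)) / 2) = P" by simp
qed

lemma pw_at_m1: "((\<lambda>x. pw a b x * (1 + x) powr (- b)) \<longlongrightarrow> 0) (at_right (-1))"
  "b > - 1 \<Longrightarrow> (pw a b \<longlongrightarrow> 0) (at_right (-1))"
proof -
  have 1: "((\<lambda>x. (1 - x) powr (a + 1)) \<longlongrightarrow> (1 - - 1) powr (a + 1)) (at_right (-1::real))"
    by (intro tendsto_intros) auto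
  have "((\<lambda>x. (1 - x) powr (a + 1) * (1 + x)) \<longlongrightarrow> (1 - - 1) powr (a + 1) * (1 + - 1)) (at_right (-1))"
    by (intro tendsto_mult 1 tendsto_intros)
  then have "((\<lambda>x. (1 - x) powr (a + 1) * (1 + x)) \<longlongrightarrow> 0) (at_right (-1))" by simp
  then show "((\<lambda>x. pw a b x * (1 + x) powr (- b)) \<longlongrightarrow> 0) (at_right (-1))"
    by (rule Lim_transform_eventually)
      (use eventually_at_right_m1 in eventually_elim, simp add: pw_def mult.assoc flip: powr_add)
  show "(pw a b \<longlongrightarrow> 0) (at_right (-1))" if "b > -1"
    unfolding pw_def[abs_def] using tendsto_mult[OF 1 tendsto_1_plus_powr_0[of "b + 1"]] that by simp
qed

section \<open>A fundamental system at -1\<close>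

text \<open>The solution analytic at -1 and equal to 1 there. For b < 0 this 1 is the first boundary
  value and the quasi-derivative vanishes with \<open>pw\<close>; for b >= 0 it is the second,
  because \<open>ell\<close> does not occur.\<close>

lemma regular_solution_at_m1:
  assumes b: "-1 < b" "b < 1"
  obtains u g where "solg a b z u g" "bv a b u g (if b < 0 then 1 else 0) (if b < 0 then 0 else 1)"
proof -
  obtain A B where AB: "A + B = of_real (1 + b + a)" "A * B = - z" using exists_sum_prod by blast
  let ?c = "hcoef A B (1 + b)"
  have ds: "disc_summable ?c" using b by auto
  define u where "u x = psum ?c (of_real ((1 + x) / 2))" for x :: real
  define g where "g x = of_real (pw a b x) * (psum (diffs ?c) (of_real ((1 + x) / 2)) / 2)" for x :: real
  have "solg a b z u g"
    using ode2_solg[OF ode2_reflect[OF ode2_hyp[OF b(1) AB]]] unfolding u_def[abs_def] g_def[abs_def] by simp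
  moreover have u1: "(u \<longlongrightarrow> 1) (at_right (-1))"
    using psum_at_m1_tendsto[OF ds] by (simp add: u_def[abs_def])
  moreover have "(g \<longlongrightarrow> of_real 0 * (diffs ?c 0 / 2)) (at_right (-1))"
    unfolding g_def[abs_def] using b
    by (intro tendsto_mult tendsto_divide tendsto_of_real pw_at_m1 psum_at_m1_tendsto disc_summable_diffs ds tendsto_const) auto
  ultimately show ?thesis by (intro that[of u g]) (auto simp: bv_def)
qed

text \<open>The Frobenius solution with factor (1+x)^(-b), or the logarithmic one for b = 0, scaled
  to unit boundary value. For b < 0 it vanishes at -1 and is seen through its
  quasi-derivative.\<close>

lemma singular_solution_at_m1:
  assumes b: "-1 < b" "b < 1"
  obtains u g where "solg a b z u g" "bv a b u g (if b < 0 then 0 else 1) (if b < 0 then 1 else 0)"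
proof (cases "b = 0")
  case True
  obtain A B where AB: "A + B = of_real (1 + a)" "A * B = - z" using exists_sum_prod by blast
  let ?c = "hcoef A B 1" and ?s = "\<lambda>x. complex_of_real ((1 + x) / 2)"
  have ds: "disc_summable ?c" "disc_summable (dcoef A B)" by (auto intro: disc_summable_dcoef)
  define w where "w x = of_real (ln ((1 + x) / 2)) * psum ?c (?s x) + psum (dcoef A B) (?s x)" for x :: real
  obtain y1 y2 where y: "ode2 0 a z (\<lambda>x. of_real (ln ((1 - x) / 2)) * hyp A B 1 (of_real ((1 - x) / 2)) + psum (dcoef A B) (of_real ((1 - x) / 2))) y1 y2"
    using ode2_log_solution[OF AB] by blast
  \<comment> \<open>Scales the logarithm to \<open>ell\<close> at b = 0, so that the singular part
    cancels exactly in the second boundary value.\<close>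
  define \<kappa> where "\<kappa> = - (2 powr (- a - 1))"
  obtain g where "solg a b z w g"
    using ode2_solg[OF ode2_reflect[OF y]] True unfolding w_def[abs_def] by simp
  then have s: "solg a b z (\<lambda>x. of_real \<kappa> * w x) (\<lambda>x. of_real \<kappa> * g x)" by (rule solg_cmult)
  have "((\<lambda>x. (1 + x) * ell a 0 x) \<longlongrightarrow> 0) (at_right (-1))"
    by (intro ell_mult_tendsto_0) auto
  then have "((\<lambda>x. of_real (ell a 0 x) * (psum ?c (?s x) - ?c 0)) \<longlongrightarrow> 0) (at_right (-1))"
    by (intro psum_at_m1_diff_tendsto_0 ds)
  moreover have "((\<lambda>x. of_real \<kappa> * psum (dcoef A B) (?s x)) \<longlongrightarrow> of_real \<kappa> * dcoef A B 0) (at_right (-1))"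
    by (intro tendsto_mult_left psum_at_m1_tendsto ds)
  ultimately have "((\<lambda>x. of_real (ell a 0 x) * (psum ?c (?s x) - ?c 0) + of_real \<kappa> * psum (dcoef A B) (?s x)) \<longlongrightarrow> 0 + of_real \<kappa> * dcoef A B 0) (at_right (-1))"
    by (rule tendsto_add)
  moreover have "of_real (ell a 0 x) * (psum ?c (?s x) - ?c 0) + of_real \<kappa> * psum (dcoef A B) (?s x) = of_real \<kappa> * w x - 1 * of_real (ell a b x)" for x
    using True by (simp add: ell_def \<kappa>_def w_def algebra_simps)
  ultimately have "bv a b (\<lambda>x. of_real \<kappa> * w x) (\<lambda>x. of_real \<kappa> * g x) 1 0"
    using True by (simp add: bv_def)
  with s True show ?thesis by (intro that) auto
next
  case False
  obtain A B where AB: "A + B = of_real (1 + - b + a)" "A * B = - (z + of_real (b * (a + 1)))" using exists_sum_prod by blast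
  let ?c = "hcoef A B (1 - b)" and ?s = "\<lambda>x. complex_of_real ((1 + x) / 2)"
  have ds: "disc_summable ?c" using b by auto
  define u where "u x = of_real ((1 + x) powr (- b)) * psum ?c (?s x)" for x :: real
  define g where "g x = of_real (pw a b x) * (of_real ((1 + x) powr (- b)) * (psum (diffs ?c) (?s x) / 2 - of_real (b / (1 + x)) * psum ?c (?s x)))" for x :: real
  have "- b > - 1" using b by simp
  have "ode2 a b z u (\<lambda>x. of_real ((1 + x) powr (- b)) * (psum (diffs ?c) (?s x) / 2 - of_real (b / (1 + x)) * psum ?c (?s x)))
     (\<lambda>x. of_real ((1 - - x) powr (- b)) * (psum (diffs (diffs ?c)) (of_real ((1 - - x) / 2)) / 4 + of_real (2 * b / (1 - - x)) * (- psum (diffs ?c) (of_real ((1 - - x) / 2)) / 2) + of_real (b * (b + 1) / (1 - - x)\<^sup>2) * psum ?c (of_real ((1 - - x) / 2))))"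
    using ode2_reflect[OF ode2_gauge[OF ode2_hyp[OF \<open>- b > - 1\<close> AB]]] unfolding u_def[abs_def] by (simp add: algebra_simps)
  then have s: "solg a b z u g" unfolding g_def[abs_def] by (rule ode2_solg)
  show ?thesis
  proof (cases "b < 0")
    case True
    have "((\<lambda>x. complex_of_real ((1 + x) powr (- b))) \<longlongrightarrow> of_real 0) (at_right (-1))"
      using True by (intro tendsto_of_real tendsto_1_plus_powr_0) auto
    from tendsto_mult[OF this psum_at_m1_tendsto[OF ds]] have u0: "(u \<longlongrightarrow> 0) (at_right (-1))"
      by (simp add: u_def[abs_def])
    have 1: "((\<lambda>x. (1 - x) powr (a + 1)) \<longlongrightarrow> (1 - - 1) powr (a + 1)) (at_right (-1::real))"
      by (intro tendsto_intros) auto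
    have "((\<lambda>x. complex_of_real ((1 - x) powr (a + 1)) * (of_real (1 + x) * (psum (diffs ?c) (?s x) / 2) - of_real b * psum ?c (?s x))) \<longlongrightarrow>
      of_real ((1 - - 1) powr (a + 1)) * (of_real (1 + - 1) * (diffs ?c 0 / 2) - of_real b * ?c 0)) (at_right (-1))"
      by (intro tendsto_mult tendsto_diff tendsto_of_real 1 psum_at_m1_tendsto ds disc_summable_diffs tendsto_add tendsto_const tendsto_ident_at tendsto_divide) auto
    then have "((\<lambda>x. complex_of_real ((1 - x) powr (a + 1)) * (of_real (1 + x) * (psum (diffs ?c) (?s x) / 2) - of_real b * psum ?c (?s x))) \<longlongrightarrow>
      of_real (- b * 2 powr (a + 1))) (at_right (-1))" by (simp add: mult.commute)
    then have g1: "(g \<longlongrightarrow> of_real (- b * 2 powr (a + 1))) (at_right (-1))"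
    proof (rule Lim_transform_eventually)
      show "\<forall>\<^sub>F x in at_right (-1). complex_of_real ((1 - x) powr (a + 1)) * (of_real (1 + x) * (psum (diffs ?c) (?s x) / 2) - of_real b * psum ?c (?s x)) = g x"
        using eventually_at_right_m1
      proof eventually_elim
        case (elim x)
        have "pw a b x * (1 + x) powr (- b) = (1 - x) powr (a + 1) * (1 + x)"
          using elim by (simp add: pw_def mult.assoc flip: powr_add)
        then have e: "complex_of_real (pw a b x) * of_real ((1 + x) powr (- b)) = of_real ((1 - x) powr (a + 1)) * of_real (1 + x)"
          by (simp only: flip: of_real_mult)
        have e2: "complex_of_real (1 + x) * of_real (b / (1 + x)) = of_real b"
          using elim unfolding of_real_mult[symmetric] of_real_eq_iff by simp
        have "g x = of_real ((1 - x) powr (a + 1)) * (of_real (1 + x) * (psum (diffs ?c) (?s x) / 2) - (of_real (1 + x) * of_real (b / (1 + x))) * psum ?c (?s x))"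
          unfolding g_def mult.assoc[symmetric] e by (simp only: right_diff_distrib mult.assoc)
        then show ?case unfolding e2 by simp
      qed
    qed
    \<comment> \<open>The reciprocal of the limit of the quasi-derivative: differentiating
      (1+x)^(-b) gives -b, and (1-x)^(a+1) tends to 2^(a+1).\<close>
    define \<kappa> where "\<kappa> = 1 / (- b * 2 powr (a + 1))"
    have "\<kappa> * (- b * 2 powr (a + 1)) = 1" using False by (simp add: \<kappa>_def)
    then have k: "complex_of_real \<kappa> * of_real (- b * 2 powr (a + 1)) = 1" by (simp only: flip: of_real_mult) simp
    have "bv a b u g 0 (of_real (- b * 2 powr (a + 1)))" using u0 g1 True by (simp add: bv_def)
    from bv_cmult[OF this, of "of_real \<kappa>"] have "bv a b (\<lambda>x. of_real \<kappa> * u x) (\<lambda>x. of_real \<kappa> * g x) 0 1" unfolding k by simp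
    with solg_cmult[OF s, of "of_real \<kappa>"] True show ?thesis by (intro that) auto
  next
    case b0: False
    define \<kappa> where "\<kappa> = 2 powr (- a - 1) / b"
    have "((\<lambda>x. (1 + x) * ell a b x) \<longlongrightarrow> 0) (at_right (-1))"
      using b0 b by (intro ell_mult_tendsto_0) auto
    then have "((\<lambda>x. of_real (ell a b x) * (psum ?c (?s x) - ?c 0)) \<longlongrightarrow> 0) (at_right (-1))"
      by (intro psum_at_m1_diff_tendsto_0 ds)
    moreover have "of_real (ell a b x) * (psum ?c (?s x) - ?c 0) = of_real \<kappa> * u x - 1 * of_real (ell a b x)" for x
    proof -
      have e: "ell a b x = \<kappa> * (1 + x) powr (- b)" using False by (simp add: ell_def \<kappa>_def)
      show ?thesis by (simp add: e u_def algebra_simps)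
    qed
    ultimately have "bv a b (\<lambda>x. of_real \<kappa> * u x) (\<lambda>x. of_real \<kappa> * g x) 1 0" using b0 by (simp add: bv_def)
    with solg_cmult[OF s, of "of_real \<kappa>"] b0 show ?thesis by (intro that) auto
  qed
qed

text \<open>\<open>csqrt w\<close> is holomorphic off the nonpositive axis and i times
  \<open>csqrt (- w)\<close> off the nonnegative one. They agree up to sign, which an even function
  does not see, so together they cover all points except 0, where continuity removes the
  singularity.\<close>

lemma holomorphic_even_csqrt:
  assumes f: "f holomorphic_on UNIV" and even: "\<And>s. f (- s) = f s"
  shows "(\<lambda>w. f (csqrt w)) holomorphic_on UNIV"
proof (rule no_isolated_singularity'[where K = "{0}"])
  have fo: "f holomorphic_on S" for S using f holomorphic_on_subset by blast
  have fc: "isCont f s" for s using f by (meson UNIV_I holomorphic_on_imp_continuous_on continuous_on_eq_continuous_at open_UNIV)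
  show "((\<lambda>w. f (csqrt w)) \<longlongrightarrow> f (csqrt z)) (at z within UNIV)" if "z \<in> {0}" for z
  proof -
    have "(csqrt \<longlongrightarrow> 0) (at 0)"
    proof (rule tendsto_norm_zero_cancel)
      have "((\<lambda>w :: complex. sqrt (norm w)) \<longlongrightarrow> sqrt (norm (0 :: complex))) (at 0)"
        by (intro tendsto_real_sqrt tendsto_norm tendsto_ident_at)
      then show "((\<lambda>w. norm (csqrt w)) \<longlongrightarrow> 0) (at 0)" by (simp add: norm_csqrt)
    qed
    then have "((\<lambda>w. f (csqrt w)) \<longlongrightarrow> f 0) (at 0)" by (rule isCont_tendsto_compose[OF fc])
    with that show ?thesis by simp
  qed
  have 1: "(\<lambda>w. f (csqrt w)) holomorphic_on (- \<real>\<^sub>\<le>\<^sub>0)"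
    by (rule holomorphic_on_compose_gen[OF _ fo[of UNIV], unfolded o_def]) (auto intro!: holomorphic_intros)
  have eq: "f (\<i> * csqrt (- w)) = f (csqrt w)" for w
  proof -
    have "(\<i> * csqrt (- w))\<^sup>2 = (csqrt w)\<^sup>2" by (simp add: power_mult_distrib)
    then have "\<i> * csqrt (- w) = csqrt w \<or> \<i> * csqrt (- w) = - csqrt w" by (rule power2_eq_iff[THEN iffD1])
    then show ?thesis using even by auto
  qed
  have "(\<lambda>w. f (\<i> * csqrt (- w))) holomorphic_on {w. - w \<notin> \<real>\<^sub>\<le>\<^sub>0}"
    by (rule holomorphic_on_compose_gen[OF _ fo[of UNIV], unfolded o_def]) (auto intro!: holomorphic_intros)
  then have 2: "(\<lambda>w. f (csqrt w)) holomorphic_on {w. - w \<notin> \<real>\<^sub>\<le>\<^sub>0}" by (simp add: eq)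
  have o: "open (- \<real>\<^sub>\<le>\<^sub>0 :: complex set)" "open {w :: complex. - w \<notin> \<real>\<^sub>\<le>\<^sub>0}"
  proof -
    show "open (- \<real>\<^sub>\<le>\<^sub>0 :: complex set)" by (simp add: open_Compl closed_nonpos_Reals_complex)
    then have "open (uminus -` (- \<real>\<^sub>\<le>\<^sub>0 :: complex set))" by (rule open_vimage) (intro continuous_intros)
    then show "open {w :: complex. - w \<notin> \<real>\<^sub>\<le>\<^sub>0}" by (simp add: vimage_def)
  qed
  have "(\<lambda>w. f (csqrt w)) holomorphic_on ((- \<real>\<^sub>\<le>\<^sub>0) \<union> {w. - w \<notin> \<real>\<^sub>\<le>\<^sub>0})"
    by (intro holomorphic_on_Un 1 2 o)
  moreover have "UNIV - {0} \<subseteq> (- \<real>\<^sub>\<le>\<^sub>0) \<union> {w :: complex. - w \<notin> \<real>\<^sub>\<le>\<^sub>0}"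
    by (auto simp: complex_nonpos_Reals_iff complex_eq_iff)
  ultimately show "(\<lambda>w. f (csqrt w)) holomorphic_on UNIV - {0}" by (rule holomorphic_on_subset)
qed auto

lemma filterlim_at_left_1: "filterlim (\<lambda>x. (1 - x) / 2) (at_left 1) (at_right (-1::real))"
  unfolding filterlim_at by (auto intro!: tendsto_eq_intros simp: eventually_at_filter)

lemma filterlim_half_at_left_1: "filterlim (\<lambda>x. complex_of_real ((1 - x) / 2)) (at 0) (at_left 1)"
proof -
  have "((\<lambda>x. complex_of_real ((1 - x) / 2)) \<longlongrightarrow> of_real ((1 - 1) / 2)) (at_left 1)"
    by (intro tendsto_intros) auto
  moreover have "\<forall>\<^sub>F x in at_left 1. complex_of_real ((1 - x) / 2) \<noteq> 0"
    using eventually_at_left_1_01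
  proof eventually_elim
    case (elim x)
    then have "(1 - x) / 2 \<noteq> 0" by simp
    then show ?case unfolding of_real_eq_0_iff .
  qed
  ultimately show ?thesis unfolding filterlim_at by (auto elim: eventually_mono)
qed

lemma psum_at_1_tendsto:
  assumes "disc_summable f"
  shows "((\<lambda>x. psum f (of_real ((1 - x) / 2))) \<longlongrightarrow> f 0) (at_left 1)"
proof -
  have "isCont (psum f) 0" using psum_has_field_derivative[OF assms, of 0] by (auto intro: DERIV_isCont)
  then have "(psum f \<longlongrightarrow> psum f 0) (at 0)" by (simp add: isCont_def)
  then show ?thesis using filterlim_compose[OF _ filterlim_half_at_left_1] by fastforce
qed

lemma eventually_at_left_1: "\<forall>\<^sub>F x in at_left (1::real). -1 < x \<and> x < 1"
  by (intro eventually_at_leftI[of "-1"]) auto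

section \<open>The solution that is square integrable at 1\<close>

locale jacobi =
  fixes a b :: real
  assumes a: "a \<le> - 1 \<or> 1 \<le> a" and b: "- 1 < b" "b < 1"
begin

definition \<kappa> :: real where "\<kappa> = (if 1 \<le> a then 0 else - a)"
text \<open>The case split makes this the constant 1 for a >= 1 even at x = 1, where
  \<open>0 powr 0\<close> is 0. For x < 1 it is the power with exponent
  \<open>\<kappa>\<close>.\<close>

definition kf :: "real \<Rightarrow> real" where "kf x = (if 1 \<le> a then 1 else (1 - x) powr (- a))"
definition csig :: "complex \<Rightarrow> complex" where "csig z = csqrt (of_real ((1 + a + b)\<^sup>2) + 4 * z)"
definition pA :: "complex \<Rightarrow> complex" where "pA z = (of_real (1 + \<bar>a\<bar> + b) + csig z) / 2"
definition pB :: "complex \<Rightarrow> complex" where "pB z = (of_real (1 + \<bar>a\<bar> + b) - csig z) / 2"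

abbreviation wco :: "complex \<Rightarrow> nat \<Rightarrow> complex" where "wco z \<equiv> hcoef (pA z) (pB z) (1 + \<bar>a\<bar>)"

definition psi :: "complex \<Rightarrow> real \<Rightarrow> complex" where
  "psi z x = of_real (kf x) * psum (wco z) (of_real ((1 - x) / 2))"
definition dpsi :: "complex \<Rightarrow> real \<Rightarrow> complex" where
  "dpsi z x = of_real (kf x) * (- psum (diffs (wco z)) (of_real ((1 - x) / 2)) / 2 + of_real (- \<kappa> / (1 - x)) * psum (wco z) (of_real ((1 - x) / 2)))"
definition psig :: "complex \<Rightarrow> real \<Rightarrow> complex" where
  "psig z x = of_real (pw a b x) * dpsi z x"

lemma kf_powr: "x < 1 \<Longrightarrow> kf x = (1 - x) powr \<kappa>"
  by (simp add: kf_def \<kappa>_def)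

text \<open>The identity behind the common treatment of both signs of a: the square of
  \<open>kf\<close> times the weight or times \<open>pw\<close> carries (1-x) to the power |a| or
  |a| + 1.\<close>

lemma abs_a: "\<bar>a\<bar> = a + 2 * \<kappa>" "\<bar>a\<bar> \<ge> 1"
  using a by (auto simp: \<kappa>_def)

lemma pAB_add: "pA z + pB z = of_real (1 + \<bar>a\<bar> + b)"
  by (simp add: pA_def pB_def field_simps)

lemma pAB_mult: "pA z * pB z = - (z + of_real ((if 1 \<le> a then 0 else a) * (b + 1)))"
proof -
  have "pA z * pB z = ((of_real (1 + \<bar>a\<bar> + b))\<^sup>2 - (csig z)\<^sup>2) / 4"
    by (simp add: pA_def pB_def field_simps power2_eq_square)
  also have "\<dots> = (of_real ((1 + \<bar>a\<bar> + b)\<^sup>2 - (1 + a + b)\<^sup>2)) / 4 - z" by (simp add: csig_def)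
  also have "(1 + \<bar>a\<bar> + b)\<^sup>2 - (1 + a + b)\<^sup>2 = - 4 * ((if 1 \<le> a then 0 else a) * (b + 1))"
    using a by (auto simp: power2_eq_square algebra_simps)
  finally show ?thesis by simp
qed

lemma disc_summable_wco: "disc_summable (wco z)"
  by (intro disc_summable_hcoef) auto

lemma ode2_psi: "\<exists>y2. ode2 a b z (psi z) (dpsi z) y2"
proof (cases "1 \<le> a")
  case True
  then have "pA z + pB z = of_real (1 + a + b)" "pA z * pB z = - z" using pAB_add[of z] pAB_mult[of z] by auto
  from ode2_hyp[OF _ this] have "ode2 a b z (\<lambda>x. psum (wco z) (of_real ((1 - x) / 2))) (\<lambda>x. - psum (diffs (wco z)) (of_real ((1 - x) / 2)) / 2)
    (\<lambda>x. psum (diffs (diffs (wco z))) (of_real ((1 - x) / 2)) / 4)" using True by simp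
  with True show ?thesis by (auto simp: psi_def[abs_def] dpsi_def[abs_def] kf_def \<kappa>_def)
next
  case False
  with a have "a \<le> - 1" by simp
  then have "pA z + pB z = of_real (1 + - a + b)" "pA z * pB z = - (z + of_real (a * (b + 1)))" using pAB_add[of z] pAB_mult[of z] by auto
  from ode2_gauge[OF ode2_hyp[OF _ this]] False \<open>a \<le> - 1\<close> show ?thesis
    by (auto simp: psi_def[abs_def] dpsi_def[abs_def] kf_def \<kappa>_def)
qed

lemma solg_psi: "solg a b z (psi z) (psig z)"
  using ode2_psi[of z] ode2_solg unfolding psig_def[abs_def] by blast

lemma kf_tendsto: "(kf \<longlongrightarrow> 2 powr \<kappa>) (at_right (-1))"
proof -
  have "((\<lambda>x. (1 - x) powr (- a)) \<longlongrightarrow> (1 - - 1) powr (- a)) (at_right (-1::real))"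
    by (intro tendsto_intros) auto
  then show ?thesis by (auto simp: kf_def[abs_def] \<kappa>_def)
qed

lemma kf_diff_tendsto_0:
  assumes "((\<lambda>x. (1 + x) * h x) \<longlongrightarrow> 0) (at_right (-1))"
  shows "((\<lambda>x. (kf x - 2 powr \<kappa>) * h x) \<longlongrightarrow> 0) (at_right (-1))"
proof (cases "1 \<le> a")
  case False
  have "((\<lambda>x. (1 - x) powr \<kappa>) has_real_derivative (- \<kappa> * (1 - - 1) powr (\<kappa> - 1))) (at (-1))"
    by (auto intro!: derivative_eq_intros simp: powr_diff)
  then have "((\<lambda>x. ((1 - x) powr \<kappa> - 2 powr \<kappa>) / (x + 1)) \<longlongrightarrow> (- \<kappa> * (1 - - 1) powr (\<kappa> - 1))) (at_right (-1))"
    unfolding has_field_derivative_iff by (auto intro: tendsto_within_subset)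
  from tendsto_mult[OF this assms]
  have "((\<lambda>x. ((1 - x) powr \<kappa> - 2 powr \<kappa>) / (x + 1) * ((1 + x) * h x)) \<longlongrightarrow> 0) (at_right (-1))" by simp
  then show ?thesis
    by (rule Lim_transform_eventually)
      (use eventually_at_right_m1 in eventually_elim, auto simp: kf_powr add.commute)
qed (simp add: kf_def \<kappa>_def)

section \<open>Boundary values at -1 of the solution distinguished at 1\<close>

text \<open>The factor 2^kappa is the limit of \<open>kf\<close> at -1. With t = (1-x)/2, the
  singular terms of F are -ln(1-t) and (1-t)^(-b); the constants 2^(a+1) and b 2^(a+1) 2^b express
  them through \<open>ell\<close>.\<close>

definition P0 :: "complex \<Rightarrow> complex" where
  "P0 z = of_real (2 powr \<kappa>) * of_real (Gamma (1 + \<bar>a\<bar>)) *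
    (if b < 0 then of_real (Gamma (- b)) * (rGamma (of_real (1 + \<bar>a\<bar>) - pA z) * rGamma (of_real (1 + \<bar>a\<bar>) - pB z))
     else if b = 0 then of_real (2 powr (a + 1)) * (rGamma (pA z) * rGamma (pB z))
     else of_real (b * 2 powr (a + 1) * 2 powr b) * of_real (Gamma b) * (rGamma (pA z) * rGamma (pB z)))"

definition P1 :: "complex \<Rightarrow> complex" where
  "P1 z = of_real (2 powr \<kappa>) * of_real (Gamma (1 + \<bar>a\<bar>)) *
    (if b < 0 then - of_real (2 powr (1 + a + b)) * of_real (Gamma (b + 1)) * (rGamma (pA z) * rGamma (pB z))
     else if b = 0 then deriv rGamma (pA z) * rGamma (pB z) + rGamma (pA z) * deriv rGamma (pB z) - 2 * euler_mascheroni * rGamma (pA z) * rGamma (pB z)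
     else of_real (Gamma (- b)) * (rGamma (of_real (1 + \<bar>a\<bar>) - pA z) * rGamma (of_real (1 + \<bar>a\<bar>) - pB z)))"

text \<open>The factor \<open>kf\<close> is not constant, but it differs from its limit by O(1+x),
  which outweighs the growth of \<open>ell\<close>. It thus acts on the boundary values as its
  limit.\<close>

lemma bv_kf_mult:
  fixes w :: "real \<Rightarrow> complex"
  assumes b0: "b \<ge> 0" and w: "((\<lambda>x. w x - w0 * of_real (ell a b x)) \<longlongrightarrow> w1) (at_right (-1))"
  shows "((\<lambda>x. of_real (kf x) * w x - (of_real (2 powr \<kappa>) * w0) * of_real (ell a b x)) \<longlongrightarrow> of_real (2 powr \<kappa>) * w1) (at_right (-1))"
proof -
  have "((\<lambda>x. complex_of_real ((kf x - 2 powr \<kappa>) * ell a b x)) \<longlongrightarrow> of_real 0) (at_right (-1))"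
    using b b0 by (intro tendsto_of_real kf_diff_tendsto_0 ell_mult_tendsto_0) auto
  from tendsto_add[OF tendsto_mult[OF tendsto_of_real[OF kf_tendsto, where 'a = complex] w] tendsto_mult_right[OF this, of w0]]
  have "((\<lambda>x. of_real (kf x) * (w x - w0 * of_real (ell a b x)) + of_real ((kf x - 2 powr \<kappa>) * ell a b x) * w0) \<longlongrightarrow>
      of_real (2 powr \<kappa>) * w1) (at_right (-1))" by simp
  then show ?thesis by (simp add: algebra_simps)
qed

text \<open>The endpoint x = -1 corresponds to the argument t = 1. For b < 0 the value is Gauss'
  sum, and the blow-up (1-t)^(-b-1) of F' is balanced by (1+x)^(b+1) in \<open>pw\<close>. For b >=
  0 both boundary values are read off the two-term expansion.\<close>

lemma bv_psi: "bv a b (psi z) (psig z) (P0 z) (P1 z)"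
proof -
  let ?c = "1 + \<bar>a\<bar>"
  have c: "?c > 0" by simp
  have AB: "pA z + pB z = of_real (?c + b)" using pAB_add[of z] by simp
  let ?v = "\<lambda>x. psum (wco z) (of_real ((1 - x) / 2))" and ?v1 = "\<lambda>x. psum (diffs (wco z)) (of_real ((1 - x) / 2))"
  let ?G = "complex_of_real (Gamma ?c)"
  consider "b < 0" | "b = 0" | "b > 0" by linarith
  then show ?thesis
  proof cases
    case 1
    have "(?v \<longlongrightarrow> suminf (wco z)) (at_right (-1))"
      using filterlim_compose[OF psum_tendsto_suminf[OF summable_norm_hcoef[OF c AB 1]] filterlim_at_left_1] .
    then have v: "(?v \<longlongrightarrow> ?G * of_real (Gamma (- b)) * rGamma (of_real ?c - pA z) * rGamma (of_real ?c - pB z)) (at_right (-1))"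
      using gauss_hypergeometric_sum[OF c AB 1] by simp
    from tendsto_mult[OF tendsto_of_real[OF kf_tendsto] this]
    have "(psi z \<longlongrightarrow> P0 z) (at_right (-1))"
      using 1 by (simp add: psi_def[abs_def] P0_def mult_ac)
    moreover have "(psig z \<longlongrightarrow> P1 z) (at_right (-1))"
    proof -
      have L1: "((\<lambda>x. of_real ((1 - (1 - x) / 2) powr (b + 1)) * ?v1 x) \<longlongrightarrow> ?G * of_real (Gamma (b + 1)) * rGamma (pA z) * rGamma (pB z)) (at_right (-1))"
        using filterlim_compose[OF hyp_deriv_powr_tendsto[OF c AB b(1)] filterlim_at_left_1] .
      have L2: "((\<lambda>x. - (2 powr (b + 1) / 2 * (1 - x) powr (a + 1))) \<longlongrightarrow> - (2 powr (b + 1) / 2 * (1 - - 1) powr (a + 1))) (at_right (-1::real))"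
        by (intro tendsto_intros) auto
      have e2: "2 powr (b + 1) / 2 * (1 - - 1) powr (a + 1) = (2::real) powr (1 + a + b)" by (simp add: powr_add)
      have "((\<lambda>x. of_real (kf x) * (of_real (- (2 powr (b + 1) / 2 * (1 - x) powr (a + 1))) * (of_real ((1 - (1 - x) / 2) powr (b + 1)) * ?v1 x))) \<longlongrightarrow>
         of_real (2 powr \<kappa>) * (of_real (- (2 powr (1 + a + b))) * (?G * of_real (Gamma (b + 1)) * rGamma (pA z) * rGamma (pB z)))) (at_right (-1))"
        using tendsto_mult[OF tendsto_of_real[OF kf_tendsto] tendsto_mult[OF tendsto_of_real[OF L2] L1]] unfolding e2 .
      \<comment> \<open>The part of the quasi-derivative that comes from differentiating
        \<open>kf\<close> disappears in the limit, since \<open>pw\<close> tends to 0 while F stays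
        bounded.\<close>
      moreover have "((\<lambda>x. of_real (kf x) * (of_real (pw a b x) * (of_real (- \<kappa> / (1 - x)) * ?v x))) \<longlongrightarrow>
         of_real (2 powr \<kappa>) * (of_real 0 * (of_real (- \<kappa> / (1 - - 1)) * suminf (wco z)))) (at_right (-1))"
        using \<open>(?v \<longlongrightarrow> suminf (wco z)) _\<close> b
        by (intro tendsto_mult tendsto_of_real[OF kf_tendsto] tendsto_of_real pw_at_m1 tendsto_divide tendsto_intros) auto
      ultimately have "((\<lambda>x. of_real (kf x) * (of_real (- (2 powr (b + 1) / 2 * (1 - x) powr (a + 1))) * (of_real ((1 - (1 - x) / 2) powr (b + 1)) * ?v1 x))
          + of_real (kf x) * (of_real (pw a b x) * (of_real (- \<kappa> / (1 - x)) * ?v x))) \<longlongrightarrow>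
         of_real (2 powr \<kappa>) * (of_real (- (2 powr (1 + a + b))) * (?G * of_real (Gamma (b + 1)) * rGamma (pA z) * rGamma (pB z)))
         + of_real (2 powr \<kappa>) * (of_real 0 * (of_real (- \<kappa> / (1 - - 1)) * suminf (wco z)))) (at_right (-1))"
        by (rule tendsto_add)
      moreover have "of_real (2 powr \<kappa>) * (of_real (- (2 powr (1 + a + b))) * (?G * of_real (Gamma (b + 1)) * rGamma (pA z) * rGamma (pB z)))
         + of_real (2 powr \<kappa>) * (of_real 0 * (of_real (- \<kappa> / (1 - - 1)) * suminf (wco z))) = P1 z"
        using 1 by (simp add: P1_def mult_ac)
      ultimately have lim: "((\<lambda>x. of_real (kf x) * (of_real (- (2 powr (b + 1) / 2 * (1 - x) powr (a + 1))) * (of_real ((1 - (1 - x) / 2) powr (b + 1)) * ?v1 x))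
          + of_real (kf x) * (of_real (pw a b x) * (of_real (- \<kappa> / (1 - x)) * ?v x))) \<longlongrightarrow> P1 z) (at_right (-1))"
        by (simp only:)
      show ?thesis
      proof (rule Lim_transform_eventually[OF lim])
        show "\<forall>\<^sub>F x in at_right (-1). of_real (kf x) * (of_real (- (2 powr (b + 1) / 2 * (1 - x) powr (a + 1))) * (of_real ((1 - (1 - x) / 2) powr (b + 1)) * ?v1 x))
          + of_real (kf x) * (of_real (pw a b x) * (of_real (- \<kappa> / (1 - x)) * ?v x)) = psig z x"
          using eventually_at_right_m1
        proof eventually_elim
          case (elim x)
          have h: "1 - (1 - x) / 2 = (1 + x) / 2" by (simp add: field_simps)
          have "(1 - (1 - x) / 2) powr (b + 1) = (1 + x) powr (b + 1) / 2 powr (b + 1)"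
            unfolding h using elim by (simp add: powr_divide)
          then have "2 powr (b + 1) / 2 * (1 - x) powr (a + 1) * (1 - (1 - x) / 2) powr (b + 1) = pw a b x / 2"
            by (simp add: pw_def)
          then have e: "complex_of_real (2 powr (b + 1) / 2 * (1 - x) powr (a + 1)) * of_real ((1 - (1 - x) / 2) powr (b + 1)) = of_real (pw a b x) / 2"
            by (simp only: flip: of_real_mult) simp
          have "of_real (- (2 powr (b + 1) / 2 * (1 - x) powr (a + 1))) * (of_real ((1 - (1 - x) / 2) powr (b + 1)) * ?v1 x) = of_real (pw a b x) * (- ?v1 x / 2)"
            unfolding mult.assoc[symmetric] of_real_minus mult_minus_left e by simp
          then show ?case unfolding psig_def dpsi_def by (simp add: algebra_simps)
        qed
      qed
    qed
    ultimately show ?thesis using 1 by (simp add: bv_def)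
  next
    case 2
    then have AB0: "pA z + pB z = of_real ?c" using AB by simp
    let ?L = "?G * (deriv rGamma (pA z) * rGamma (pB z) + rGamma (pA z) * deriv rGamma (pB z) - 2 * euler_mascheroni * rGamma (pA z) * rGamma (pB z))"
    let ?K = "?G * rGamma (pA z) * rGamma (pB z)"
    have "((\<lambda>x. ?v x + ?K * of_real (ln (1 - (1 - x) / 2))) \<longlongrightarrow> ?L) (at_right (-1))"
      using filterlim_compose[OF hyp_expansion_at_1_zero[OF c AB0] filterlim_at_left_1] .
    moreover have "?K * of_real (ln (1 - (1 - x) / 2)) = - (of_real (2 powr (a + 1)) * ?K) * of_real (ell a b x)" for x
    proof -
      have h: "1 - (1 - x) / 2 = (1 + x) / 2" by (simp add: field_simps)
      have "2 powr (a + 1) * ell a b x = - ((2 powr (a + 1) * 2 powr (- a - 1)) * ln ((1 + x) / 2))"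
        using 2 by (simp add: ell_def)
      moreover have "2 powr (a + 1) * 2 powr (- a - 1) = (1::real)" by (simp flip: powr_add)
      ultimately have "ln ((1 + x) / 2) = - (2 powr (a + 1) * ell a b x)" by simp
      then show ?thesis unfolding h by (simp only:) simp
    qed
    ultimately have "((\<lambda>x. ?v x - (of_real (2 powr (a + 1)) * ?K) * of_real (ell a b x)) \<longlongrightarrow> ?L) (at_right (-1))" by simp
    note lim = this
    have nb: "\<not> b < 0" "b \<ge> 0" using 2 by auto
    from bv_kf_mult[OF nb(2) lim] show ?thesis
      unfolding bv_def P0_def P1_def if_not_P[OF nb(1)] if_P[OF 2] by (simp add: psi_def mult_ac)
  next
    case 3
    let ?L = "?G * of_real (Gamma (- b)) * rGamma (of_real ?c - pA z) * rGamma (of_real ?c - pB z)"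
    let ?K = "?G * of_real (Gamma b) * rGamma (pA z) * rGamma (pB z)"
    have "((\<lambda>x. ?v x - ?K * of_real ((1 - (1 - x) / 2) powr (- b))) \<longlongrightarrow> ?L) (at_right (-1))"
      using filterlim_compose[OF hyp_expansion_at_1_pos[OF c AB 3 b(2)] filterlim_at_left_1] .
    moreover have "\<forall>\<^sub>F x in at_right (-1). ?v x - ?K * of_real ((1 - (1 - x) / 2) powr (- b)) = ?v x - (of_real (b * 2 powr (a + 1) * 2 powr b) * ?K) * of_real (ell a b x)"
      using eventually_at_right_m1
    proof eventually_elim
      case (elim x)
      have h: "1 - (1 - x) / 2 = (1 + x) / 2" by (simp add: field_simps)
      have "(b * 2 powr (a + 1) * 2 powr b) * ell a b x = (2 powr (a + 1) * 2 powr (- a - 1)) * 2 powr b * (1 + x) powr (- b)"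
        using 3 by (simp add: ell_def)
      moreover have "2 powr (a + 1) * 2 powr (- a - 1) = (1::real)" by (simp flip: powr_add)
      moreover have "((1 + x) / 2) powr (- b) = 2 powr b * (1 + x) powr (- b)" using elim by (simp add: powr_divide powr_minus divide_simps)
      ultimately have "((1 + x) / 2) powr (- b) = (b * 2 powr (a + 1) * 2 powr b) * ell a b x" by simp
      then show ?case unfolding h by (simp only:) simp
    qed
    ultimately have "((\<lambda>x. ?v x - (of_real (b * 2 powr (a + 1) * 2 powr b) * ?K) * of_real (ell a b x)) \<longlongrightarrow> ?L) (at_right (-1))"
      by (rule Lim_transform_eventually)
    from bv_kf_mult[OF _ this] 3 show ?thesis
      by (simp add: bv_def psi_def P0_def P1_def mult_ac)
  qed
qed

lemma holomorphic_even_csig: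
  assumes "f holomorphic_on UNIV" "\<And>s. f (- s) = f s"
  shows "(\<lambda>z. f (csig z)) holomorphic_on UNIV"
  unfolding csig_def
  by (rule holomorphic_on_compose_gen[OF _ holomorphic_even_csqrt[OF assms], unfolded o_def])
    (auto intro!: holomorphic_intros)

text \<open>Changing the sign of the square root exchanges the two factors, so the product is even
  in it and hence entire in z.\<close>

lemma holomorphic_rGamma_pair: "(\<lambda>z. rGamma ((d + csig z) / 2) * rGamma ((d - csig z) / 2)) holomorphic_on UNIV"
  by (rule holomorphic_even_csig) (auto intro!: holomorphic_intros simp: mult.commute)

lemma holomorphic_deriv_rGamma_pair:
  "(\<lambda>z. deriv rGamma ((d + csig z) / 2) * rGamma ((d - csig z) / 2) + rGamma ((d + csig z) / 2) * deriv rGamma ((d - csig z) / 2)) holomorphic_on UNIV"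
proof (rule holomorphic_even_csig[of "\<lambda>s. deriv rGamma ((d + s) / 2) * rGamma ((d - s) / 2) + rGamma ((d + s) / 2) * deriv rGamma ((d - s) / 2)"])
  have "deriv rGamma holomorphic_on (UNIV :: complex set)"
    by (intro holomorphic_deriv holomorphic_rGamma) auto
  then have dr: "(\<lambda>s. deriv rGamma (g s)) holomorphic_on UNIV" if "g holomorphic_on UNIV" for g :: "complex \<Rightarrow> complex"
    using holomorphic_on_compose_gen[OF that, of "deriv rGamma" UNIV] by (simp add: o_def)
  then show "(\<lambda>s. deriv rGamma ((d + s) / 2) * rGamma ((d - s) / 2) + rGamma ((d + s) / 2) * deriv rGamma ((d - s) / 2)) holomorphic_on UNIV"
    by (intro holomorphic_intros dr) auto
qed simp

lemma c_minus_p: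
  "of_real (1 + \<bar>a\<bar>) - pA z = (of_real (1 + \<bar>a\<bar> - b) - csig z) / 2"
  "of_real (1 + \<bar>a\<bar>) - pB z = (of_real (1 + \<bar>a\<bar> - b) + csig z) / 2"
  by (simp_all add: pA_def pB_def field_simps)

lemma holomorphic_rGamma_pA_pB:
  "(\<lambda>z. rGamma (pA z) * rGamma (pB z)) holomorphic_on UNIV"
  "(\<lambda>z. rGamma (of_real (1 + \<bar>a\<bar>) - pA z) * rGamma (of_real (1 + \<bar>a\<bar>) - pB z)) holomorphic_on UNIV"
  "(\<lambda>z. deriv rGamma (pA z) * rGamma (pB z) + rGamma (pA z) * deriv rGamma (pB z)) holomorphic_on UNIV"
    unfolding c_minus_p unfolding pA_def pB_def
    by (rule holomorphic_rGamma_pair, subst mult.commute, rule holomorphic_rGamma_pair, rule holomorphic_deriv_rGamma_pair)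

lemma holomorphic_on_if_const:
  "(C \<Longrightarrow> f holomorphic_on S) \<Longrightarrow> (\<not> C \<Longrightarrow> g holomorphic_on S) \<Longrightarrow> (\<lambda>z. if C then f z else g z) holomorphic_on S"
  by (cases C) simp_all

lemma holomorphic_P0: "P0 holomorphic_on S"
proof -
  have "P0 holomorphic_on UNIV"
    unfolding P0_def[abs_def]
    by (intro holomorphic_rGamma_pA_pB holomorphic_on_if_const holomorphic_on_mult holomorphic_on_const)
  then show ?thesis by (rule holomorphic_on_subset) auto
qed

lemma holomorphic_P1: "P1 holomorphic_on S"
proof -
  have "P1 holomorphic_on UNIV"
    unfolding P1_def[abs_def] mult.assoc[of "2 * euler_mascheroni"]
    by (intro holomorphic_rGamma_pA_pB holomorphic_on_if_const holomorphic_on_diff holomorphic_on_mult holomorphic_on_const)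
  then show ?thesis by (rule holomorphic_on_subset) auto
qed

text \<open>Poles of \<open>Gamma\<close> in a denominator do no harm: \<open>Gamma\<close> has the
  default value 0 there, so its inverse is 0 too, as is \<open>rGamma\<close>. For b = 0 the
  hypothesis keeps both factors \<open>rGamma\<close> nonzero, which permits writing their
  logarithmic derivatives as minus \<open>Digamma\<close>.\<close>

lemma m0_formula_eq:
  assumes "P0 z \<noteq> 0"
  shows "P1 z / P0 z = m0_formula a b z"
proof -
  let ?c = "1 + \<bar>a\<bar>" and ?s = "csig z"
  have G: "Gamma ?c \<noteq> 0" using Gamma_real_pos[of ?c] by linarith
  have n: "complex_of_real (2 powr \<kappa>) * of_real (Gamma ?c) \<noteq> 0" using G by simp
  \<comment> \<open>In terms of |a|, the cases a >= 1 and a <= -1 of the formula coincide. Only the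
    power of 2 in front keeps a with its sign.\<close>
  have m0: "m0_formula a b z = 
      (if b < 0 then
         of_real (2 powr (1 + a + b) * b) * (Gamma (of_real (1 + b)) / Gamma (of_real (1 - b))) *
         (Gamma (of_real ?c - pA z) * Gamma (of_real ?c - pB z)) / (Gamma (pA z) * Gamma (pB z))
       else if b = 0 then - of_real (2 powr (- a - 1)) * (2 * euler_mascheroni + Digamma (pA z) + Digamma (pB z))
       else
         - of_real (inverse b * 2 powr (- 1 - a - b)) * (Gamma (of_real (1 - b)) / Gamma (of_real (1 + b))) *
         (Gamma (pA z) * Gamma (pB z)) / (Gamma (of_real ?c - pA z) * Gamma (of_real ?c - pB z)))"
  proof (cases "1 \<le> a")
    case True
    then have "\<bar>a\<bar> = a" by simp
    with True show ?thesis unfolding c_minus_p unfolding m0_formula_def Let_def csig_def[symmetric] pA_def pB_def by (simp add: mult_ac)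
  next
    case False
    with a have "\<bar>a\<bar> = - a" by simp
    then have e: "1 + \<bar>a\<bar> + b = 1 + b - a" "1 + \<bar>a\<bar> - b = 1 - a - b" "b = 0 \<Longrightarrow> 1 - a = 1 + b - a" by simp_all
    from False show ?thesis unfolding c_minus_p unfolding m0_formula_def Let_def csig_def[symmetric] pA_def pB_def e(1,2)
      by (auto simp: mult_ac)
  qed
  consider "b < 0" | "b = 0" | "b > 0" by linarith
  then show ?thesis
  proof cases
    case 1
    have "- b \<notin> \<int>\<^sub>\<le>\<^sub>0" using 1 by (auto elim!: nonpos_Ints_cases)
    from Gamma_plus1[OF this] have g: "Gamma (1 - b) = - b * Gamma (- b)" by simp
    have "Gamma (- b) > 0" using 1 by (intro Gamma_real_pos) simp
    then have g0: "Gamma (- b) \<noteq> 0" by linarith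
    have "P1 z / P0 z = (- of_real (2 powr (1 + a + b)) * of_real (Gamma (b + 1)) * (rGamma (pA z) * rGamma (pB z))) /
       (of_real (Gamma (- b)) * (rGamma (of_real ?c - pA z) * rGamma (of_real ?c - pB z)))"
      unfolding P0_def P1_def if_P[OF 1] using n by (rule nonzero_mult_divide_mult_cancel_left)
    also have "\<dots> = of_real (2 powr (1 + a + b) * b) * (of_real (Gamma (1 + b)) / of_real (Gamma (1 - b))) *
         (Gamma (of_real ?c - pA z) * Gamma (of_real ?c - pB z)) / (Gamma (pA z) * Gamma (pB z))"
      unfolding g rGamma_inverse_Gamma using g0 1 by (simp add: divide_inverse mult_ac add.commute)
    finally show ?thesis unfolding m0 if_P[OF 1] by (simp only: Gamma_complex_of_real)
  next
    case 2
    have nb: "\<not> b < 0" using 2 by simp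
    have nz: "rGamma (pA z) \<noteq> 0" "rGamma (pB z) \<noteq> 0"
      using assms unfolding P0_def if_not_P[OF nb] if_P[OF 2] by auto
    then have d: "deriv rGamma (pA z) = - rGamma (pA z) * Digamma (pA z)" "deriv rGamma (pB z) = - rGamma (pB z) * Digamma (pB z)"
      using DERIV_imp_deriv[OF has_field_derivative_rGamma_no_nonpos_int[of "pA z" UNIV]]
        DERIV_imp_deriv[OF has_field_derivative_rGamma_no_nonpos_int[of "pB z" UNIV]]
      by (auto simp: rGamma_eq_zero_iff)
    have "P1 z / P0 z = (deriv rGamma (pA z) * rGamma (pB z) + rGamma (pA z) * deriv rGamma (pB z) - 2 * euler_mascheroni * rGamma (pA z) * rGamma (pB z)) /
      (of_real (2 powr (a + 1)) * (rGamma (pA z) * rGamma (pB z)))"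
      unfolding P0_def P1_def using 2 n by (simp add: nonzero_mult_divide_mult_cancel_left)
    also have "\<dots> = (- (2 * euler_mascheroni + Digamma (pA z) + Digamma (pB z)) * (rGamma (pA z) * rGamma (pB z))) / (of_real (2 powr (a + 1)) * (rGamma (pA z) * rGamma (pB z)))"
      unfolding d by (simp add: algebra_simps)
    also have "\<dots> = - (2 * euler_mascheroni + Digamma (pA z) + Digamma (pB z)) / of_real (2 powr (a + 1))"
      using nz by (intro nonzero_mult_divide_mult_cancel_right) auto
    also have "\<dots> = m0_formula a b z"
    proof -
      have "2 powr (- a - 1) * 2 powr (a + 1) = (1::real)" by (simp flip: powr_add)
      then have "complex_of_real (2 powr (- a - 1)) * of_real (2 powr (a + 1)) = 1" by (simp only: flip: of_real_mult) simp
      then have "inverse (complex_of_real (2 powr (a + 1))) = of_real (2 powr (- a - 1))" by (intro inverse_unique) (simp only: mult.commute)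
      then show ?thesis unfolding m0 if_not_P[OF nb] if_P[OF 2] divide_inverse by (simp add: algebra_simps)
    qed
    finally show ?thesis .
  next
    case 3
    have "- b \<notin> \<int>\<^sub>\<le>\<^sub>0" using 3 b by (intro notin_nonpos_Ints_between) auto
    from Gamma_plus1[OF this] have g: "Gamma (1 - b) = - b * Gamma (- b)" by simp
    have "b \<notin> \<int>\<^sub>\<le>\<^sub>0" using 3 by (auto elim!: nonpos_Ints_cases)
    from Gamma_plus1[OF this] have g2: "Gamma (1 + b) = b * Gamma b" by (simp add: add.commute)
    have "Gamma b > 0" using 3 by (rule Gamma_real_pos)
    then have g0: "Gamma b \<noteq> 0" by linarith
    have nb: "\<not> b < 0" "b \<noteq> 0" using 3 by auto
    have "P1 z / P0 z = (of_real (Gamma (- b)) * (rGamma (of_real ?c - pA z) * rGamma (of_real ?c - pB z))) /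
       (of_real (b * 2 powr (a + 1) * 2 powr b) * of_real (Gamma b) * (rGamma (pA z) * rGamma (pB z)))"
      unfolding P0_def P1_def if_not_P[OF nb(1)] if_not_P[OF nb(2)] using n by (rule nonzero_mult_divide_mult_cancel_left)
    also have "\<dots> = (of_real (Gamma (- b)) / (of_real (b * 2 powr (a + 1) * 2 powr b) * of_real (Gamma b))) *
       ((Gamma (pA z) * Gamma (pB z)) / (Gamma (of_real ?c - pA z) * Gamma (of_real ?c - pB z)))"
      unfolding rGamma_inverse_Gamma by (simp add: divide_inverse mult_ac)
    also have "of_real (Gamma (- b)) / (of_real (b * 2 powr (a + 1) * 2 powr b) * of_real (Gamma b)) =
       - complex_of_real (inverse b * 2 powr (- 1 - a - b)) * (of_real (Gamma (1 - b)) / of_real (Gamma (1 + b)))"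
    proof -
      have "(2::real) powr (- 1 - a - b) = 2 powr (- (a + 1 + b))" by (rule arg_cong) simp
      then have "(2::real) powr (- 1 - a - b) = inverse (2 powr (a + 1) * 2 powr b)"
        by (simp only: powr_minus powr_add)
      then have "Gamma (- b) / (b * 2 powr (a + 1) * 2 powr b * Gamma b) = - (inverse b * 2 powr (- 1 - a - b)) * (Gamma (1 - b) / Gamma (1 + b))"
        unfolding g g2 using g0 nb by (simp add: field_simps)
      from arg_cong[OF this, of complex_of_real] show ?thesis by (simp only: of_real_mult of_real_divide of_real_minus)
    qed
    finally show ?thesis unfolding m0 if_not_P[OF nb(1)] if_not_P[OF nb(2)] Gamma_complex_of_real by (simp only: times_divide_eq_right)
  qed
qed

end

section \<open>Weighted square integrable functions and the Wronskian\<close>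

lemma L2w_iff:
  assumes "S \<in> sets lebesgue"
  shows "L2w w S f \<longleftrightarrow> f \<in> borel_measurable (lebesgue_on S) \<and> (\<lambda>x. (cmod (f x))\<^sup>2 * w x) integrable_on S"
  unfolding L2w_def using measurable_on_iff_borel_measurable[OF assms] by blast

lemma continuous_on_pw_rw:
  "continuous_on {-1<..<1} (pw a b)" "continuous_on {-1<..<1} (rw a b)"
  unfolding pw_def[abs_def] rw_def[abs_def] by (auto intro!: continuous_intros)

lemma L2w_subset:
  assumes "L2w w S f" "S \<in> sets lebesgue" "T \<in> sets lebesgue" "T \<subseteq> S" "\<And>x. x \<in> S \<Longrightarrow> w x \<ge> 0"
  shows "L2w w T f"
proof -
  note f = assms(1)[unfolded L2w_iff[OF assms(2)]]
  have "(\<lambda>x. (cmod (f x))\<^sup>2 * w x) absolutely_integrable_on S"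
    using f assms(5) by (intro nonnegative_absolutely_integrable_1) auto
  then have "(\<lambda>x. (cmod (f x))\<^sup>2 * w x) absolutely_integrable_on T"
    by (rule set_integrable_subset) (use assms in auto)
  moreover have "f \<in> borel_measurable (lebesgue_on T)"
    using f measurable_restrict_mono[OF _ assms(4)] by blast
  ultimately show ?thesis unfolding L2w_iff[OF assms(3)] by (simp add: absolutely_integrable_on_def)
qed

lemma L2w_cmult:
  assumes "L2w w S f" "S \<in> sets lebesgue"
  shows "L2w w S (\<lambda>x. c * f x)"
proof -
  have "(\<lambda>x. (cmod c)\<^sup>2 * ((cmod (f x))\<^sup>2 * w x)) integrable_on S"
    using assms(1)[unfolded L2w_iff[OF assms(2)]] by (intro integrable_on_mult_right) auto
  then show ?thesis using assms(1) unfolding L2w_iff[OF assms(2)]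
    by (auto simp: norm_mult power_mult_distrib mult_ac intro: borel_measurable_times)
qed

lemma norm_add_sq_le: "(cmod (u + v))\<^sup>2 \<le> 2 * (cmod u)\<^sup>2 + 2 * (cmod v)\<^sup>2"
proof -
  have "(cmod (u + v))\<^sup>2 \<le> (cmod u + cmod v)\<^sup>2" by (intro power_mono norm_triangle_ineq) auto
  also have "\<dots> \<le> 2 * (cmod u)\<^sup>2 + 2 * (cmod v)\<^sup>2"
    using sum_squares_bound[of "cmod u" "cmod v"] by (simp add: power2_sum)
  finally show ?thesis .
qed

text \<open>The constant sqrt 2 replaces Minkowski's inequality. This is good enough, since a
  resolvent needs only some bound.\<close>

lemma L2w_add:
  assumes f: "L2w w S f" and g: "L2w w S g" and S: "S \<in> sets lebesgue"
    and w: "w \<in> borel_measurable (lebesgue_on S)" "\<And>x. x \<in> S \<Longrightarrow> w x \<ge> 0"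
  shows "L2w w S (\<lambda>x. f x + g x)"
    and "l2norm w S (\<lambda>x. f x + g x) \<le> sqrt 2 * (l2norm w S f + l2norm w S g)"
proof -
  have fm: "f \<in> borel_measurable (lebesgue_on S)" "g \<in> borel_measurable (lebesgue_on S)"
    and fi: "(\<lambda>x. (cmod (f x))\<^sup>2 * w x) integrable_on S" "(\<lambda>x. (cmod (g x))\<^sup>2 * w x) integrable_on S"
    using f g unfolding L2w_iff[OF S] by auto
  have m: "(\<lambda>x. (cmod (f x + g x))\<^sup>2 * w x) \<in> borel_measurable (lebesgue_on S)"
    using fm w(1) by measurable
  have i: "(\<lambda>x. 2 * ((cmod (f x))\<^sup>2 * w x) + 2 * ((cmod (g x))\<^sup>2 * w x)) integrable_on S"
    by (intro integrable_add integrable_on_mult_right fi)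
  have le: "(cmod (f x + g x))\<^sup>2 * w x \<le> 2 * ((cmod (f x))\<^sup>2 * w x) + 2 * ((cmod (g x))\<^sup>2 * w x)" if "x \<in> S" for x
    using mult_right_mono[OF norm_add_sq_le w(2)[OF that], of "f x" "g x"] by (simp add: algebra_simps)
  have "(\<lambda>x. (cmod (f x + g x))\<^sup>2 * w x) absolutely_integrable_on S"
    using le w(2) by (intro measurable_bounded_by_integrable_imp_absolutely_integrable[OF m S i]) auto
  then have ii: "(\<lambda>x. (cmod (f x + g x))\<^sup>2 * w x) integrable_on S" by (simp add: absolutely_integrable_on_def)
  then show "L2w w S (\<lambda>x. f x + g x)" using fm unfolding L2w_iff[OF S] by simp
  define X Y where "X = integral S (\<lambda>x. (cmod (f x))\<^sup>2 * w x)" and "Y = integral S (\<lambda>x. (cmod (g x))\<^sup>2 * w x)"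
  have XY: "X \<ge> 0" "Y \<ge> 0" unfolding X_def Y_def using w(2) by (auto intro!: integral_nonneg fi)
  have "integral S (\<lambda>x. (cmod (f x + g x))\<^sup>2 * w x) \<le> integral S (\<lambda>x. 2 * ((cmod (f x))\<^sup>2 * w x) + 2 * ((cmod (g x))\<^sup>2 * w x))"
    using le by (intro integral_le ii i)
  also have "\<dots> = 2 * (X + Y)"
    unfolding X_def Y_def by (subst integral_add) (auto intro!: integrable_on_mult_right fi)
  finally have "sqrt (integral S (\<lambda>x. (cmod (f x + g x))\<^sup>2 * w x)) \<le> sqrt 2 * sqrt (X + Y)"
    by (simp flip: real_sqrt_mult)
  also have "sqrt (X + Y) \<le> sqrt X + sqrt Y" using XY by (rule sqrt_add_le_add_sqrt)
  finally show "l2norm w S (\<lambda>x. f x + g x) \<le> sqrt 2 * (l2norm w S f + l2norm w S g)"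
    by (simp add: l2norm_def X_def Y_def)
qed

text \<open>The weighted inequality of means is optimal at l = sqrt Y / sqrt X. The perturbation by
  e > 0 keeps this quotient meaningful when X or Y is 0.\<close>

lemma le_sqrt_mult_sqrt:
  assumes le: "\<And>l. l > 0 \<Longrightarrow> 2 * I \<le> l * X + Y / l" and X: "X \<ge> 0" and Y: "Y \<ge> 0"
  shows "I \<le> sqrt X * sqrt Y"
proof (rule tendsto_lowerbound)
  have "((\<lambda>e. (sqrt X + e) * (sqrt Y + e)) \<longlongrightarrow> (sqrt X + 0) * (sqrt Y + 0)) (at_right 0)"
    by (intro tendsto_intros)
  then show "((\<lambda>e. (sqrt X + e) * (sqrt Y + e)) \<longlongrightarrow> sqrt X * sqrt Y) (at_right 0)" by simp
  have "\<forall>\<^sub>F e in at_right (0::real). e > 0" by (rule eventually_at_right_less)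
  then show "\<forall>\<^sub>F e in at_right 0. I \<le> (sqrt X + e) * (sqrt Y + e)"
  proof eventually_elim
    case (elim e)
    define p q where "p = sqrt X + e" and "q = sqrt Y + e"
    have p: "p > 0" "q > 0" using elim X Y by (simp_all add: p_def q_def add_nonneg_pos)
    have "(sqrt X)\<^sup>2 \<le> p\<^sup>2" "(sqrt Y)\<^sup>2 \<le> q\<^sup>2"
      using elim X Y unfolding p_def q_def by (intro power_mono; simp)+
    then have XY: "X \<le> p * p" "Y \<le> q * q" using X Y by (simp_all add: power2_eq_square)
    have "q / p > 0" using p by simp
    then have "2 * I \<le> q / p * X + Y / (q / p)" by (rule le)
    also have "\<dots> \<le> q / p * (p * p) + q * q / (q / p)"
      using XY p by (intro add_mono mult_left_mono divide_right_mono) auto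
    also have "q / p * (p * p) = q * p" using p by simp
    also have "q * q / (q / p) = q * p" using p by simp
    finally show ?case by (simp add: p_def q_def mult.commute)
  qed
qed auto

lemma L2w_Cauchy_Schwarz:
  assumes f: "L2w w S f" and g: "L2w w S g" and S: "S \<in> sets lebesgue"
    and w: "w \<in> borel_measurable (lebesgue_on S)" "\<And>x. x \<in> S \<Longrightarrow> w x \<ge> 0"
  shows "(\<lambda>x. of_real (w x) * (f x * g x)) absolutely_integrable_on S"
    and "integral S (\<lambda>x. w x * (cmod (f x) * cmod (g x))) \<le> l2norm w S f * l2norm w S g"
proof -
  have fm: "f \<in> borel_measurable (lebesgue_on S)" "g \<in> borel_measurable (lebesgue_on S)"
    and fi: "(\<lambda>x. (cmod (f x))\<^sup>2 * w x) integrable_on S" "(\<lambda>x. (cmod (g x))\<^sup>2 * w x) integrable_on S"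
    using f g unfolding L2w_iff[OF S] by auto
  have i: "(\<lambda>x. l * ((cmod (f x))\<^sup>2 * w x) + 1 / l * ((cmod (g x))\<^sup>2 * w x)) integrable_on S" for l
    by (intro integrable_add integrable_on_mult_right fi)
  have le: "2 * (w x * (cmod (f x) * cmod (g x))) \<le> l * ((cmod (f x))\<^sup>2 * w x) + 1 / l * ((cmod (g x))\<^sup>2 * w x)"
    if l: "l > 0" and x: "x \<in> S" for x l
  proof -
    have "0 \<le> (sqrt l * cmod (f x) - cmod (g x) / sqrt l)\<^sup>2" by simp
    also have "\<dots> = l * (cmod (f x))\<^sup>2 + 1 / l * (cmod (g x))\<^sup>2 - 2 * (cmod (f x) * cmod (g x))"
      using l by (simp add: power2_diff power_mult_distrib power_divide)
    finally have "w x * (2 * (cmod (f x) * cmod (g x))) \<le> w x * (l * (cmod (f x))\<^sup>2 + 1 / l * (cmod (g x))\<^sup>2)"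
      using w(2)[OF x] by (intro mult_left_mono) auto
    then show ?thesis by (simp add: algebra_simps)
  qed
  have m: "(\<lambda>x. complex_of_real (w x) * (f x * g x)) \<in> borel_measurable (lebesgue_on S)"
    using fm w(1) by measurable
  show ai: "(\<lambda>x. of_real (w x) * (f x * g x)) absolutely_integrable_on S"
  proof (rule measurable_bounded_by_integrable_imp_absolutely_integrable[OF m S i[of 1]])
    fix x assume x: "x \<in> S"
    have "norm (of_real (w x) * (f x * g x)) = w x * (cmod (f x) * cmod (g x))"
      using w(2)[OF x] by (simp add: norm_mult)
    also have "\<dots> \<le> 2 * (w x * (cmod (f x) * cmod (g x)))" using w(2)[OF x] by simp
    also have "\<dots> \<le> 1 * ((cmod (f x))\<^sup>2 * w x) + 1 / 1 * ((cmod (g x))\<^sup>2 * w x)"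
      using x by (intro le) auto
    finally show "norm (of_real (w x) * (f x * g x)) \<le> 1 * ((cmod (f x))\<^sup>2 * w x) + 1 / 1 * ((cmod (g x))\<^sup>2 * w x)" .
  qed
  then have "(\<lambda>x. norm (complex_of_real (w x) * (f x * g x))) integrable_on S"
    by (simp add: absolutely_integrable_on_def)
  then have ii: "(\<lambda>x. w x * (cmod (f x) * cmod (g x))) integrable_on S"
    by (rule integrable_eq) (use w(2) in \<open>auto simp: norm_mult\<close>)
  show "integral S (\<lambda>x. w x * (cmod (f x) * cmod (g x))) \<le> l2norm w S f * l2norm w S g"
    unfolding l2norm_def
  proof (rule le_sqrt_mult_sqrt)
    fix l :: real assume l: "l > 0"
    have "integral S (\<lambda>x. 2 * (w x * (cmod (f x) * cmod (g x)))) \<le> integral S (\<lambda>x. l * ((cmod (f x))\<^sup>2 * w x) + 1 / l * ((cmod (g x))\<^sup>2 * w x))"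
      using le l by (intro integral_le i integrable_on_mult_right ii)
    also have "\<dots> = l * integral S (\<lambda>x. (cmod (f x))\<^sup>2 * w x) + 1 / l * integral S (\<lambda>x. (cmod (g x))\<^sup>2 * w x)"
      by (subst integral_add) (intro integrable_on_mult_right fi, intro integrable_on_mult_right fi, simp)
    finally show "2 * integral S (\<lambda>x. w x * (cmod (f x) * cmod (g x))) \<le> l * integral S (\<lambda>x. (cmod (f x))\<^sup>2 * w x) + integral S (\<lambda>x. (cmod (g x))\<^sup>2 * w x) / l"
      by simp
  qed (use w(2) in \<open>auto intro!: integral_nonneg fi\<close>)
qed

lemma integral_diff_eq:
  fixes F :: "real \<Rightarrow> 'a :: banach"
  assumes "F integrable_on {c..d}" "c \<le> x" "x \<le> y" "y \<le> d"
  shows "integral {c..y} F - integral {c..x} F = integral {x..y} F"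
proof -
  have "F integrable_on {c..y}" using assms by (auto intro: integrable_on_subinterval)
  from Henstock_Kurzweil_Integration.integral_combine[OF assms(2,3) this] show ?thesis by (simp add: algebra_simps)
qed

text \<open>Product rule for the indefinite integral of an integrable function that need not be differentiable anywhere:
  the difference of the two sides has increments $O(|y-x| \int_x^y |k|)$, hence derivative zero.\<close>
lemma product_rule_indefinite_integral:
  fixes k u u' :: "real \<Rightarrow> complex"
  assumes cd: "c \<le> d" and k: "k absolutely_integrable_on {c..d}"
    and u: "\<And>x. x \<in> {c..d} \<Longrightarrow> (u has_vector_derivative u' x) (at x within {c..d})"
    and u': "continuous_on {c..d} u'"
  shows "(\<lambda>s. u' s * integral {c..s} k + u s * k s) absolutely_integrable_on {c..d}"
    and "u d * integral {c..d} k = integral {c..d} (\<lambda>s. u' s * integral {c..s} k + u s * k s)"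
proof -
  have ki: "k integrable_on {c..d}" "(\<lambda>s. norm (k s)) integrable_on {c..d}" using k by (auto simp: absolutely_integrable_on_def)
  define G where "G x = integral {c..x} k" for x
  define J where "J x = integral {c..x} (\<lambda>s. norm (k s))" for x
  have Gc: "continuous_on {c..d} G" unfolding G_def by (intro indefinite_integral_continuous_1 ki)
  have Jc: "continuous_on {c..d} J" unfolding J_def by (intro indefinite_integral_continuous_1 ki)
  have uc: "continuous_on {c..d} u" using u by (intro continuous_on_vector_derivative) auto
  have p1: "(\<lambda>s. u' s * G s) absolutely_integrable_on {c..d}"
    by (intro absolutely_integrable_continuous_real continuous_intros u' Gc)
  have p2: "(\<lambda>s. v s * k s) absolutely_integrable_on {c..d}" if "continuous_on {c..d} v" for v :: "real \<Rightarrow> complex"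
    using that k by (intro absolutely_integrable_bounded_measurable_product[OF bilinear_times])
      (auto intro!: continuous_imp_measurable_on_sets_lebesgue compact_imp_bounded compact_continuous_image)
  show ai: "(\<lambda>s. u' s * integral {c..s} k + u s * k s) absolutely_integrable_on {c..d}"
    unfolding G_def[symmetric] by (intro set_integral_add p1 p2 uc)
  define I where "I s = u' s * G s + u s * k s" for s
  have Ii: "I integrable_on {c..d}" using ai unfolding I_def[abs_def] G_def by (simp add: absolutely_integrable_on_def)
  define E where "E x = u x * G x - integral {c..x} I" for x
  obtain M where M: "M > 0" "\<And>x. x \<in> {c..d} \<Longrightarrow> norm (u' x) \<le> M"
  proof -
    have "bounded (u' ` {c..d})" by (intro compact_imp_bounded compact_continuous_image u') auto
    then show ?thesis using that unfolding bounded_pos by auto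
  qed
  have GJ: "norm (G y - G x) \<le> J y - J x" if "c \<le> x" "x \<le> y" "y \<le> d" for x y
  proof -
    have "G y - G x = integral {x..y} k" "J y - J x = integral {x..y} (\<lambda>s. norm (k s))"
      unfolding G_def J_def using that by (auto intro!: integral_diff_eq[where d = d] ki)
    then show ?thesis using that ki by (auto intro!: integral_norm_bound_integral intro: integrable_on_subinterval)
  qed
  have on: "onorm (\<lambda>h. h *\<^sub>R u' x) \<le> M" if "x \<in> {c..d}" for x
  proof (rule onorm_le)
    fix h :: real
    have "\<bar>h\<bar> * norm (u' x) \<le> \<bar>h\<bar> * M" using M(2)[OF that] by (intro mult_left_mono) auto
    then show "norm (h *\<^sub>R u' x) \<le> M * norm h" by (simp add: mult.commute)
  qed
  have uu: "norm (u y - u x) \<le> M * \<bar>y - x\<bar>" if "x \<in> {c..d}" "y \<in> {c..d}" for x y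
    using differentiable_bound[of "{c..d}" u "\<lambda>x h. h *\<^sub>R u' x" M y x] u[unfolded has_vector_derivative_def] on that by simp
  have EE: "norm (E y - E x) \<le> 2 * M * (y - x) * (J y - J x)" if xy: "c \<le> x" "x \<le> y" "y \<le> d" for x y
  proof -
    have sub: "F integrable_on {x..y}" if "F integrable_on {c..d}" for F :: "real \<Rightarrow> complex"
      using that xy by (auto intro: integrable_on_subinterval)
    have ui: "(\<lambda>s. u' s * G s) integrable_on {x..y}" "(\<lambda>s. u s * k s) integrable_on {x..y}" "u' integrable_on {x..y}" "k integrable_on {x..y}"
      using p1 p2[OF uc] integrable_continuous_real[OF u'] ki(1) unfolding absolutely_integrable_on_def
      by (blast intro: sub)+
    have "(u' has_integral (u y - u x)) {x..y}"
      using xy by (intro fundamental_theorem_of_calculus) (auto intro!: has_vector_derivative_within_subset[OF u])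
    then have i1: "integral {x..y} u' = u y - u x" by (rule integral_unique)
    have i2: "integral {x..y} k = G y - G x" unfolding G_def using xy by (intro integral_diff_eq[symmetric, where d = d] ki)
    have "integral {c..y} I - integral {c..x} I = integral {x..y} I" using xy by (intro integral_diff_eq[where d = d] Ii)
    also have "\<dots> = integral {x..y} (\<lambda>s. u' s * G s) + integral {x..y} (\<lambda>s. u s * k s)"
      unfolding I_def by (intro integral_add ui)
    finally have "E y - E x = ((u y - u x) * G y - integral {x..y} (\<lambda>s. u' s * G s)) + (u x * (G y - G x) - integral {x..y} (\<lambda>s. u s * k s))"
      unfolding E_def by (simp add: algebra_simps)
    also have "(u y - u x) * G y - integral {x..y} (\<lambda>s. u' s * G s) = integral {x..y} (\<lambda>s. u' s * (G y - G s))"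
      unfolding i1[symmetric] right_diff_distrib by (subst integral_diff) (use ui integrable_on_mult_left in \<open>auto\<close>)
    also have "u x * (G y - G x) - integral {x..y} (\<lambda>s. u s * k s) = integral {x..y} (\<lambda>s. (u x - u s) * k s)"
      unfolding i2[symmetric] left_diff_distrib by (subst integral_diff) (use ui integrable_on_mult_right in \<open>auto\<close>)
    finally have E: "E y - E x = integral {x..y} (\<lambda>s. u' s * (G y - G s)) + integral {x..y} (\<lambda>s. (u x - u s) * k s)" .
    have Jm: "J x \<le> J s" if "x \<le> s" "s \<le> y" for s using GJ[of x s] xy that norm_ge_zero[of "G s - G x"] by linarith
    have "norm (integral {x..y} (\<lambda>s. u' s * (G y - G s))) \<le> integral {x..y} (\<lambda>s. M * (J y - J x))"
    proof (rule integral_norm_bound_integral)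
      show "(\<lambda>s. u' s * (G y - G s)) integrable_on {x..y}"
        unfolding right_diff_distrib using ui by (intro integrable_diff) (auto intro: integrable_on_mult_left)
      fix s assume s: "s \<in> {x..y}"
      have "norm (G y - G s) \<le> J y - J s" using s xy by (intro GJ) auto
      also have "\<dots> \<le> J y - J x" using Jm[of s] s by simp
      finally show "norm (u' s * (G y - G s)) \<le> M * (J y - J x)"
        unfolding norm_mult using M(2)[of s] M(1) s xy by (intro mult_mono) auto
    qed auto
    moreover have "norm (integral {x..y} (\<lambda>s. (u x - u s) * k s)) \<le> integral {x..y} (\<lambda>s. M * (y - x) * norm (k s))"
    proof (rule integral_norm_bound_integral)
      show "(\<lambda>s. (u x - u s) * k s) integrable_on {x..y}"
        unfolding left_diff_distrib using ui by (intro integrable_diff) (auto intro: integrable_on_mult_right)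
      show "(\<lambda>s. M * (y - x) * norm (k s)) integrable_on {x..y}"
        using ki(2) xy by (intro integrable_on_mult_right) (auto intro: integrable_on_subinterval)
      fix s assume s: "s \<in> {x..y}"
      have "norm (u x - u s) \<le> M * \<bar>x - s\<bar>" using s xy by (intro uu) auto
      also have "\<dots> \<le> M * (y - x)" using s M by (intro mult_left_mono) auto
      finally show "norm ((u x - u s) * k s) \<le> M * (y - x) * norm (k s)"
        unfolding norm_mult by (intro mult_right_mono) auto
    qed
    moreover have "integral {x..y} (\<lambda>s. M * (y - x) * norm (k s)) = M * (y - x) * (J y - J x)"
      unfolding J_def using xy by (subst integral_diff_eq[where d = d]) (auto intro: ki)
    moreover have "integral {x..y} (\<lambda>s. M * (J y - J x)) = M * (y - x) * (J y - J x)" using xy by simp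
    ultimately show ?thesis unfolding E
      using norm_triangle_ineq[of "integral {x..y} (\<lambda>s. u' s * (G y - G s))" "integral {x..y} (\<lambda>s. (u x - u s) * k s)"] by linarith
  qed
  have "\<exists>C. \<forall>x\<in>{c..d}. E x = C"
  proof (rule has_derivative_zero_constant)
    fix x assume x: "x \<in> {c..d}"
    have "((\<lambda>y. norm (E y - E x) / norm (y - x)) \<longlongrightarrow> 0) (at x within {c..d})"
    proof (rule tendsto_sandwich[OF _ _ tendsto_const])
      have "(J \<longlongrightarrow> J x) (at x within {c..d})" using Jc x by (simp add: continuous_on)
      then have "((\<lambda>y. 2 * M * \<bar>J y - J x\<bar>) \<longlongrightarrow> 2 * M * \<bar>J x - J x\<bar>) (at x within {c..d})" by (intro tendsto_intros)
      then show "((\<lambda>y. 2 * M * \<bar>J y - J x\<bar>) \<longlongrightarrow> 0) (at x within {c..d})" by simp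
      show "\<forall>\<^sub>F y in at x within {c..d}. norm (E y - E x) / norm (y - x) \<le> 2 * M * \<bar>J y - J x\<bar>"
        unfolding eventually_at_filter
      proof (intro always_eventually allI impI)
        fix y assume y: "y \<noteq> x" "y \<in> {c..d}"
        have "norm (E y - E x) \<le> 2 * M * \<bar>y - x\<bar> * \<bar>J y - J x\<bar>"
        proof (cases "x \<le> y")
          case True
          have "2 * M * (y - x) * (J y - J x) \<le> 2 * M * (y - x) * \<bar>J y - J x\<bar>" using M True by (intro mult_left_mono) auto
          with EE[of x y] x y True show ?thesis by auto
        next
          case False
          have "2 * M * (x - y) * (J x - J y) \<le> 2 * M * (x - y) * \<bar>J y - J x\<bar>" using M False by (intro mult_left_mono) auto
          with EE[of y x] x y False show ?thesis by (auto simp: norm_minus_commute)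
        qed
        then show "norm (E y - E x) / norm (y - x) \<le> 2 * M * \<bar>J y - J x\<bar>" using y by (simp add: field_simps)
      qed
    qed auto
    then have "((\<lambda>y. norm ((1 / norm (y - x)) *\<^sub>R (E y - (E x + 0)))) \<longlongrightarrow> 0) (at x within {c..d})"
      by simp
    then show "(E has_derivative (\<lambda>h. 0)) (at x within {c..d})"
      unfolding has_derivative_within by (intro conjI bounded_linear_zero) (rule tendsto_norm_zero_cancel)
  qed auto
  then obtain C where "\<And>x. x \<in> {c..d} \<Longrightarrow> E x = C" by blast
  then have "E d = C" "E c = C" using cd by simp_all
  then have "E d = E c" by simp
  then show "u d * integral {c..d} k = integral {c..d} (\<lambda>s. u' s * integral {c..s} k + u s * k s)"
    unfolding E_def G_def I_def by simp
qed

section \<open>Integrated form of tau f = k and Lagrange's identity\<close>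

text \<open>The asymmetry between f and g is intended: g is only an indefinite integral of an
  integrable function and need not be differentiable anywhere in particular, whereas f has the
  continuous derivative g/p.\<close>

definition tpair :: "real \<Rightarrow> real \<Rightarrow> (real \<Rightarrow> complex) \<Rightarrow> (real \<Rightarrow> complex) \<Rightarrow> (real \<Rightarrow> complex) \<Rightarrow> bool" where
  "tpair a b f g k \<longleftrightarrow> qpair a b f g \<and>
     (\<forall>u v. -1 < u \<and> v < 1 \<longrightarrow> (\<lambda>t. of_real (rw a b t) * k t) absolutely_integrable_on {u..v}) \<and>
     (\<forall>x y. -1 < x \<and> x \<le> y \<and> y < 1 \<longrightarrow> g y - g x = - integral {x..y} (\<lambda>t. of_real (rw a b t) * k t))"

lemma absolutely_integrable_onD:
  fixes f :: "real \<Rightarrow> complex"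
  shows "f absolutely_integrable_on S \<Longrightarrow> f integrable_on S"
  unfolding absolutely_integrable_on_def by (rule conjunct1)

lemma qpair_within:
  assumes "qpair a b f g" "-1 < x" "x < 1"
  shows "(f has_vector_derivative g x / of_real (pw a b x)) (at x within S)"
  by (rule has_vector_derivative_at_within) (use assms in \<open>simp add: qpair_def\<close>)

lemma solg_within:
  assumes "solg a b z u h" "-1 < x" "x < 1"
  shows "(h has_vector_derivative - of_real (rw a b x) * z * u x) (at x within S)"
  by (rule has_vector_derivative_at_within) (use assms in \<open>simp add: solg_def\<close>)

lemma qpair_continuous_on:
  assumes "qpair a b f g" "-1 < u" "v < 1"
  shows "continuous_on {u..v} f"
  by (rule continuous_on_vector_derivative, rule qpair_within[OF assms(1)]) (use assms(2,3) in auto)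

lemma tpair_continuous_on:
  assumes t: "tpair a b f g k" and uv: "-1 < u" "v < 1"
  shows "continuous_on {u..v} g"
proof -
  let ?F = "\<lambda>t. of_real (rw a b t) * k t"
  have "?F integrable_on {u..v}" using t uv unfolding tpair_def by (blast intro: absolutely_integrable_onD)
  then have c: "continuous_on {u..v} (\<lambda>y. g u - integral {u..y} ?F)"
    by (intro continuous_on_diff continuous_on_const indefinite_integral_continuous_1)
  show ?thesis
  proof (rule continuous_on_eq[OF c])
    fix y assume "y \<in> {u..v}"
    then have "-1 < u \<and> u \<le> y \<and> y < 1" using uv by auto
    then have "g y - g u = - integral {u..y} ?F" using t unfolding tpair_def by blast
    then show "g u - integral {u..y} ?F = g y" by (simp add: algebra_simps)
  qed
qed

lemma continuous_on_quotient_pw: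
  fixes g :: "real \<Rightarrow> complex"
  assumes "continuous_on {u..v} g" "-1 < u" "v < 1"
  shows "continuous_on {u..v} (\<lambda>t. g t / of_real (pw a b t))"
proof -
  have "continuous_on {u..v} (pw a b)" by (rule continuous_on_subset[OF continuous_on_pw_rw(1)]) (use assms in auto)
  moreover have "pw a b t \<noteq> 0" if "t \<in> {u..v}" for t using pw_pos[of t a b] that assms by auto
  ultimately show ?thesis using assms(1) by (intro continuous_intros) auto
qed

lemma continuous_on_rw_mult:
  fixes u :: "real \<Rightarrow> complex"
  assumes "continuous_on {c..d} u" "-1 < c" "d < 1"
  shows "continuous_on {c..d} (\<lambda>t. of_real (rw a b t) * u t)"
proof -
  have "continuous_on {c..d} (rw a b)" by (rule continuous_on_subset[OF continuous_on_pw_rw(2)]) (use assms in auto)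
  then show ?thesis using assms(1) by (intro continuous_intros)
qed

lemma sint_diff:
  assumes F: "loc_int F" and xy: "-1 < x" "x \<le> y" "y < 1"
  shows "sint 0 y F - sint 0 x F = integral {x..y} F"
proof -
  have i: "F integrable_on {u..v}" if "-1 < u" "v < 1" for u v
    using F that unfolding loc_int_def by (blast intro: absolutely_integrable_onD)
  consider "0 \<le> x" | "x < 0" "0 \<le> y" | "y < 0" using xy by linarith
  then show ?thesis
  proof cases
    case 1
    then show ?thesis using xy integral_diff_eq[OF i, of 0 y x y] by (auto simp: sint_def)
  next
    case 2
    then show ?thesis using xy Henstock_Kurzweil_Integration.integral_combine[OF _ _ i, of x 0 y] by (auto simp: sint_def add.commute)
  next
    case 3
    then have "integral {x..y} F + integral {y..0} F = integral {x..0} F"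
      using xy by (intro Henstock_Kurzweil_Integration.integral_combine i) auto
    then show ?thesis using 3 xy by (auto simp: sint_def algebra_simps)
  qed
qed

lemma has_vector_derivative_integral_at:
  fixes F :: "real \<Rightarrow> complex"
  assumes F: "continuous_on {u..v} F" and x: "u < x" "x < v"
    and f: "\<And>y. y \<in> {u..v} \<Longrightarrow> f y = C + integral {u..y} F"
  shows "(f has_vector_derivative F x) (at x)"
proof -
  have "((\<lambda>y. C + integral {u..y} F) has_vector_derivative 0 + F x) (at x within {u..v})"
    using F x by (intro has_vector_derivative_add has_vector_derivative_const integral_has_vector_derivative) auto
  then have "((\<lambda>y. C + integral {u..y} F) has_vector_derivative F x) (at x)"
    using x by (simp add: at_within_Icc_at)
  then show ?thesis
    by (rule has_vector_derivative_transform_within_open[where S = "{u<..<v}"]) (use x f in auto)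
qed

lemma eq_of_diff_eq:
  fixes x y q :: complex
  shows "y - x = q \<Longrightarrow> y = x + q" "x - y = q \<Longrightarrow> y = x + - q" "y - x = - q \<Longrightarrow> y = x - q" "x - y = - q \<Longrightarrow> y = x - - q"
proof -
  have 1: "y - x = q \<Longrightarrow> y = x + q" and 2: "x - y = q \<Longrightarrow> y = x + - q" for x y q :: complex
    by (erule subst, simp)+
  show "y - x = q \<Longrightarrow> y = x + q" "x - y = q \<Longrightarrow> y = x + - q" by (fact 1, fact 2)
  show "y - x = - q \<Longrightarrow> y = x - q" unfolding diff_conv_add_uminus[of x q] by (rule 1)
  show "x - y = - q \<Longrightarrow> y = x - - q" unfolding diff_conv_add_uminus[of x "- q"] by (rule 2)
qed

text \<open>An indefinite integral g is continuous, so g/p is continuous as well and f is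
  differentiable at every point of the interval, not just almost everywhere. The integrals based at
  0 are exchanged for increments over arbitrary subintervals.\<close>

lemma Tmax_iff:
  "(f, k) \<in> Tmax a b \<longleftrightarrow> L2w (rw a b) {-1<..<1} f \<and> L2w (rw a b) {-1<..<1} k \<and> (\<exists>g. tpair a b f g k)"
proof -
  let ?F = "\<lambda>t. of_real (rw a b t) * k t"
  have "(\<exists>g. loc_int (\<lambda>t. g t / of_real (pw a b t)) \<and> loc_int ?F \<and>
        (\<forall>x\<in>{-1<..<1}. f x = f 0 + sint 0 x (\<lambda>t. g t / of_real (pw a b t))) \<and>
        (\<forall>x\<in>{-1<..<1}. g x = g 0 - sint 0 x ?F)) \<longleftrightarrow> (\<exists>g. tpair a b f g k)" (is "(\<exists>g. ?P g) \<longleftrightarrow> _")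
  proof (intro iffI; elim exE)
    fix g assume P: "?P g"
    let ?Q = "\<lambda>t. g t / of_real (pw a b t)"
    have lQ: "loc_int ?Q" and lF: "loc_int ?F" using P by blast+
    have fx: "f x = f 0 + sint 0 x ?Q" and gx: "g x = g 0 - sint 0 x ?F" if "x \<in> {-1<..<1}" for x
      using P[THEN conjunct2, THEN conjunct2] that by blast+
    have gi: "g y - g x = - integral {x..y} ?F" if xy: "-1 < x" "x \<le> y" "y < 1" for x y
    proof -
      have "x \<in> {-1<..<1}" "y \<in> {-1<..<1}" using xy by auto
      from arg_cong2[where f = minus, OF gx[OF this(2)] gx[OF this(1)]]
      have "g y - g x = g 0 - sint 0 y ?F - (g 0 - sint 0 x ?F)" .
      also have "\<dots> = - (sint 0 y ?F - sint 0 x ?F)" by simp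
      finally show ?thesis unfolding sint_diff[OF lF xy] .
    qed
    have fi: "f y - f x = integral {x..y} ?Q" if xy: "-1 < x" "x \<le> y" "y < 1" for x y
    proof -
      have "x \<in> {-1<..<1}" "y \<in> {-1<..<1}" using xy by auto
      from arg_cong2[where f = minus, OF fx[OF this(2)] fx[OF this(1)]]
      show ?thesis unfolding sint_diff[OF lQ xy, symmetric] by (simp only: add_diff_cancel_left)
    qed
    have "qpair a b f g"
      unfolding qpair_def
    proof
      fix x :: real assume x: "x \<in> {-1<..<1}"
      define u v where "u = (x - 1) / 2" and "v = (x + 1) / 2"
      have uv: "-1 < u" "u < x" "x < v" "v < 1" using x by (simp_all add: u_def v_def)
      have "?F absolutely_integrable_on {u..v}" by (rule lF[unfolded loc_int_def, rule_format]) (intro conjI uv)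
      then have "?F integrable_on {u..v}" by (rule absolutely_integrable_onD)
      then have c: "continuous_on {u..v} (\<lambda>y. g u - integral {u..y} ?F)"
        by (rule continuous_on_diff[OF continuous_on_const indefinite_integral_continuous_1])
      have "g u - integral {u..y} ?F = g y" if "y \<in> {u..v}" for y
      proof -
        have "u \<le> y" "y < 1" using uv that by auto
        from gi[OF uv(1) this] have "g y - g u = - integral {u..y} ?F" .
        then show ?thesis by (rule eq_of_diff_eq(3)[symmetric])
      qed
      from continuous_on_eq[OF c this] have "continuous_on {u..v} g" .
      from continuous_on_quotient_pw[OF this uv(1,4)] have "continuous_on {u..v} ?Q" .
      then show "(f has_vector_derivative ?Q x) (at x)"
      proof (rule has_vector_derivative_integral_at[where C = "f u", OF _ uv(2,3)])
        fix y assume "y \<in> {u..v}"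
        then have "u \<le> y" "y < 1" using uv by auto
        from fi[OF uv(1) this] have "f y - f u = integral {u..y} ?Q" .
        then show "f y = f u + integral {u..y} ?Q" by (rule eq_of_diff_eq)
      qed
    qed
    then have "tpair a b f g k" unfolding tpair_def
      by (intro conjI allI impI, assumption) (rule lF[unfolded loc_int_def, rule_format], assumption, elim conjE, rule gi)
    then show "\<exists>g. tpair a b f g k" by (rule exI[where x = g])
  next
    fix g assume t: "tpair a b f g k"
    let ?Q = "\<lambda>t. g t / of_real (pw a b t)"
    have q: "qpair a b f g" using t by (simp add: tpair_def)
    have Qc: "continuous_on {u..v} ?Q" if "-1 < u" "v < 1" for u v
      using that t by (intro continuous_on_quotient_pw tpair_continuous_on)
    have lq: "loc_int ?Q" unfolding loc_int_def using Qc by (auto intro: absolutely_integrable_continuous_real)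
    have lF: "loc_int ?F" using t unfolding loc_int_def tpair_def by blast
    have "f y - f x = integral {x..y} ?Q" if "-1 < x" "x \<le> y" "y < 1" for x y
    proof -
      have "(?Q has_integral (f y - f x)) {x..y}"
        using that by (intro fundamental_theorem_of_calculus qpair_within[OF q]) auto
      then show ?thesis by (simp add: integral_unique)
    qed
    note fi = this
    have f0: "f x = f 0 + sint 0 x ?Q" if "x \<in> {-1<..<1}" for x
    proof (cases "0 \<le> x")
      case True
      then have "f x - f 0 = integral {0..x} ?Q" using that by (intro fi) auto
      then show ?thesis unfolding sint_def if_P[OF True] by (rule eq_of_diff_eq)
    next
      case False
      then have "f 0 - f x = integral {x..0} ?Q" using that by (intro fi) auto
      then show ?thesis unfolding sint_def if_not_P[OF False] by (rule eq_of_diff_eq)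
    qed
    have gi: "g y - g x = - integral {x..y} ?F" if "-1 < x" "x \<le> y" "y < 1" for x y
      using t that unfolding tpair_def by blast
    have g0: "g x = g 0 - sint 0 x ?F" if "x \<in> {-1<..<1}" for x
    proof (cases "0 \<le> x")
      case True
      then have "g x - g 0 = - integral {0..x} ?F" using that by (intro gi) auto
      then show ?thesis unfolding sint_def if_P[OF True] by (rule eq_of_diff_eq)
    next
      case False
      then have "g 0 - g x = - integral {x..0} ?F" using that by (intro gi) auto
      then show ?thesis unfolding sint_def if_not_P[OF False] by (rule eq_of_diff_eq)
    qed
    have "?P g" using lq lF f0 g0 by (intro conjI ballI)
    then show "\<exists>g. ?P g" by (rule exI[where x = g])
  qed
  then show ?thesis unfolding Tmax_def by (simp only: mem_Collect_eq case_prod_conv)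
qed

lemma tpair_add_cmult:
  assumes t: "tpair a b f g k" and t': "tpair a b f' g' k'"
  shows "tpair a b (\<lambda>x. f x + c * f' x) (\<lambda>x. g x + c * g' x) (\<lambda>x. k x + c * k' x)"
  unfolding tpair_def
proof (intro conjI allI impI)
  show "qpair a b (\<lambda>x. f x + c * f' x) (\<lambda>x. g x + c * g' x)"
    using t t' by (intro qpair_add qpair_cmult) (auto simp: tpair_def)
  let ?F = "\<lambda>t. of_real (rw a b t) * k t" and ?F' = "\<lambda>t. of_real (rw a b t) * k' t"
  have eq: "(\<lambda>t. of_real (rw a b t) * (k t + c * k' t)) = (\<lambda>t. ?F t + c * ?F' t)" by (simp add: fun_eq_iff algebra_simps)
  have ai: "?F absolutely_integrable_on {u..v}" "?F' absolutely_integrable_on {u..v}" if "-1 < u" "v < 1" for u v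
    using t t' that unfolding tpair_def by blast+
  then show "(\<lambda>t. of_real (rw a b t) * (k t + c * k' t)) absolutely_integrable_on {u..v}" if "-1 < u \<and> v < 1" for u v
    unfolding eq using that by (intro set_integral_add set_integrable_mult_right) auto
  fix x y :: real assume xy: "-1 < x \<and> x \<le> y \<and> y < 1"
  have "integral {x..y} (\<lambda>t. ?F t + c * ?F' t) = integral {x..y} ?F + integral {x..y} (\<lambda>t. c * ?F' t)"
    using ai[of x y] xy by (intro integral_add integrable_on_mult_right absolutely_integrable_onD) auto
  also have "integral {x..y} (\<lambda>t. c * ?F' t) = c * integral {x..y} ?F'" by simp
  finally have i: "integral {x..y} (\<lambda>t. ?F t + c * ?F' t) = integral {x..y} ?F + c * integral {x..y} ?F'" .
  have "g y - g x = - integral {x..y} ?F" "g' y - g' x = - integral {x..y} ?F'"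
    using t t' xy unfolding tpair_def by blast+
  then have "(g y - g x) + c * (g' y - g' x) = - (integral {x..y} ?F + c * integral {x..y} ?F')" by simp
  then show "g y + c * g' y - (g x + c * g' x) = - integral {x..y} (\<lambda>t. of_real (rw a b t) * (k t + c * k' t))"
    unfolding eq i by (simp add: algebra_simps)
qed

lemma solg_tpair:
  assumes s: "solg a b z u h"
  shows "tpair a b u h (\<lambda>x. z * u x)"
  unfolding tpair_def
proof (intro conjI allI impI)
  show q: "qpair a b u h" using s by (rule solg_qpair)
  have c: "continuous_on {c..d} (\<lambda>t. of_real (rw a b t) * (z * u t))" if "-1 < c" "d < 1" for c d
    using that q by (intro continuous_on_rw_mult continuous_on_mult_left qpair_continuous_on)
  then show "(\<lambda>t. of_real (rw a b t) * (z * u t)) absolutely_integrable_on {c..d}" if "-1 < c \<and> d < 1" for c d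
    using that by (intro absolutely_integrable_continuous_real) auto
  fix x y :: real assume xy: "-1 < x \<and> x \<le> y \<and> y < 1"
  have "((\<lambda>t. - of_real (rw a b t) * z * u t) has_integral (h y - h x)) {x..y}"
    using xy by (intro fundamental_theorem_of_calculus solg_within[OF s]) auto
  then have "((\<lambda>t. - (of_real (rw a b t) * (z * u t))) has_integral (h y - h x)) {x..y}" by (simp add: mult.assoc)
  then have "((\<lambda>t. - (- (of_real (rw a b t) * (z * u t)))) has_integral - (h y - h x)) {x..y}" by (rule has_integral_neg)
  then show "h y - h x = - integral {x..y} (\<lambda>t. of_real (rw a b t) * (z * u t))" by (simp add: integral_unique)
qed

text \<open>Regularity bootstrap: for k = z f the integrand is continuous, so g is differentiable
  everywhere and f is a classical solution.\<close>

lemma tpair_solg: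
  assumes t: "tpair a b f g (\<lambda>x. z * f x)"
  shows "solg a b z f g"
  unfolding solg_def
proof (intro ballI conjI)
  have q: "qpair a b f g" using t by (simp add: tpair_def)
  fix x :: real assume x: "x \<in> {-1<..<1}"
  then show "(f has_vector_derivative g x / of_real (pw a b x)) (at x)" using q by (simp add: qpair_def)
  define u v where "u = (x - 1) / 2" and "v = (x + 1) / 2"
  have uv: "-1 < u" "u < x" "x < v" "v < 1" using x by (auto simp: u_def v_def)
  have "continuous_on {u..v} (\<lambda>t. of_real (rw a b t) * (z * f t))"
    using uv q by (intro continuous_on_rw_mult continuous_on_mult_left qpair_continuous_on)
  then have c: "continuous_on {u..v} (\<lambda>t. - (of_real (rw a b t) * (z * f t)))" by (rule continuous_on_minus)
  have "(g has_vector_derivative - (of_real (rw a b x) * (z * f x))) (at x)"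
  proof (rule has_vector_derivative_integral_at[OF c, where C = "g u"])
    fix y assume y: "y \<in> {u..v}"
    then have "-1 < u \<and> u \<le> y \<and> y < 1" using uv by auto
    then have "g y - g u = - integral {u..y} (\<lambda>t. of_real (rw a b t) * (z * f t))"
      using t unfolding tpair_def by blast
    then show "g y = g u + integral {u..y} (\<lambda>t. - (of_real (rw a b t) * (z * f t)))" by (simp add: algebra_simps)
  qed (use uv in auto)
  then show "(g has_vector_derivative - of_real (rw a b x) * z * f x) (at x)" by (simp add: mult.assoc)
qed

text \<open>Bilinear, without conjugation, so that two solutions for the same z have a constant
  Wronskian.\<close>

definition wrk :: "(real \<Rightarrow> complex) \<Rightarrow> (real \<Rightarrow> complex) \<Rightarrow> (real \<Rightarrow> complex) \<Rightarrow> (real \<Rightarrow> complex) \<Rightarrow> real \<Rightarrow> complex" where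
  "wrk f g u h x = f x * h x - u x * g x"

text \<open>Only g lacks a derivative. Writing g = g(c) - G, with G the indefinite integral from c
  of the weight times k, the part f h - g(c) u of the Wronskian obeys the fundamental theorem, and u
  G obeys the product rule for indefinite integrals.\<close>

lemma lagrange_identity:
  assumes t: "tpair a b f g k" and s: "solg a b z u h" and cd: "-1 < c" "c \<le> d" "d < 1"
  shows "(\<lambda>t. of_real (rw a b t) * (u t * (k t - z * f t))) absolutely_integrable_on {c..d}"
    and "wrk f g u h d - wrk f g u h c = integral {c..d} (\<lambda>t. of_real (rw a b t) * (u t * (k t - z * f t)))"
proof -
  let ?F = "\<lambda>t. of_real (rw a b t) * k t" and ?p = "\<lambda>t. complex_of_real (pw a b t)" and ?r = "\<lambda>t. complex_of_real (rw a b t)"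
  define G where "G s = integral {c..s} ?F" for s
  have q: "qpair a b f g" "qpair a b u h" using t solg_qpair[OF s] by (auto simp: tpair_def)
  have F: "?F absolutely_integrable_on {c..d}" using t cd unfolding tpair_def by blast
  have uc: "continuous_on {c..d} u" and fc: "continuous_on {c..d} f" using q cd by (auto intro: qpair_continuous_on)
  have hc: "continuous_on {c..d} h" and gc: "continuous_on {c..d} g"
    using t solg_tpair[OF s] cd by (auto intro: tpair_continuous_on)
  have hpc: "continuous_on {c..d} (\<lambda>t. h t / ?p t)" using hc cd by (intro continuous_on_quotient_pw)
  have gpc: "continuous_on {c..d} (\<lambda>t. g t / ?p t)" using gc cd by (intro continuous_on_quotient_pw)
  have ud: "(u has_vector_derivative h x / ?p x) (at x within {c..d})" if "x \<in> {c..d}" for x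
    using that cd by (intro qpair_within[OF q(2)]) auto
  have P1: "(\<lambda>s. h s / ?p s * integral {c..s} ?F + u s * ?F s) absolutely_integrable_on {c..d}"
    by (rule product_rule_indefinite_integral(1)[OF cd(2) F ud hpc])
  have P2: "u d * integral {c..d} ?F = integral {c..d} (\<lambda>s. h s / ?p s * integral {c..s} ?F + u s * ?F s)"
    by (rule product_rule_indefinite_integral(2)[OF cd(2) F ud hpc])
  have Ec: "continuous_on {c..d} (\<lambda>s. (g s / ?p s) * h s + f s * (- ?r s * z * u s) - g c * (h s / ?p s))"
  proof -
    have rc: "continuous_on {c..d} (\<lambda>s. ?r s * (z * u s))" using uc cd by (intro continuous_on_rw_mult continuous_on_mult_left)
    have "continuous_on {c..d} (\<lambda>s. (g s / ?p s) * h s + f s * (- (?r s * (z * u s))) - g c * (h s / ?p s))"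
      by (intro rc gpc hpc continuous_on_add continuous_on_diff continuous_on_mult continuous_on_minus continuous_on_const gpc hpc hc fc)
    then show ?thesis by (simp add: mult.assoc)
  qed
  have "((\<lambda>s. f s * h s - g c * u s) has_vector_derivative (f s * (- ?r s * z * u s) + (g s / ?p s) * h s - g c * (h s / ?p s))) (at s within {c..d})"
    if "s \<in> {c..d}" for s
    using that cd
    by (intro has_vector_derivative_diff has_vector_derivative_mult has_vector_derivative_mult_right
        qpair_within[OF q(1)] solg_within[OF s] ud) auto
  then have "((\<lambda>s. f s * (- ?r s * z * u s) + (g s / ?p s) * h s - g c * (h s / ?p s)) has_integral (f d * h d - g c * u d - (f c * h c - g c * u c))) {c..d}"
    using cd by (intro fundamental_theorem_of_calculus) auto
  then have i1: "((\<lambda>s. (g s / ?p s) * h s + f s * (- ?r s * z * u s) - g c * (h s / ?p s)) has_integral (f d * h d - g c * u d - (f c * h c - g c * u c))) {c..d}"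
    by (simp add: add.commute)
  have i2: "((\<lambda>s. h s / ?p s * G s + u s * ?F s) has_integral u d * G d) {c..d}"
    unfolding has_integral_integrable_integral G_def using absolutely_integrable_onD[OF P1] P2[symmetric] by (rule conjI)
  have gG: "g s = g c - G s" if "s \<in> {c..d}" for s
  proof -
    have "-1 < c \<and> c \<le> s \<and> s < 1" using that cd by auto
    then have "g s - g c = - integral {c..s} ?F" using t unfolding tpair_def by blast
    then show ?thesis by (simp add: G_def algebra_simps)
  qed
  have eq: "((g s / ?p s) * h s + f s * (- ?r s * z * u s) - g c * (h s / ?p s)) + (h s / ?p s * G s + u s * ?F s) = ?r s * (u s * (k s - z * f s))"
    if "s \<in> {c..d}" for s
    unfolding gG[OF that] by (simp add: algebra_simps diff_divide_distrib)
  have "(\<lambda>s. ((g s / ?p s) * h s + f s * (- ?r s * z * u s) - g c * (h s / ?p s)) + (h s / ?p s * G s + u s * ?F s)) absolutely_integrable_on {c..d}"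
    using set_integral_add(1)[OF absolutely_integrable_continuous_real[OF Ec] P1] unfolding G_def .
  then show "(\<lambda>t. ?r t * (u t * (k t - z * f t))) absolutely_integrable_on {c..d}"
    using eq by (subst (asm) set_integrable_cong[OF refl refl]) auto
  have "((\<lambda>s. ?r s * (u s * (k s - z * f s))) has_integral ((f d * h d - g c * u d - (f c * h c - g c * u c)) + u d * G d)) {c..d}"
    using has_integral_eq[OF eq has_integral_add[OF i1 i2]] .
  moreover have "(f d * h d - g c * u d - (f c * h c - g c * u c)) + u d * G d = wrk f g u h d - wrk f g u h c"
  proof -
    have G: "G d = g c - g d" using gG[of d] cd by simp
    show ?thesis unfolding G wrk_def by (simp add: algebra_simps)
  qed
  ultimately show "wrk f g u h d - wrk f g u h c = integral {c..d} (\<lambda>t. ?r t * (u t * (k t - z * f t)))"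
    by (simp add: integral_unique)
qed

lemma borel_measurable_rw: "S \<in> sets lebesgue \<Longrightarrow> S \<subseteq> {-1<..<1} \<Longrightarrow> rw a b \<in> borel_measurable (lebesgue_on S)"
  by (intro continuous_imp_measurable_on_sets_lebesgue continuous_on_subset[OF continuous_on_pw_rw(2)])

lemma rw_nonneg: "rw a b x \<ge> 0"
  by (simp add: rw_def)

text \<open>Lagrange's identity and Cauchy-Schwarz give a bound independent of the two points. It is
  the oscillation bound M that the argument at the endpoint 1 takes as hypothesis.\<close>

lemma wrk_diff_bound:
  assumes t: "tpair a b f g k" and s: "solg a b z u h"
    and L: "L2w (rw a b) {-1<..<1} u" "L2w (rw a b) {-1<..<1} (\<lambda>x. k x - z * f x)"
    and cd: "-1 < c" "c < 1" "-1 < d" "d < 1"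
  shows "norm (wrk f g u h d - wrk f g u h c) \<le> l2norm (rw a b) {-1<..<1} u * l2norm (rw a b) {-1<..<1} (\<lambda>x. k x - z * f x)"
proof -
  let ?S = "{-1<..<1::real}" and ?N = "\<lambda>t. rw a b t * (cmod (u t) * cmod (k t - z * f t))"
  have S: "?S \<in> sets lebesgue" by simp
  note CS = L2w_Cauchy_Schwarz[OF L S borel_measurable_rw[OF S subset_refl] rw_nonneg]
  have "(\<lambda>t. norm (complex_of_real (rw a b t) * (u t * (k t - z * f t)))) integrable_on ?S"
    using CS(1) by (simp add: absolutely_integrable_on_def)
  then have Ni: "?N integrable_on ?S" by (simp add: norm_mult rw_nonneg)
  have bd: "norm (wrk f g u h y - wrk f g u h x) \<le> integral ?S ?N" if xy: "-1 < x" "x \<le> y" "y < 1" for x y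
  proof -
    note LI = lagrange_identity[OF t s xy]
    have sub: "?N integrable_on {x..y}" by (rule integrable_on_subinterval[OF Ni]) (use xy in auto)
    have "norm (wrk f g u h y - wrk f g u h x) \<le> integral {x..y} ?N"
      unfolding LI(2) by (intro integral_norm_bound_integral absolutely_integrable_onD[OF LI(1)] sub) (simp add: norm_mult rw_nonneg)
    also have "\<dots> \<le> integral ?S ?N"
      using xy by (intro integral_subset_le sub Ni) (auto simp: rw_nonneg)
    finally show ?thesis .
  qed
  have "norm (wrk f g u h d - wrk f g u h c) \<le> integral ?S ?N"
    using bd[of c d] bd[of d c] cd by (cases "c \<le> d") (auto simp: norm_minus_commute)
  then show ?thesis using CS(2) by linarith
qed

section \<open>The limit point endpoint 1\<close>

lemma not_integrable_inverse_at_1: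
  fixes F :: "real \<Rightarrow> real"
  assumes c: "c < 1" and F: "F integrable_on {c<..<1}" and C: "C > 0"
    and le: "\<And>y. c < y \<Longrightarrow> y < 1 \<Longrightarrow> C / (1 - y) \<le> F y"
  shows False
proof -
  define I where "I = integral {c<..<1} F"
  define d where "d = (c + 1) / 2"
  have d: "c < d" "d < 1" using c by (auto simp: d_def)
  have F0: "F y \<ge> 0" if "y \<in> {c<..<1}" for y
  proof -
    have "0 \<le> C / (1 - y)" using that C by simp
    with le[of y] that show ?thesis by simp
  qed
  have bd: "C * (ln (1 - d) - ln (1 - y)) \<le> I" if y: "d \<le> y" "y < 1" for y
  proof -
    have hi: "((\<lambda>x. C / (1 - x)) has_integral (- C * ln (1 - y) - (- C * ln (1 - d)))) {d..y}"
    proof (rule fundamental_theorem_of_calculus[OF y(1)])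
      fix x assume "x \<in> {d..y}"
      then have "1 - x > 0" using y by simp
      then have "((\<lambda>x. - C * ln (1 - x)) has_real_derivative C / (1 - x)) (at x within {d..y})"
        by (auto intro!: derivative_eq_intros)
      then show "((\<lambda>x. - C * ln (1 - x)) has_vector_derivative C / (1 - x)) (at x within {d..y})"
        by (simp add: has_real_derivative_iff_has_vector_derivative)
    qed
    have sub: "F integrable_on {d..y}" by (rule integrable_on_subinterval[OF F]) (use d y in auto)
    have "- C * ln (1 - y) - (- C * ln (1 - d)) \<le> integral {d..y} F"
      by (rule has_integral_le[OF hi integrable_integral[OF sub]]) (use d y le in auto)
    also have "\<dots> \<le> I" unfolding I_def using d y F0 by (intro integral_subset_le sub F) auto
    finally show ?thesis by (simp add: algebra_simps)
  qed
  \<comment> \<open>Chosen so that ln(1-d) - ln(1-y) is at least I/C + 1. The partial integral then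
    exceeds the whole integral I by at least C.\<close>
  define T where "T = I / C - ln (1 - d) + 1"
  define y where "y = max d (1 - exp (- T))"
  have y: "d \<le> y" "y < 1" "1 - y \<le> exp (- T)" using d by (auto simp: y_def)
  then have "ln (1 - y) \<le> - T" by (metis exp_gt_zero diff_gt_0_iff_gt ln_exp ln_le_cancel_iff)
  then have "I / C + 1 \<le> ln (1 - d) - ln (1 - y)" by (simp add: T_def)
  then have "C * (I / C + 1) \<le> C * (ln (1 - d) - ln (1 - y))" using C by (intro mult_left_mono) auto
  also have "\<dots> \<le> I" using y by (intro bd)
  finally show False using C by (simp add: distrib_left)
qed

context jacobi begin

lemma kf_pos: "x < 1 \<Longrightarrow> kf x > 0"
  by (simp add: kf_powr)

lemma kf_sq_pw: "x < 1 \<Longrightarrow> (kf x)\<^sup>2 * pw a b x = (1 - x) powr (\<bar>a\<bar> + 1) * (1 + x) powr (b + 1)"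
  by (simp add: kf_powr pw_def abs_a(1) power2_eq_square algebra_simps flip: powr_add)

lemma kf_sq_rw: "x < 1 \<Longrightarrow> (kf x)\<^sup>2 * rw a b x = (1 - x) powr \<bar>a\<bar> * (1 + x) powr b"
  by (simp add: kf_powr rw_def abs_a(1) power2_eq_square algebra_simps flip: powr_add)

definition wv :: "complex \<Rightarrow> real \<Rightarrow> complex" where
  "wv z x = psum (wco z) (of_real ((1 - x) / 2))"

lemma psi_wv: "psi z x = of_real (kf x) * wv z x"
  by (simp add: psi_def wv_def)

lemma wv_tendsto: "(wv z \<longlongrightarrow> 1) (at_left 1)"
  using psum_at_1_tendsto[OF disc_summable_wco[of z]] by (simp add: wv_def[abs_def])

text \<open>If the Wronskian stayed away from zero, then $f/\psi$ would grow like $(1-x)^{-|\alpha|}$,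
  which is not square integrable at $1$ because $|\alpha| \ge 1$ (limit point case).\<close>
lemma wrk_bound_at_1:
  assumes q: "qpair a b f g" and c: "-1 < c" "c < 1" and L: "L2w (rw a b) {c<..<1} f"
    and M: "\<And>x y. -1 < x \<Longrightarrow> x < 1 \<Longrightarrow> -1 < y \<Longrightarrow> y < 1 \<Longrightarrow> norm (wrk f g (psi z) (psig z) y - wrk f g (psi z) (psig z) x) \<le> M"
    and x0: "-1 < x0" "x0 < 1"
  shows "norm (wrk f g (psi z) (psig z) x0) \<le> M"
proof (rule ccontr)
  let ?W = "wrk f g (psi z) (psig z)"
  assume "\<not> norm (?W x0) \<le> M"
  define \<delta> where "\<delta> = norm (?W x0) - M"
  have \<delta>: "\<delta> > 0" using \<open>\<not> _\<close> by (simp add: \<delta>_def)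
  have M0: "M \<ge> 0" using M[OF x0 x0] by simp
  \<comment> \<open>A unit factor turning the value at x0 into a positive real. As the Wronskian
    moves by at most M, its rotated values stay in the half-plane of real part at least delta, which
    excludes cancellation.\<close>
  define \<omega> where "\<omega> = cnj (?W x0) / of_real (norm (?W x0))"
  have W0: "norm (?W x0) > 0" using \<delta> M0 unfolding \<delta>_def by linarith
  have \<omega>: "norm \<omega> = 1" using W0 by (simp add: \<omega>_def norm_divide)
  have \<omega>W0: "\<omega> * ?W x0 = of_real (norm (?W x0))"
  proof -
    have "cnj (?W x0) * ?W x0 = of_real (norm (?W x0)) * of_real (norm (?W x0))"
      by (simp add: mult.commute[of "cnj _"] complex_norm_square[symmetric] power2_eq_square flip: of_real_mult)
    then show ?thesis using W0 by (simp add: \<omega>_def)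
  qed
  define N where "N = norm (?W x0) + M"
  have Wb: "norm (?W y) \<le> N" "Re (\<omega> * ?W y) \<ge> \<delta>" if "-1 < y" "y < 1" for y
  proof -
    have d: "norm (?W y - ?W x0) \<le> M" by (intro M x0 that)
    then show "norm (?W y) \<le> N" unfolding N_def using norm_triangle_ineq[of "?W x0" "?W y - ?W x0"] by simp
    have "Re (\<omega> * ?W y) = norm (?W x0) + Re (\<omega> * (?W y - ?W x0))"
      unfolding right_diff_distrib \<omega>W0 by simp
    moreover have "\<bar>Re (\<omega> * (?W y - ?W x0))\<bar> \<le> norm (\<omega> * (?W y - ?W x0))" by (rule abs_Re_le_cmod)
    moreover have "norm (\<omega> * (?W y - ?W x0)) \<le> M" using d by (simp add: norm_mult \<omega>)
    ultimately show "Re (\<omega> * ?W y) \<ge> \<delta>" unfolding \<delta>_def by linarith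
  qed
  have N0: "N > 0" using W0 M0 unfolding N_def by linarith
  have "((\<lambda>x. inverse (wv z x ^ 2)) \<longlongrightarrow> inverse (1 ^ 2)) (at_left 1)" by (intro tendsto_intros wv_tendsto) auto
  then have "\<forall>\<^sub>F x in at_left 1. dist (inverse (wv z x ^ 2)) 1 < \<delta> / 2 / N"
    using \<delta> N0 by (intro tendstoD) auto
  moreover have "\<forall>\<^sub>F x in at_left 1. dist (wv z x) 1 < 1 / 2" by (intro tendstoD wv_tendsto) auto
  ultimately have "\<forall>\<^sub>F x in at_left 1. dist (inverse (wv z x ^ 2)) 1 < \<delta> / 2 / N \<and> dist (wv z x) 1 < 1 / 2"
    by (rule eventually_conj)
  then obtain x1 where x1: "x1 < 1" "\<And>x. x1 < x \<Longrightarrow> x < 1 \<Longrightarrow> dist (inverse (wv z x ^ 2)) 1 < \<delta> / 2 / N \<and> dist (wv z x) 1 < 1 / 2"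
    unfolding eventually_at_left_field by blast
  define x2 where "x2 = (max (max x1 0) c + 1) / 2"
  have x2: "x1 < x2" "0 < x2" "c < x2" "x2 < 1" using x1 c by (auto simp: x2_def)
  have wv: "norm (wv z x) \<ge> 1 / 2" "Re (\<omega> * ?W x * inverse (wv z x ^ 2)) \<ge> \<delta> / 2" if "x2 \<le> x" "x < 1" for x
  proof -
    have *: "norm (inverse (wv z x ^ 2) - 1) < \<delta> / 2 / N" "norm (wv z x - 1) < 1 / 2"
      using x1(2)[of x] that x2 by (auto simp: dist_norm)
    show "norm (wv z x) \<ge> 1 / 2" using *(2) norm_triangle_ineq2[of 1 "wv z x"] by (simp add: norm_minus_commute)
    have "norm (\<omega> * ?W x * (inverse (wv z x ^ 2) - 1)) \<le> N * (\<delta> / 2 / N)"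
      unfolding norm_mult \<omega> using Wb(1)[of x] that x2 *(1) N0 by (simp only: mult_1) (intro mult_mono, auto)
    then have "\<bar>Re (\<omega> * ?W x * (inverse (wv z x ^ 2) - 1))\<bar> \<le> \<delta> / 2"
      using abs_Re_le_cmod[of "\<omega> * ?W x * (inverse (wv z x ^ 2) - 1)"] N0 by simp
    moreover have "Re (\<omega> * ?W x * inverse (wv z x ^ 2)) = Re (\<omega> * ?W x) + Re (\<omega> * ?W x * (inverse (wv z x ^ 2) - 1))"
      by (simp add: right_diff_distrib)
    moreover have "Re (\<omega> * ?W x) \<ge> \<delta>" using Wb(2)[of x] that x2 by simp
    ultimately show "Re (\<omega> * ?W x * inverse (wv z x ^ 2)) \<ge> \<delta> / 2" by linarith
  qed
  define \<eta> where "\<eta> = \<delta> / 2 / 2 powr (b + 1)"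
  have \<eta>: "\<eta> > 0" using \<delta> by (simp add: \<eta>_def)
  \<comment> \<open>The derivative of f/psi is minus the Wronskian over p psi^2. The rotation and
    the sign give Q a derivative bounded below by a positive multiple of (1-x)^(-|a|-1).\<close>
  define Q where "Q x = Re (- \<omega> * (f x * inverse (psi z x)))" for x
  define Q' where "Q' x = Re (\<omega> * ?W x * inverse (wv z x ^ 2)) / ((kf x)\<^sup>2 * pw a b x)" for x
  have psi0: "psi z x \<noteq> 0" if "x2 \<le> x" "x < 1" for x
    using wv(1)[OF that] kf_pos[of x] that by (auto simp: psi_wv)
  have Qd: "(Q has_real_derivative Q' x) (at x)" if x: "x2 \<le> x" "x < 1" for x
  proof -
    have xx: "-1 < x" "x < 1" using x x2 by auto
    have p: "complex_of_real (pw a b x) \<noteq> 0" using pw_pos[OF xx, of a b] by simp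
    have "(psi z has_vector_derivative psig z x / of_real (pw a b x)) (at x)" by (rule qpair_within[OF solg_qpair[OF solg_psi] xx])
    from field_vector_diff_chain_at[OF this DERIV_inverse[OF psi0[OF x]]]
    have "((\<lambda>x. inverse (psi z x)) has_vector_derivative psig z x / of_real (pw a b x) * - (inverse (psi z x) ^ Suc (Suc 0))) (at x)"
      by (simp add: o_def)
    from has_vector_derivative_mult[OF qpair_within[OF q xx] this]
    have "((\<lambda>x. f x * inverse (psi z x)) has_vector_derivative
       f x * (psig z x / of_real (pw a b x) * - (inverse (psi z x) ^ Suc (Suc 0))) + g x / of_real (pw a b x) * inverse (psi z x)) (at x)" .
    also have "f x * (psig z x / of_real (pw a b x) * - (inverse (psi z x) ^ Suc (Suc 0))) + g x / of_real (pw a b x) * inverse (psi z x)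
       = - ?W x * inverse (psi z x ^ 2) / of_real (pw a b x)"
      using psi0[OF x] p unfolding wrk_def by (simp add: field_simps power2_eq_square)
    also have "\<dots> = - (?W x * inverse (wv z x ^ 2) / of_real ((kf x)\<^sup>2 * pw a b x))"
      by (simp add: psi_wv power_mult_distrib divide_inverse mult_ac)
    finally have "(Q has_vector_derivative Re (- \<omega> * - (?W x * inverse (wv z x ^ 2) / of_real ((kf x)\<^sup>2 * pw a b x)))) (at x)"
      unfolding Q_def[abs_def] by (intro bounded_linear.has_vector_derivative[OF bounded_linear_Re] has_vector_derivative_mult_right)
    moreover have "Re (- \<omega> * - (?W x * inverse (wv z x ^ 2) / of_real ((kf x)\<^sup>2 * pw a b x))) = Q' x"
    proof -
      have "- \<omega> * - (?W x * inverse (wv z x ^ 2) / of_real ((kf x)\<^sup>2 * pw a b x)) = \<omega> * ?W x * inverse (wv z x ^ 2) / of_real ((kf x)\<^sup>2 * pw a b x)"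
        by (simp del: of_real_mult of_real_power)
      then show ?thesis unfolding Q'_def by (simp only: Re_divide_of_real)
    qed
    ultimately show ?thesis by (simp add: has_real_derivative_iff_has_vector_derivative)
  qed
  have a0: "\<bar>a\<bar> \<ge> 1" by (rule abs_a(2))
  define \<phi> where "\<phi> x = \<eta> / \<bar>a\<bar> * (1 - x) powr (- \<bar>a\<bar>)" for x
  have Qphi: "Q x2 - \<phi> x2 \<le> Q y - \<phi> y" if y: "x2 \<le> y" "y < 1" for y
  proof (rule DERIV_nonneg_imp_nondecreasing[OF y(1)])
    fix x assume x: "x2 \<le> x" "x \<le> y"
    have "1 - x > 0" using x y by simp
    then have "(\<phi> has_real_derivative \<eta> * (1 - x) powr (- \<bar>a\<bar> - 1)) (at x)"
      unfolding \<phi>_def[abs_def] using a0 by (auto intro!: derivative_eq_intros simp: powr_diff divide_simps)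
    then have "((\<lambda>x. Q x - \<phi> x) has_real_derivative (Q' x - \<eta> * (1 - x) powr (- \<bar>a\<bar> - 1))) (at x)"
      using Qd[of x] x y by (intro DERIV_diff) auto
    moreover have "Q' x - \<eta> * (1 - x) powr (- \<bar>a\<bar> - 1) \<ge> 0"
    proof -
      have "(1 + x) powr (b + 1) \<le> 2 powr (b + 1)" using x x2 y b by (intro powr_mono2) auto
      then have "(kf x)\<^sup>2 * pw a b x \<le> (1 - x) powr (\<bar>a\<bar> + 1) * 2 powr (b + 1)"
        using x y by (subst kf_sq_pw) (auto intro!: mult_left_mono)
      moreover have "(kf x)\<^sup>2 * pw a b x > 0" using kf_pos[of x] pw_pos[of x a b] x x2 y by simp
      ultimately have "\<delta> / 2 / ((1 - x) powr (\<bar>a\<bar> + 1) * 2 powr (b + 1)) \<le> Q' x"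
      proof -
        assume p: "(kf x)\<^sup>2 * pw a b x \<le> (1 - x) powr (\<bar>a\<bar> + 1) * 2 powr (b + 1)" "(kf x)\<^sup>2 * pw a b x > 0"
        have r: "\<delta> / 2 \<le> Re (\<omega> * ?W x * inverse (wv z x ^ 2))" using x y by (intro wv(2)) auto
        have r0: "0 \<le> Re (\<omega> * ?W x * inverse (wv z x ^ 2))" using r \<delta> by linarith
        show ?thesis unfolding Q'_def by (rule frac_le[OF r0 r p(2,1)])
      qed
      moreover have "\<delta> / 2 / ((1 - x) powr (\<bar>a\<bar> + 1) * 2 powr (b + 1)) = \<eta> * (1 - x) powr (- \<bar>a\<bar> - 1)"
        using \<open>1 - x > 0\<close> by (simp add: \<eta>_def powr_minus_divide[of _ "\<bar>a\<bar> + 1", simplified] mult.commute)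
      ultimately show ?thesis by simp
    qed
    ultimately show "\<exists>d. ((\<lambda>x. Q x - \<phi> x) has_real_derivative d) (at x) \<and> 0 \<le> d" by blast
  qed
  define K where "K = \<bar>Q x2 - \<phi> x2\<bar> + 1"
  \<comment> \<open>To the right of this point the constant K is at most half of phi, so the lower
    bound phi - K for Q is at least half of phi.\<close>
  define x3 where "x3 = max x2 (1 - \<eta> / (2 * \<bar>a\<bar> * K))"
  have K: "K > 0" by (simp add: K_def add_nonneg_pos)
  have x3: "x2 \<le> x3" "x3 < 1" using x2 K \<eta> a0 by (auto simp: x3_def)
  define C where "C = (\<eta> / (2 * \<bar>a\<bar>))\<^sup>2 / 8"
  have C: "C > 0" using \<eta> a0 by (simp add: C_def)
  have low: "C / (1 - y) \<le> (cmod (f y))\<^sup>2 * rw a b y" if y: "x3 < y" "y < 1" for y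
  proof -
    have yy: "x2 \<le> y" "y < 1" "0 < y" using y x3 x2 by auto
    have pos: "1 - y > 0" "1 - y \<le> 1" using yy by auto
    define P where "P = (1 - y) powr (- \<bar>a\<bar>)"
    have P1: "1 / (1 - y) \<le> P"
    proof -
      have "(1 - y) powr (- 1) \<le> P" unfolding P_def using pos a0 by (intro powr_mono') auto
      then show ?thesis using pos by (simp add: powr_minus_divide)
    qed
    have "K \<le> \<eta> / (2 * \<bar>a\<bar>) * P"
    proof -
      have "1 - y \<le> \<eta> / (2 * \<bar>a\<bar> * K)" using y by (simp add: x3_def)
      then have "(1 - y) * K \<le> \<eta> / (2 * \<bar>a\<bar> * K) * K" using K by (intro mult_right_mono) auto
      also have "\<dots> = \<eta> / (2 * \<bar>a\<bar>)" using K by simp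
      finally have "K * (1 - y) \<le> \<eta> / (2 * \<bar>a\<bar>)" by (simp only: mult.commute)
      then have "K \<le> \<eta> / (2 * \<bar>a\<bar>) / (1 - y)" unfolding pos_le_divide_eq[OF pos(1)] .
      then have "K \<le> \<eta> / (2 * \<bar>a\<bar>) * (1 / (1 - y))" by simp
      also have "\<dots> \<le> \<eta> / (2 * \<bar>a\<bar>) * P" using P1 \<eta> a0 by (intro mult_left_mono) auto
      finally show ?thesis .
    qed
    moreover have "\<phi> y = 2 * (\<eta> / (2 * \<bar>a\<bar>) * P)" using a0 by (simp add: \<phi>_def P_def)
    moreover have "- K \<le> Q x2 - \<phi> x2" by (simp add: K_def)
    ultimately have Qy: "\<eta> / (2 * \<bar>a\<bar>) * P \<le> Q y" using Qphi[OF yy(1,2)] by linarith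
    have Qf: "Q y \<le> norm (f y) / norm (psi z y)"
      using complex_Re_le_cmod[of "- \<omega> * (f y * inverse (psi z y))"] unfolding Q_def
      by (simp add: norm_mult \<omega> norm_inverse divide_inverse)
    have np: "norm (psi z y) > 0" using psi0[OF yy(1,2)] by simp
    have "\<eta> / (2 * \<bar>a\<bar>) * P \<le> norm (f y) / norm (psi z y)" using Qy Qf by linarith
    then have "\<eta> / (2 * \<bar>a\<bar>) * P * norm (psi z y) \<le> norm (f y)" unfolding pos_le_divide_eq[OF np] .
    moreover have "kf y * (1 / 2) \<le> norm (psi z y)"
      unfolding psi_wv norm_mult using wv(1)[OF yy(1,2)] kf_pos[of y] yy by (intro mult_mono) auto
    moreover have Pp: "0 \<le> \<eta> / (2 * \<bar>a\<bar>) * P" using \<eta> by (simp add: P_def)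
    ultimately have "\<eta> / (2 * \<bar>a\<bar>) * P * (kf y * (1 / 2)) \<le> norm (f y)"
      by (meson mult_left_mono order_trans)
    then have "(\<eta> / (2 * \<bar>a\<bar>) * P * (kf y * (1 / 2)))\<^sup>2 \<le> (norm (f y))\<^sup>2"
      by (intro power_mono mult_nonneg_nonneg[OF Pp]) (use kf_pos[of y] yy in auto)
    then have "(\<eta> / (2 * \<bar>a\<bar>) * P * (kf y * (1 / 2)))\<^sup>2 * rw a b y \<le> (norm (f y))\<^sup>2 * rw a b y"
      by (intro mult_right_mono rw_nonneg)
    also have "(\<eta> / (2 * \<bar>a\<bar>) * P * (kf y * (1 / 2)))\<^sup>2 * rw a b y = (\<eta> / (2 * \<bar>a\<bar>))\<^sup>2 / 4 * P * (P * ((kf y)\<^sup>2 * rw a b y))"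
      by (simp add: power_mult_distrib power2_eq_square mult_ac)
    also have "P * ((kf y)\<^sup>2 * rw a b y) = (1 + y) powr b"
      unfolding kf_sq_rw[OF yy(2)] P_def using pos by (simp add: mult.assoc[symmetric] flip: powr_add)
    finally have "(\<eta> / (2 * \<bar>a\<bar>))\<^sup>2 / 4 * P * (1 + y) powr b \<le> (norm (f y))\<^sup>2 * rw a b y" .
    moreover have "1 / 2 \<le> (1 + y) powr b"
    proof -
      have "1 / 2 \<le> 1 / (1 + y)" using yy by (simp add: field_simps)
      also have "\<dots> = (1 + y) powr (- 1)" using yy by (simp add: powr_minus_divide)
      also have "\<dots> \<le> (1 + y) powr b" using yy b by (intro powr_mono) auto
      finally show ?thesis .
    qed
    moreover have "0 \<le> (\<eta> / (2 * \<bar>a\<bar>))\<^sup>2 / 4 * P" by (simp add: P_def)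
    ultimately have "(\<eta> / (2 * \<bar>a\<bar>))\<^sup>2 / 4 * P * (1 / 2) \<le> (norm (f y))\<^sup>2 * rw a b y"
      by (meson mult_left_mono order_trans)
    moreover have "C * (1 / (1 - y)) \<le> C * P" using C P1 by (intro mult_left_mono) auto
    moreover have "C * P = (\<eta> / (2 * \<bar>a\<bar>))\<^sup>2 / 4 * P * (1 / 2)" "C / (1 - y) = C * (1 / (1 - y))"
      by (simp_all add: C_def)
    ultimately show ?thesis by linarith
  qed
  have "L2w (rw a b) {x3<..<1} f" using c x3 x2 by (intro L2w_subset[OF L]) (auto simp: rw_nonneg)
  then have "(\<lambda>x. (cmod (f x))\<^sup>2 * rw a b x) integrable_on {x3<..<1}" by (simp add: L2w_def)
  from not_integrable_inverse_at_1[OF x3(2) this C low] show False .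
qed

lemma L2w_psi_at_1: "\<exists>c. -1 < c \<and> c < 1 \<and> L2w (rw a b) {c<..<1} (psi z)"
proof -
  have "\<forall>\<^sub>F x in at_left 1. dist (wv z x) 1 < 1" by (intro tendstoD wv_tendsto) auto
  then obtain x1 where x1: "x1 < 1" "\<And>x. x1 < x \<Longrightarrow> x < 1 \<Longrightarrow> dist (wv z x) 1 < 1"
    unfolding eventually_at_left_field by blast
  define c where "c = max x1 0"
  have c: "-1 < c" "c < 1" using x1 by (auto simp: c_def)
  let ?S = "{c<..<1}"
  have pc: "continuous_on ?S (psi z)"
  proof (rule continuous_on_vector_derivative)
    fix x assume "x \<in> ?S"
    then show "(psi z has_vector_derivative psig z x / of_real (pw a b x)) (at x within ?S)"
      using c by (intro qpair_within[OF solg_qpair[OF solg_psi]]) auto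
  qed
  have S: "?S \<in> sets lebesgue" by simp
  have pm: "psi z \<in> borel_measurable (lebesgue_on ?S)" by (rule continuous_imp_measurable_on_sets_lebesgue[OF pc S])
  have "?S \<subseteq> {-1<..<1}" using c by auto
  note rm = borel_measurable_rw[OF S this, of a b]
  have m: "(\<lambda>x. (cmod (psi z x))\<^sup>2 * rw a b x) \<in> borel_measurable (lebesgue_on ?S)"
    using pm rm by measurable
  \<comment> \<open>On (0,1) near 1 the factors are bounded by 4 for the square of
    \<open>wv\<close>, 1 for (1-x)^|a| and 2 for (1+x)^b.\<close>
  have i: "(\<lambda>x. 8 :: real) integrable_on ?S" using integrable_on_open_interval[of "\<lambda>x. 8 :: real" c 1] integrable_const_ivl[of "8 :: real" c 1] by simp
  have "(\<lambda>x. (cmod (psi z x))\<^sup>2 * rw a b x) absolutely_integrable_on ?S"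
  proof (rule measurable_bounded_by_integrable_imp_absolutely_integrable[OF m S i])
    fix x assume x: "x \<in> ?S"
    then have xx: "0 < x" "x < 1" by (auto simp: c_def)
    have "norm (wv z x) \<le> 2" using x1(2)[of x] x norm_triangle_ineq2[of "wv z x" 1] by (auto simp: dist_norm c_def)
    then have "(norm (wv z x))\<^sup>2 \<le> 2\<^sup>2" by (intro power_mono) auto
    moreover have "(1 - x) powr \<bar>a\<bar> \<le> 1" using xx by (intro powr_le1) auto
    moreover have "(1 + x) powr b \<le> 2"
    proof -
      have "(1 + x) powr b \<le> (1 + x) powr 1" using xx b by (intro powr_mono) auto
      then show ?thesis using xx by simp
    qed
    ultimately have "(norm (wv z x))\<^sup>2 * ((1 - x) powr \<bar>a\<bar> * (1 + x) powr b) \<le> 4 * (1 * 2)"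
      by (intro mult_mono) auto
    moreover have "(cmod (psi z x))\<^sup>2 * rw a b x = (norm (wv z x))\<^sup>2 * ((kf x)\<^sup>2 * rw a b x)"
      by (simp add: psi_wv norm_mult power_mult_distrib mult_ac)
    ultimately show "norm ((cmod (psi z x))\<^sup>2 * rw a b x) \<le> 8"
      using kf_sq_rw[OF xx(2)] rw_nonneg[of a b x] by simp
  qed
  then have "L2w (rw a b) ?S (psi z)" unfolding L2w_iff[OF S] using pm by (simp add: absolutely_integrable_on_def)
  with c show ?thesis by blast
qed

text \<open>The boundary term of the energy identity at 1. The square of \<open>kf\<close> times
  \<open>pw\<close> has the factor (1-x)^(|a|+1); one power cancels the pole in \<open>dpsi\<close>,
  and the remaining exponent |a| is positive.\<close>

lemma psi_psig_tendsto_0: "((\<lambda>x. cnj (psi z x) * psig z x) \<longlongrightarrow> 0) (at_left 1)"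
proof -
  let ?v1 = "\<lambda>x. psum (diffs (wco z)) (of_real ((1 - x) / 2))"
  have v1: "(?v1 \<longlongrightarrow> diffs (wco z) 0) (at_left 1)"
    by (intro psum_at_1_tendsto disc_summable_diffs disc_summable_wco)
  have p: "((\<lambda>x. (1 - x) powr \<bar>a\<bar> * (1 + x) powr (b + 1)) \<longlongrightarrow> (1 - 1) powr \<bar>a\<bar> * (1 + 1) powr (b + 1)) (at_left 1)"
    using abs_a(2) by (intro tendsto_mult tendsto_powr2 tendsto_powr tendsto_intros) (auto simp: eventually_at_filter)
  have "((\<lambda>x. of_real ((1 - x) powr \<bar>a\<bar> * (1 + x) powr (b + 1)) * (cnj (wv z x) * (of_real (1 - x) * (- ?v1 x / 2) - of_real \<kappa> * wv z x))) \<longlongrightarrow>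
     of_real ((1 - 1) powr \<bar>a\<bar> * (1 + 1) powr (b + 1)) * (cnj 1 * (of_real (1 - 1) * (- diffs (wco z) 0 / 2) - of_real \<kappa> * 1))) (at_left 1)"
    by (intro tendsto_mult tendsto_of_real[OF p] tendsto_cnj wv_tendsto tendsto_diff tendsto_divide tendsto_minus v1 tendsto_of_real[OF tendsto_diff] tendsto_const tendsto_ident_at) auto
  then have l: "((\<lambda>x. of_real ((1 - x) powr \<bar>a\<bar> * (1 + x) powr (b + 1)) * (cnj (wv z x) * (of_real (1 - x) * (- ?v1 x / 2) - of_real \<kappa> * wv z x))) \<longlongrightarrow> 0) (at_left 1)"
    by simp
  show ?thesis
  proof (rule Lim_transform_eventually[OF l])
    show "\<forall>\<^sub>F x in at_left 1. of_real ((1 - x) powr \<bar>a\<bar> * (1 + x) powr (b + 1)) * (cnj (wv z x) * (of_real (1 - x) * (- ?v1 x / 2) - of_real \<kappa> * wv z x)) = cnj (psi z x) * psig z x"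
      using eventually_at_left_1
    proof eventually_elim
      case (elim x)
      have e: "(kf x)\<^sup>2 * pw a b x = (1 - x) powr \<bar>a\<bar> * (1 + x) powr (b + 1) * (1 - x)"
        using elim by (subst kf_sq_pw) (auto simp: powr_add)
      have "(1 - x) * (- \<kappa> / (1 - x)) = - \<kappa>" using elim by simp
      then have k: "of_real (1 - x) * complex_of_real (- \<kappa> / (1 - x)) = - of_real \<kappa>" by (simp only: flip: of_real_mult) simp
      have "cnj (psi z x) * psig z x = of_real ((kf x)\<^sup>2 * pw a b x) * (cnj (wv z x) * (- ?v1 x / 2 + of_real (- \<kappa> / (1 - x)) * wv z x))"
        by (simp add: psi_wv psig_def dpsi_def wv_def power2_eq_square)
      also have "\<dots> = of_real ((1 - x) powr \<bar>a\<bar> * (1 + x) powr (b + 1)) * (cnj (wv z x) * (of_real (1 - x) * (- ?v1 x / 2) + (of_real (1 - x) * of_real (- \<kappa> / (1 - x))) * wv z x))"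
        unfolding e of_real_mult by (simp only: distrib_left mult_ac)
      finally show ?case unfolding k by simp
    qed
  qed
qed

end

text \<open>For $\beta \ge 0$ the boundary values alone do not control the quasi-derivative $g$; the extra clauses
  are what makes the Wronskian converge at $-1$.\<close>
definition regular_at_m1 :: "real \<Rightarrow> real \<Rightarrow> (real \<Rightarrow> complex) \<Rightarrow> (real \<Rightarrow> complex) \<Rightarrow> complex \<Rightarrow> complex \<Rightarrow> bool" where
  "regular_at_m1 a b f g v0 v1 \<longleftrightarrow> bv a b f g v0 v1 \<and> (b \<ge> 0 \<longrightarrow> (g \<longlongrightarrow> - v0) (at_right (-1)) \<and>
     ((\<lambda>x. of_real (ell a b x) * (g x + v0)) \<longlongrightarrow> 0) (at_right (-1)))"

section \<open>Limits of quasi-derivatives and Wronskians at -1\<close>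

text \<open>For b >= 0 the products f h and u g may each diverge. Both have the leading term -v0 w0
  times \<open>ell\<close>, which cancels in the difference.\<close>

lemma wrk_tendsto_m1:
  assumes f: "regular_at_m1 a b f g v0 v1" and u: "regular_at_m1 a b u h w0 w1"
  shows "(wrk f g u h \<longlongrightarrow> v0 * w1 - v1 * w0) (at_right (-1))"
proof (cases "b < 0")
  case True
  then have "(f \<longlongrightarrow> v0) (at_right (-1))" "(g \<longlongrightarrow> v1) (at_right (-1))" "(u \<longlongrightarrow> w0) (at_right (-1))" "(h \<longlongrightarrow> w1) (at_right (-1))"
    using f u by (auto simp: regular_at_m1_def bv_def)
  then have "((\<lambda>x. f x * h x - u x * g x) \<longlongrightarrow> v0 * w1 - w0 * v1) (at_right (-1))" by (intro tendsto_intros)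
  then show ?thesis by (simp add: wrk_def[abs_def] mult.commute)
next
  case False
  let ?l = "\<lambda>x. complex_of_real (ell a b x)"
  have l: "((\<lambda>x. f x - v0 * ?l x) \<longlongrightarrow> v1) (at_right (-1))" "((\<lambda>x. u x - w0 * ?l x) \<longlongrightarrow> w1) (at_right (-1))"
    "(g \<longlongrightarrow> - v0) (at_right (-1))" "(h \<longlongrightarrow> - w0) (at_right (-1))"
    "((\<lambda>x. ?l x * (g x + v0)) \<longlongrightarrow> 0) (at_right (-1))" "((\<lambda>x. ?l x * (h x + w0)) \<longlongrightarrow> 0) (at_right (-1))"
    using f u False by (auto simp: regular_at_m1_def bv_def)
  have "((\<lambda>x. (f x - v0 * ?l x) * h x - (u x - w0 * ?l x) * g x + (v0 * (?l x * (h x + w0)) - w0 * (?l x * (g x + v0)))) \<longlongrightarrow>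
     v1 * (- w0) - w1 * (- v0) + (v0 * 0 - w0 * 0)) (at_right (-1))"
    by (intro tendsto_intros l)
  moreover have "(f x - v0 * ?l x) * h x - (u x - w0 * ?l x) * g x + (v0 * (?l x * (h x + w0)) - w0 * (?l x * (g x + v0))) = wrk f g u h x" for x
    by (simp add: wrk_def algebra_simps)
  ultimately show ?thesis by (simp add: mult.commute)
qed

text \<open>The base lies between 1 and 2, so the sum of the two endpoint values bounds the power
  for either sign of the exponent.\<close>

lemma powr_le_near_m1:
  fixes x s :: real
  assumes "-1 < x" "x \<le> 0"
  shows "(1 - x) powr s \<le> 1 + 2 powr s"
proof (cases "s \<ge> 0")
  case True
  then have "(1 - x) powr s \<le> 2 powr s" using assms by (intro powr_mono2) auto
  then show ?thesis by simp
next
  case False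
  have "(1 - x) powr s \<le> (1 - x) powr 0" using assms False by (intro powr_mono) auto
  then have "(1 - x) powr s \<le> 1" using assms by simp
  then show ?thesis using powr_ge_zero[of 2 s] by linarith
qed

lemma has_integral_1_plus_powr:
  fixes s x y :: real
  assumes "s > 0" "-1 \<le> x" "x \<le> y"
  shows "((\<lambda>t. (1 + t) powr (s - 1)) has_integral ((1 + y) powr s / s - (1 + x) powr s / s)) {x..y}"
proof (rule fundamental_theorem_of_calculus_interior[where f = "\<lambda>t. (1 + t) powr s / s"])
  show "continuous_on {x..y} (\<lambda>t. (1 + t) powr s / s)"
    using assms by (intro continuous_intros continuous_on_powr') auto
  fix t assume t: "t \<in> {x<..<y}"
  then have "1 + t > 0" using assms by simp
  then have "((\<lambda>t. (1 + t) powr s / s) has_real_derivative (1 + t) powr (s - 1)) (at t)"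
    using assms by (auto intro!: derivative_eq_intros simp: powr_diff)
  then show "((\<lambda>t. (1 + t) powr s / s) has_vector_derivative (1 + t) powr (s - 1)) (at t)"
    by (simp add: has_real_derivative_iff_has_vector_derivative)
qed (use assms in auto)

text \<open>Cauchy-Schwarz for the weighted integral of k against 1. Near -1 the weight has integral
  O((1+y)^(b+1)), and its square root gives the exponent (b+1)/2.\<close>

lemma tpair_increment_bound:
  assumes t: "tpair a b f g k" and L: "L2w (rw a b) {-1<..0} k" and b: "-1 < b"
  obtains K where "K \<ge> 0" "\<And>x y. -1 < x \<Longrightarrow> x \<le> y \<Longrightarrow> y \<le> 0 \<Longrightarrow> norm (g y - g x) \<le> K * (1 + y) powr ((b + 1) / 2)"
proof -
  define Ca where "Ca = 1 + 2 powr a"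
  have Ca: "Ca > 0" by (simp add: Ca_def add_pos_nonneg)
  define K where "K = sqrt (Ca / (b + 1)) * l2norm (rw a b) {-1<..0} k"
  have ki: "(\<lambda>x. (cmod (k x))\<^sup>2 * rw a b x) integrable_on {-1<..0}" using L by (simp add: L2w_def)
  have nk: "l2norm (rw a b) {-1<..0} k \<ge> 0" unfolding l2norm_def using ki by (auto intro!: integral_nonneg simp: rw_nonneg)
  show ?thesis
  proof (rule that[of K])
    show "K \<ge> 0" unfolding K_def using Ca b nk by simp
    fix x y :: real assume xy: "-1 < x" "x \<le> y" "y \<le> 0"
    let ?S = "{x..y}" and ?F = "\<lambda>t. complex_of_real (rw a b t) * k t"
    have sub: "?S \<subseteq> {-1<..<1}" and sub0: "?S \<subseteq> {-1<..0}" using xy by auto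
    have S: "?S \<in> sets lebesgue" by simp
    have rc: "continuous_on ?S (rw a b)" by (rule continuous_on_subset[OF continuous_on_pw_rw(2) sub])
    have Lk: "L2w (rw a b) ?S k" by (rule L2w_subset[OF L _ S sub0]) (auto simp: rw_nonneg)
    have L1: "L2w (rw a b) ?S (\<lambda>_. 1)"
      unfolding L2w_iff[OF S] using integrable_continuous_real[OF rc] by simp
    note CS = L2w_Cauchy_Schwarz[OF L1 Lk S borel_measurable_rw[OF S sub] rw_nonneg]
    have Fi: "?F integrable_on ?S" using absolutely_integrable_onD[OF CS(1)] by simp
    have "(\<lambda>t. norm (complex_of_real (rw a b t) * (1 * k t))) integrable_on ?S"
      using CS(1) by (simp add: absolutely_integrable_on_def)
    then have Ni: "(\<lambda>t. rw a b t * (cmod 1 * cmod (k t))) integrable_on ?S" by (simp add: norm_mult rw_nonneg)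
    have "-1 < x \<and> x \<le> y \<and> y < 1" using xy by simp
    then have "g y - g x = - integral ?S ?F" using t unfolding tpair_def by blast
    then have "norm (g y - g x) = norm (integral ?S ?F)" by simp
    also have "\<dots> \<le> integral ?S (\<lambda>t. rw a b t * (cmod 1 * cmod (k t)))"
      by (intro integral_norm_bound_integral Fi Ni) (simp add: norm_mult rw_nonneg)
    also have "\<dots> \<le> l2norm (rw a b) ?S (\<lambda>_. 1) * l2norm (rw a b) ?S k" by (rule CS(2))
    also have "\<dots> \<le> (sqrt (Ca / (b + 1)) * (1 + y) powr ((b + 1) / 2)) * l2norm (rw a b) {-1<..0} k"
    proof (rule mult_mono)
      have hi: "((\<lambda>t. Ca * (1 + t) powr (b + 1 - 1)) has_integral Ca * ((1 + y) powr (b + 1) / (b + 1) - (1 + x) powr (b + 1) / (b + 1))) ?S"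
        using b xy by (intro has_integral_mult_right has_integral_1_plus_powr) auto
      have "integral ?S (rw a b) \<le> Ca * ((1 + y) powr (b + 1) / (b + 1) - (1 + x) powr (b + 1) / (b + 1))"
      proof (rule has_integral_le[OF integrable_integral[OF integrable_continuous_real[OF rc]] hi])
        fix s assume s: "s \<in> ?S"
        have "(1 - s) powr a \<le> Ca" unfolding Ca_def using s xy by (intro powr_le_near_m1) auto
        then show "rw a b s \<le> Ca * (1 + s) powr (b + 1 - 1)" unfolding rw_def by (simp add: mult_right_mono)
      qed
      also have "\<dots> \<le> Ca * ((1 + y) powr (b + 1) / (b + 1))" using Ca b by (intro mult_left_mono) auto
      finally have "integral ?S (rw a b) \<le> Ca / (b + 1) * (1 + y) powr (b + 1)" by simp
      then have "l2norm (rw a b) ?S (\<lambda>_. 1) \<le> sqrt (Ca / (b + 1) * (1 + y) powr (b + 1))"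
        by (simp add: l2norm_def)
      also have "\<dots> = sqrt (Ca / (b + 1)) * sqrt ((1 + y) powr (b + 1))" by (rule real_sqrt_mult)
      also have "sqrt ((1 + y) powr (b + 1)) = (1 + y) powr ((b + 1) / 2)"
        by (simp add: powr_half_sqrt[symmetric] powr_powr)
      finally show "l2norm (rw a b) ?S (\<lambda>_. 1) \<le> sqrt (Ca / (b + 1)) * (1 + y) powr ((b + 1) / 2)" .
      have kS: "(\<lambda>x. (cmod (k x))\<^sup>2 * rw a b x) integrable_on ?S" using Lk by (simp add: L2w_def)
      then show "l2norm (rw a b) ?S k \<le> l2norm (rw a b) {-1<..0} k" 
        unfolding l2norm_def by (intro real_sqrt_le_mono integral_subset_le sub0 kS ki) (auto simp: rw_nonneg)
      show "0 \<le> sqrt (Ca / (b + 1)) * (1 + y) powr ((b + 1) / 2)" using Ca b by simp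
      show "0 \<le> l2norm (rw a b) ?S k" using kS unfolding l2norm_def
        by (auto intro!: integral_nonneg simp: rw_nonneg)
    qed
    finally show "norm (g y - g x) \<le> K * (1 + y) powr ((b + 1) / 2)" by (simp add: K_def mult_ac)
  qed
qed

text \<open>Hence the quasi-derivative of \<open>ell\<close> tends to -1 at -1. This is the origin
  of the limit -v0 demanded in \<open>regular_at_m1\<close>.\<close>

lemma has_real_derivative_ell:
  assumes "-1 < x" "x < 1"
  shows "(ell a b has_real_derivative - (((1 - x) / 2) powr (a + 1) / pw a b x)) (at x)"
proof -
  have e: "((1 - x) / 2) powr (a + 1) / pw a b x = 2 powr (- a - 1) * (1 + x) powr (- b - 1)"
  proof -
    have m: "- a - 1 = - (a + 1)" "- b - 1 = - (b + 1)" by simp_all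
    show ?thesis unfolding m powr_minus pw_def using assms by (simp add: powr_divide divide_simps)
  qed
  show ?thesis
  proof (cases "b = 0")
    case True
    have "((\<lambda>x. - (2 powr (- a - 1) * ln ((1 + x) / 2))) has_real_derivative - (2 powr (- a - 1) * (1 / (1 + x)))) (at x)"
      using assms by (auto intro!: derivative_eq_intros simp: field_simps)
    moreover have "(1 + x) powr (- b - 1) = 1 / (1 + x)" using assms True by (simp add: powr_minus_divide)
    ultimately show ?thesis unfolding e ell_def[abs_def] using True by simp
  next
    case False
    have p: "((\<lambda>y. y powr (- b)) has_real_derivative - b * (1 + x) powr (- b - 1)) (at (1 + x))"
      by (rule has_real_derivative_powr) (use assms in simp)
    have "((\<lambda>x. 2 powr (- a - 1) / b * (1 + x) powr (- b)) has_real_derivative - (2 powr (- a - 1) * (1 + x) powr (- b - 1))) (at x)"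
      by (rule DERIV_cong[OF DERIV_cmult[OF DERIV_chain2[OF p DERIV_add[OF DERIV_const DERIV_ident]]]]) (use False in simp)
    then show ?thesis unfolding e ell_def[abs_def] using False by simp
  qed
qed

text \<open>The increment bound makes g converge to some G, fast enough for \<open>ell\<close> times
  (g - G) to vanish in the limit. If G were not -v0, then f - v0 \<open>ell\<close> would have a
  derivative of order at least 1/(1+x) in a fixed direction and would diverge logarithmically,
  contrary to the second boundary value.\<close>

lemma regular_at_m1I:
  assumes t: "tpair a b f g k" and L: "L2w (rw a b) {-1<..0} k" and b: "-1 < b" "b < 1" and bv: "bv a b f g v0 v1"
  shows "regular_at_m1 a b f g v0 v1"
proof (cases "b < 0")
  case True
  with bv show ?thesis by (simp add: regular_at_m1_def)
next
  case False
  \<comment> \<open>The exponent of the increment bound. It exceeds b exactly because b < 1, so that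
    (1+x)^e outweighs \<open>ell\<close>.\<close>
  define e where "e = (b + 1) / 2"
  have e: "e > 0" "e > b" using b by (auto simp: e_def)
  have q: "qpair a b f g" using t by (simp add: tpair_def)
  obtain K where K: "K \<ge> 0" "\<And>x y. -1 < x \<Longrightarrow> x \<le> y \<Longrightarrow> y \<le> 0 \<Longrightarrow> norm (g y - g x) \<le> K * (1 + y) powr e"
    using tpair_increment_bound[OF t L b(1)] unfolding e_def by blast
  have K0: "((\<lambda>y. K * (1 + y) powr e) \<longlongrightarrow> 0) (at_right (-1))"
    using tendsto_mult_left[OF tendsto_1_plus_powr_0[OF e(1)], of K] by simp
  define s where "s n = inverse (real (Suc n)) - 1" for n
  have s: "-1 < s n" "s n \<le> 0" for n by (auto simp: s_def field_simps)
  have sm: "s n \<le> s m" if "m \<le> n" for m n using that by (simp add: s_def le_imp_inverse_le)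
  have "(\<lambda>n. inverse (real (Suc n)) - 1) \<longlonglongrightarrow> 0 - 1" by (intro tendsto_intros LIMSEQ_inverse_real_of_nat)
  then have sl: "filterlim s (at_right (-1)) sequentially"
    unfolding filterlim_at s_def[abs_def] using s by (auto simp: s_def intro!: always_eventually)
  have "Cauchy (\<lambda>n. g (s n))"
  proof (rule CauchyI')
    fix \<epsilon> :: real assume "\<epsilon> > 0"
    have "((\<lambda>n. K * (1 + s n) powr e) \<longlonglongrightarrow> 0)" using filterlim_compose[OF K0 sl] .
    from order_tendstoD(2)[OF this \<open>\<epsilon> > 0\<close>] obtain N where N: "\<And>n. n \<ge> N \<Longrightarrow> K * (1 + s n) powr e < \<epsilon>"
      by (auto simp: eventually_sequentially)
    show "\<exists>M. \<forall>m\<ge>M. \<forall>n>m. dist (g (s m)) (g (s n)) < \<epsilon>"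
    proof (intro exI allI impI)
      fix m n assume mn: "m \<ge> N" "n > m"
      have "norm (g (s m) - g (s n)) \<le> K * (1 + s m) powr e" using mn by (intro K(2) s sm) auto
      with N[OF mn(1)] show "dist (g (s m)) (g (s n)) < \<epsilon>" by (simp add: dist_norm)
    qed
  qed
  then obtain G where G: "(\<lambda>n. g (s n)) \<longlonglongrightarrow> G" using Cauchy_convergent_iff convergent_def by blast
  have gG: "norm (g y - G) \<le> K * (1 + y) powr e" if y: "-1 < y" "y \<le> 0" for y
  proof (rule tendsto_upperbound)
    show "(\<lambda>n. norm (g y - g (s n))) \<longlonglongrightarrow> norm (g y - G)" by (intro tendsto_intros G)
    have "\<forall>\<^sub>F x in at_right (-1). x < y" using y by (intro eventually_at_rightI[of _ y]) auto
    then have "\<forall>\<^sub>F n in sequentially. s n < y" using sl by (rule eventually_compose_filterlim)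
    then show "\<forall>\<^sub>F n in sequentially. norm (g y - g (s n)) \<le> K * (1 + y) powr e"
      by eventually_elim (use K(2) s y in \<open>simp add: less_imp_le\<close>)
  qed auto
  have ev0: "\<forall>\<^sub>F y in at_right (-1::real). -1 < y \<and> y \<le> 0" by (intro eventually_at_rightI[of _ 0]) auto
  have "((\<lambda>y. g y - G) \<longlongrightarrow> 0) (at_right (-1))"
    by (rule Lim_null_comparison[OF _ K0]) (use ev0 gG in \<open>auto elim: eventually_mono\<close>)
  then have gl: "(g \<longlongrightarrow> G) (at_right (-1))" by (simp add: LIM_zero_iff)
  have "((\<lambda>x. K * norm ((1 + x) powr e * ell a b x)) \<longlongrightarrow> K * norm (0::real)) (at_right (-1))"
    using e False by (intro tendsto_intros ell_powr_tendsto_0) auto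
  then have "((\<lambda>x. K * norm ((1 + x) powr e * ell a b x)) \<longlongrightarrow> 0) (at_right (-1))" by simp
  then have ellg: "((\<lambda>x. of_real (ell a b x) * (g x - G)) \<longlongrightarrow> 0) (at_right (-1))"
  proof (rule Lim_null_comparison[rotated])
    show "\<forall>\<^sub>F x in at_right (-1). norm (of_real (ell a b x) * (g x - G)) \<le> K * norm ((1 + x) powr e * ell a b x)"
      using ev0
    proof eventually_elim
      case (elim x)
      then have "\<bar>ell a b x\<bar> * norm (g x - G) \<le> \<bar>ell a b x\<bar> * (K * (1 + x) powr e)" by (intro mult_left_mono gG) auto
      then show ?case by (simp add: norm_mult abs_mult mult_ac)
    qed
  qed
  have "G = - v0"
  proof (rule ccontr)
    assume "G \<noteq> - v0"
    define D where "D = G + v0"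
    have D: "D \<noteq> 0" using \<open>G \<noteq> - v0\<close> by (simp add: D_def eq_neg_iff_add_eq_0)
    define m where "m x = ((1 - x) / 2) powr (a + 1)" for x :: real
    define y where "y x = f x - v0 * of_real (ell a b x)" for x
    \<comment> \<open>R/p is the derivative of y in the direction of D. Since g tends to G and m to
      1, R tends to the square of |D|, a positive number.\<close>
    define R where "R x = Re (cnj D * (g x + v0 * of_real (m x)))" for x
    have yl: "(y \<longlongrightarrow> v1) (at_right (-1))" using bv False by (simp add: bv_def y_def[abs_def])
    have "(m \<longlongrightarrow> ((1 - - 1) / 2) powr (a + 1)) (at_right (-1))" unfolding m_def[abs_def] by (intro tendsto_intros) auto
    then have ml: "(m \<longlongrightarrow> 1) (at_right (-1))" by simp
    have "(R \<longlongrightarrow> Re (cnj D * (G + v0 * of_real 1))) (at_right (-1))" unfolding R_def[abs_def] by (intro tendsto_intros gl ml)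
    moreover have "Re (cnj D * (G + v0 * of_real 1)) = (norm D)\<^sup>2"
      by (simp add: D_def[symmetric] complex_norm_square[symmetric] mult.commute[of "cnj D"] del: of_real_power complex_cnj_add) 
    ultimately have Rl: "(R \<longlongrightarrow> (norm D)\<^sup>2) (at_right (-1))" by simp
    have "(norm D)\<^sup>2 / 2 < (norm D)\<^sup>2" using D by simp
    from order_tendstoD(1)[OF Rl this] obtain x1 where x1: "x1 > -1" "\<And>x. -1 < x \<Longrightarrow> x < x1 \<Longrightarrow> (norm D)\<^sup>2 / 2 < R x"
      unfolding eventually_at_right_field by blast
    define x2 where "x2 = (min x1 0 - 1) / 2"
    have x2: "-1 < x2" "x2 < x1" "x2 < 0" using x1 by (auto simp: x2_def)
    define Cp where "Cp = 1 + 2 powr (a + 1)"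
    have Cp: "Cp > 0" by (simp add: Cp_def add_pos_nonneg)
    define c where "c = (norm D)\<^sup>2 / 2 / Cp"
    have c: "c > 0" using D Cp by (simp add: c_def)
    define Q where "Q x = Re (cnj D * y x)" for x
    have Qd: "(Q has_real_derivative R x / pw a b x) (at x)" if x: "-1 < x" "x < 1" for x
    proof -
      have "(y has_vector_derivative (g x / of_real (pw a b x) - v0 * of_real (- (m x / pw a b x)))) (at x)"
        unfolding y_def[abs_def] m_def
        by (intro has_vector_derivative_diff qpair_within[OF q x] has_vector_derivative_mult_right has_vector_derivative_of_real has_real_derivative_ell x)
      then have "(Q has_vector_derivative Re (cnj D * (g x / of_real (pw a b x) - v0 * of_real (- (m x / pw a b x))))) (at x)"
        unfolding Q_def[abs_def] by (intro bounded_linear.has_vector_derivative[OF bounded_linear_Re] has_vector_derivative_mult_right)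
      also have "cnj D * (g x / of_real (pw a b x) - v0 * of_real (- (m x / pw a b x))) = cnj D * (g x + v0 * of_real (m x)) / of_real (pw a b x)"
        by (simp add: add_divide_distrib distrib_left)
      finally show ?thesis by (simp only: R_def has_real_derivative_iff_has_vector_derivative Re_divide_of_real)
    qed
    have Qb: "Q x \<le> Q x2 - c * ln (1 + x2) + c * ln (1 + x)" if x: "-1 < x" "x \<le> x2" for x
    proof -
      have "Q x - c * ln (1 + x) \<le> Q x2 - c * ln (1 + x2)"
      proof (rule DERIV_nonneg_imp_nondecreasing[OF x(2)])
        fix s assume s: "x \<le> s" "s \<le> x2"
        then have s1: "-1 < s" "s < 0" "s < x1" using x x2 by auto
        have "((\<lambda>s. c * ln (1 + s)) has_real_derivative c / (1 + s)) (at s)" using s1 by (auto intro!: derivative_eq_intros)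
        then have "((\<lambda>s. Q s - c * ln (1 + s)) has_real_derivative (R s / pw a b s - c / (1 + s))) (at s)"
          using s1 by (intro DERIV_diff Qd) auto
        moreover have "R s / pw a b s - c / (1 + s) \<ge> 0"
        proof -
          have "(1 + s) powr (b + 1) \<le> (1 + s) powr 1" using s1 False by (intro powr_mono') auto
          moreover have "(1 - s) powr (a + 1) \<le> Cp" unfolding Cp_def using s1 by (intro powr_le_near_m1) auto
          ultimately have "pw a b s \<le> Cp * (1 + s)" unfolding pw_def using Cp s1 by (intro mult_mono) auto
          moreover have "pw a b s > 0" using s1 by (intro pw_pos) auto
          ultimately have "(norm D)\<^sup>2 / 2 / (Cp * (1 + s)) \<le> R s / pw a b s"
          proof -
            assume p: "pw a b s \<le> Cp * (1 + s)" "pw a b s > 0"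
            have r: "(norm D)\<^sup>2 / 2 \<le> R s" using x1(2)[of s] s1 by simp
            have "0 \<le> (norm D)\<^sup>2 / 2" by simp
            then have r0: "0 \<le> R s" using r by linarith
            show ?thesis by (rule frac_le[OF r0 r p(2,1)])
          qed
          then show ?thesis by (simp add: c_def)
        qed
        ultimately show "\<exists>d. ((\<lambda>s. Q s - c * ln (1 + s)) has_real_derivative d) (at s) \<and> 0 \<le> d" by blast
      qed
      then show ?thesis by simp
    qed
    have Ql: "(Q \<longlongrightarrow> Re (cnj D * v1)) (at_right (-1))" unfolding Q_def[abs_def] by (intro tendsto_intros yl)
    then have "\<forall>\<^sub>F x in at_right (-1). Q x > Re (cnj D * v1) - 1" by (intro order_tendstoD) auto
    moreover have "\<forall>\<^sub>F x in at_right (-1). ln (1 + x) < (Re (cnj D * v1) - 1 - Q x2 + c * ln (1 + x2)) / c"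
    proof -
      have "filterlim (\<lambda>x. ln (1 + x)) at_bot (at_right (-1::real))" by real_asymp
      then show ?thesis by (simp add: filterlim_at_bot_dense)
    qed
    moreover have "\<forall>\<^sub>F x in at_right (-1). -1 < x \<and> x \<le> x2" using x2 by (intro eventually_at_rightI[of _ x2]) auto
    ultimately have "\<forall>\<^sub>F x in at_right (-1::real). False"
    proof eventually_elim
      case (elim x)
      have "c * ln (1 + x) < Re (cnj D * v1) - 1 - Q x2 + c * ln (1 + x2)"
        using elim(2) c by (simp add: pos_less_divide_eq mult.commute)
      with Qb[of x] elim show ?case by simp
    qed
    then show False by simp
  qed
  with gl ellg bv show ?thesis by (simp add: regular_at_m1_def)
qed

section \<open>Square integrability near the limit circle endpoint -1\<close>

lemma tendsto_minus_1_bounded_L2: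
  assumes b: "-1 < b" "b < 1" and bv: "bv a b f g v0 v1"
  obtains C \<eta> x0 where "\<eta> < 1" "-1 < x0" "x0 \<le> 0" "\<And>x. -1 < x \<Longrightarrow> x \<le> x0 \<Longrightarrow> (cmod (f x))\<^sup>2 * rw a b x \<le> C * (1 + x) powr (- \<eta>)"
proof -
  \<comment> \<open>For b >= 0, the midpoint of b and (1+b)/2. Above b, the power (1+x)^e absorbs
    \<open>ell\<close>; below (1+b)/2, the resulting bound (1+x)^(b-2e) on the density is
    integrable.\<close>
  define e where "e = (if b < 0 then 0 else (1 + 3 * b) / 4)"
  have e: "b - 2 * e > -1" "b \<ge> 0 \<Longrightarrow> e > b" using b by (auto simp: e_def field_simps)
  have "\<exists>l. ((\<lambda>x. of_real ((1 + x) powr e) * f x) \<longlongrightarrow> l) (at_right (-1))"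
  proof (cases "b < 0")
    case True
    then have "(f \<longlongrightarrow> v0) (at_right (-1))" using bv by (simp add: bv_def)
    then have "((\<lambda>x. of_real ((1 + x) powr e) * f x) \<longlongrightarrow> v0) (at_right (-1))"
      by (rule Lim_transform_eventually) (use eventually_at_right_m1 in eventually_elim, use True in \<open>simp add: e_def\<close>)
    then show ?thesis ..
  next
    case False
    then have "e > 0" using e b by simp
    have l: "((\<lambda>x. f x - v0 * of_real (ell a b x)) \<longlongrightarrow> v1) (at_right (-1))" using bv False by (simp add: bv_def)
    have "((\<lambda>x. of_real ((1 + x) powr e) * (f x - v0 * of_real (ell a b x)) + v0 * of_real ((1 + x) powr e * ell a b x)) \<longlongrightarrow> of_real 0 * v1 + v0 * of_real 0) (at_right (-1))"
      using e(2) False by (intro tendsto_add tendsto_mult tendsto_const tendsto_of_real l tendsto_1_plus_powr_0 ell_powr_tendsto_0 \<open>e > 0\<close>) auto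
    then have "((\<lambda>x. of_real ((1 + x) powr e) * f x) \<longlongrightarrow> of_real 0 * v1 + v0 * of_real 0) (at_right (-1))"
      by (simp add: algebra_simps)
    then show ?thesis ..
  qed
  then obtain l where l: "((\<lambda>x. of_real ((1 + x) powr e) * f x) \<longlongrightarrow> l) (at_right (-1))" ..
  have "\<forall>\<^sub>F x in at_right (-1). norm (of_real ((1 + x) powr e) * f x) < norm l + 1"
    using tendsto_norm[OF l] by (intro order_tendstoD) auto
  then obtain x1 where x1: "x1 > -1" "\<And>x. -1 < x \<Longrightarrow> x < x1 \<Longrightarrow> norm (of_real ((1 + x) powr e) * f x) < norm l + 1"
    unfolding eventually_at_right_field by blast
  define x0 where "x0 = (min x1 0 - 1) / 2"
  have x0: "-1 < x0" "x0 < x1" "x0 \<le> 0" using x1 by (auto simp: x0_def)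
  show ?thesis
  proof (rule that[of "2 * e - b" x0 "(norm l + 1)\<^sup>2 * (1 + 2 powr a)"])
    fix x assume x: "-1 < x" "x \<le> x0"
    define P where "P = (1 + x) powr (- e)"
    have "(1 + x) powr e * norm (f x) \<le> norm l + 1" using x1(2)[of x] x x0 by (simp add: norm_mult)
    then have "P * ((1 + x) powr e * norm (f x)) \<le> P * (norm l + 1)" by (intro mult_left_mono) (auto simp: P_def)
    moreover have "P * ((1 + x) powr e * norm (f x)) = norm (f x)" using x by (simp add: P_def mult.assoc[symmetric] flip: powr_add)
    ultimately have "(norm (f x))\<^sup>2 \<le> (P * (norm l + 1))\<^sup>2" by (intro power_mono) auto
    moreover have "(1 - x) powr a \<le> 1 + 2 powr a" using x x0 by (intro powr_le_near_m1) auto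
    ultimately have "(norm (f x))\<^sup>2 * ((1 - x) powr a * (1 + x) powr b) \<le> (P * (norm l + 1))\<^sup>2 * ((1 + 2 powr a) * (1 + x) powr b)"
      by (intro mult_mono mult_right_mono) auto
    also have "\<dots> = (norm l + 1)\<^sup>2 * (1 + 2 powr a) * (P * P * (1 + x) powr b)" by (simp add: power_mult_distrib power2_eq_square mult_ac)
    also have "P * P * (1 + x) powr b = (1 + x) powr (- (2 * e - b))" unfolding P_def by (simp flip: powr_add)
    finally show "(cmod (f x))\<^sup>2 * rw a b x \<le> (norm l + 1)\<^sup>2 * (1 + 2 powr a) * (1 + x) powr (- (2 * e - b))" by (simp add: rw_def)
  qed (use e x0 in auto)
qed

text \<open>Existence of boundary values at -1 already forces square integrability there, so for
  solutions only the endpoint 1 imposes an integrability condition.\<close>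

lemma L2w_of_bv_left:
  assumes b: "-1 < b" "b < 1" and q: "qpair a b f g" and bv: "bv a b f g v0 v1"
    and c: "-1 < c" "c < 1"
  shows "L2w (rw a b) {-1<..c} f"
proof -
  obtain C \<eta> x0 where x0: "\<eta> < 1" "-1 < x0" "x0 \<le> 0"
    and le: "\<And>x. -1 < x \<Longrightarrow> x \<le> x0 \<Longrightarrow> (cmod (f x))\<^sup>2 * rw a b x \<le> C * (1 + x) powr (- \<eta>)"
  proof (rule tendsto_minus_1_bounded_L2[OF b bv], goal_cases)
    case (1 C \<eta> x0)
    show ?case by (rule 1(1)[OF 1(2-4)]) (erule (1) 1(5))
  qed
  let ?F = "\<lambda>x. (cmod (f x))\<^sup>2 * rw a b x" and ?S = "{-1<..<1::real}"
  have fc: "continuous_on ?S f" 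
    by (rule continuous_on_vector_derivative, rule qpair_within[OF q]) auto
  have Fc: "continuous_on ?S ?F" using fc continuous_on_pw_rw(2) by (intro continuous_intros)
  have F0: "?F x \<ge> 0" for x by (simp add: rw_nonneg)
  have "?F absolutely_integrable_on {-1<..x0}"
  proof (rule measurable_bounded_by_integrable_imp_absolutely_integrable)
    show S: "{-1<..x0} \<in> sets lebesgue" by simp
    show "?F \<in> borel_measurable (lebesgue_on {-1<..x0})"
      by (rule continuous_imp_measurable_on_sets_lebesgue[OF continuous_on_subset[OF Fc] S]) (use x0 in auto)
    have "((\<lambda>t. (1 + t) powr (1 - \<eta> - 1)) has_integral ((1 + x0) powr (1 - \<eta>) / (1 - \<eta>) - (1 + -1) powr (1 - \<eta>) / (1 - \<eta>))) {-1..x0}"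
      using x0 by (intro has_integral_1_plus_powr) auto
    then have "(\<lambda>t. (1 + t) powr (1 - \<eta> - 1)) integrable_on {-1..x0}" by blast
    then have "(\<lambda>t. (1 + t) powr (- \<eta>)) absolutely_integrable_on {-1..x0}" by (intro nonnegative_absolutely_integrable_1) auto
    then have "(\<lambda>t. (1 + t) powr (- \<eta>)) absolutely_integrable_on {-1<..x0}" by (rule set_integrable_subset) auto
    then show "(\<lambda>t. C * (1 + t) powr (- \<eta>)) integrable_on {-1<..x0}"
      by (intro integrable_on_mult_right) (simp add: absolutely_integrable_on_def)
    show "norm (?F x) \<le> C * (1 + x) powr (- \<eta>)" if "x \<in> {-1<..x0}" for x
      using le[of x] that F0[of x] by simp
  qed
  moreover have "?F absolutely_integrable_on {x0..c}"
    by (intro absolutely_integrable_continuous_real continuous_on_subset[OF Fc]) (use x0 c in auto)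
  ultimately have "?F absolutely_integrable_on {-1<..x0} \<union> {x0..c}"
    by (intro set_integrable_Un) auto
  then have Fi: "?F absolutely_integrable_on {-1<..c}" by (rule set_integrable_subset) auto
  have S: "{-1<..c} \<in> sets lebesgue" by simp
  have "continuous_on {-1<..c} f" by (rule continuous_on_subset[OF fc]) (use c in auto)
  from continuous_imp_measurable_on_sets_lebesgue[OF this S] Fi show ?thesis
    unfolding L2w_iff[OF S] by (simp add: absolutely_integrable_on_def)
qed

lemma L2w_of_bv:
  assumes b: "-1 < b" "b < 1" and q: "qpair a b f g" and bv: "bv a b f g v0 v1"
    and c: "-1 < c" "c < 1" and L: "L2w (rw a b) {c<..<1} f"
  shows "L2w (rw a b) {-1<..<1} f"
proof -
  let ?F = "\<lambda>x. (cmod (f x))\<^sup>2 * rw a b x"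
  have F0: "?F x \<ge> 0" for x by (simp add: rw_nonneg)
  have "?F absolutely_integrable_on {-1<..c}" "?F absolutely_integrable_on {c<..<1}"
    using L2w_of_bv_left[OF b q bv c] L by (auto intro!: nonnegative_absolutely_integrable_1 simp: L2w_def rw_nonneg)
  then have "?F absolutely_integrable_on {-1<..c} \<union> {c<..<1}" by (intro set_integrable_Un) auto
  then have Fi: "?F absolutely_integrable_on {-1<..<1}" by (rule set_integrable_subset) auto
  have S: "{-1<..<1::real} \<in> sets lebesgue" by simp
  have "continuous_on {-1<..<1} f"
    by (rule continuous_on_vector_derivative, rule qpair_within[OF q]) auto
  from continuous_imp_measurable_on_sets_lebesgue[OF this S] Fi show ?thesis
    unfolding L2w_iff[OF S] by (simp add: absolutely_integrable_on_def)
qed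

context jacobi begin

lemma L2w_psi: "L2w (rw a b) {-1<..<1} (psi z)"
proof -
  obtain c where "-1 < c" "c < 1" "L2w (rw a b) {c<..<1} (psi z)" using L2w_psi_at_1 by metis
  then show ?thesis by (rule L2w_of_bv[OF b solg_qpair[OF solg_psi] bv_psi])
qed

lemma regular_at_m1_solg:
  assumes s: "solg a b z u h" and bv: "bv a b u h v0 v1"
  shows "regular_at_m1 a b u h v0 v1"
proof -
  have "L2w (rw a b) {-1<..0} u" by (rule L2w_of_bv_left[OF b solg_qpair[OF s] bv]) auto
  then have "L2w (rw a b) {-1<..0} (\<lambda>x. z * u x)" by (rule L2w_cmult) simp
  then show ?thesis by (rule regular_at_m1I[OF solg_tpair[OF s] _ b bv])
qed

lemma regular_at_m1_psi: "regular_at_m1 a b (psi z) (psig z) (P0 z) (P1 z)"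
  by (rule regular_at_m1_solg[OF solg_psi bv_psi])

lemma regular_at_m1_cnj:
  assumes "regular_at_m1 a b f g v0 v1"
  shows "regular_at_m1 a b (\<lambda>x. cnj (f x)) (\<lambda>x. cnj (g x)) (cnj v0) (cnj v1)"
proof (cases "b < 0")
  case True
  with assms show ?thesis by (auto simp: regular_at_m1_def bv_def intro: tendsto_cnj)
next
  case False
  then have l: "((\<lambda>x. f x - v0 * of_real (ell a b x)) \<longlongrightarrow> v1) (at_right (-1))" "(g \<longlongrightarrow> - v0) (at_right (-1))"
    "((\<lambda>x. of_real (ell a b x) * (g x + v0)) \<longlongrightarrow> 0) (at_right (-1))"
    using assms by (auto simp: regular_at_m1_def bv_def)
  from tendsto_cnj[OF l(1)] tendsto_cnj[OF l(2)] tendsto_cnj[OF l(3)] False show ?thesis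
    by (simp add: regular_at_m1_def bv_def)
qed

section \<open>Sign of the imaginary part and simplicity of zeros\<close>

text \<open>The term with |psi^[1]|^2/p is real and drops out of the imaginary part, so E has
  derivative -(Im z)^2 times the weight times |psi|^2; the prefactor Im z in E makes the sign
  independent of the half-plane. E decreases to 0 at 1, strictly near 1 where psi has no zeros,
  hence its limit at -1 is positive.\<close>

lemma herglotz:
  assumes z: "Im z \<noteq> 0"
  shows "Im z * Im (cnj (P0 z) * P1 z) > 0"
proof -
  define E where "E x = Im z * Im (cnj (psi z x) * psig z x)" for x
  have Ed: "(E has_real_derivative - (rw a b x * (norm (psi z x))\<^sup>2 * (Im z)\<^sup>2)) (at x)" if x: "-1 < x" "x < 1" for x
  proof -
    have p: "complex_of_real (pw a b x) \<noteq> 0" using pw_pos[OF x, of a b] by simp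
    have "((\<lambda>x. cnj (psi z x)) has_vector_derivative cnj (psig z x / of_real (pw a b x))) (at x)"
      by (rule bounded_linear.has_vector_derivative[OF bounded_linear_cnj qpair_within[OF solg_qpair[OF solg_psi] x]])
    from has_vector_derivative_mult[OF this solg_within[OF solg_psi x]]
    have "((\<lambda>x. cnj (psi z x) * psig z x) has_vector_derivative
       cnj (psi z x) * (- of_real (rw a b x) * z * psi z x) + cnj (psig z x / of_real (pw a b x)) * psig z x) (at x)" .
    then have "((\<lambda>x. Im (cnj (psi z x) * psig z x)) has_vector_derivative
       Im (cnj (psi z x) * (- of_real (rw a b x) * z * psi z x) + cnj (psig z x / of_real (pw a b x)) * psig z x)) (at x)"
      by (rule bounded_linear.has_vector_derivative[OF bounded_linear_Im])
    moreover have "Im (cnj (psi z x) * (- of_real (rw a b x) * z * psi z x) + cnj (psig z x / of_real (pw a b x)) * psig z x) = - (rw a b x * (norm (psi z x))\<^sup>2 * Im z)"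
    proof -
      have "cnj (psi z x) * (- of_real (rw a b x) * z * psi z x) = - (of_real (rw a b x * (norm (psi z x))\<^sup>2) * z)"
        unfolding of_real_mult complex_norm_square by (simp add: mult_ac)
      moreover have "cnj (psig z x / of_real (pw a b x)) * psig z x = of_real ((norm (psig z x))\<^sup>2 / pw a b x)"
        unfolding of_real_divide complex_norm_square by (simp add: mult_ac)
      ultimately show ?thesis by (simp only: plus_complex.sel uminus_complex.sel Im_complex_of_real) simp
    qed
    ultimately have "((\<lambda>x. Im (cnj (psi z x) * psig z x)) has_real_derivative - (rw a b x * (norm (psi z x))\<^sup>2 * Im z)) (at x)"
      by (simp add: has_real_derivative_iff_has_vector_derivative)
    from DERIV_cmult[OF this, of "Im z"] show ?thesis unfolding E_def[abs_def] by (simp add: power2_eq_square mult_ac)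
  qed
  have mono: "E y \<le> E x" if xy: "-1 < x" "x \<le> y" "y < 1" for x y
  proof (rule DERIV_nonpos_imp_nonincreasing[OF xy(2)])
    fix s assume "x \<le> s" "s \<le> y"
    then have s: "-1 < s" "s < 1" using xy by auto
    show "\<exists>d. (E has_real_derivative d) (at s) \<and> d \<le> 0"
      using Ed[OF s] rw_nonneg[of a b s] by (intro exI conjI) auto
  qed
  have "((\<lambda>x. Im z * Im (cnj (psi z x) * psig z x)) \<longlongrightarrow> Im z * Im 0) (at_left 1)"
    by (intro tendsto_intros psi_psig_tendsto_0)
  then have E1: "(E \<longlongrightarrow> 0) (at_left 1)" by (simp add: E_def[abs_def])
  have E0: "E x \<ge> 0" if x: "-1 < x" "x < 1" for x
  proof (rule tendsto_upperbound[OF E1])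
    have "\<forall>\<^sub>F y in at_left 1. x < y \<and> y < 1" using x by (intro eventually_at_leftI[of x]) auto
    then show "\<forall>\<^sub>F y in at_left 1. E y \<le> E x" by eventually_elim (use mono x in auto)
  qed auto
  have "\<forall>\<^sub>F x in at_left 1. dist (wv z x) 1 < 1" by (intro tendstoD wv_tendsto) auto
  then obtain x1 where x1: "x1 < 1" "\<And>x. x1 < x \<Longrightarrow> x < 1 \<Longrightarrow> dist (wv z x) 1 < 1"
    unfolding eventually_at_left_field by blast
  define x2 x3 where "x2 = (max x1 0 + 1) / 2" and "x3 = (x2 + 1) / 2"
  have x2: "x1 < x2" "0 < x2" "x2 < x3" "x3 < 1" using x1 by (auto simp: x2_def x3_def)
  have "E x3 < E x2"
  proof (rule DERIV_neg_imp_decreasing[OF x2(3)])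
    fix s assume "x2 \<le> s" "s \<le> x3"
    then have s: "-1 < s" "s < 1" "x1 < s" using x2 by auto
    have "wv z s \<noteq> 0" using x1(2)[of s] s by auto
    then have "psi z s \<noteq> 0" using kf_pos[of s] s by (simp add: psi_wv)
    then show "\<exists>d. (E has_real_derivative d) (at s) \<and> d < 0"
      using Ed[OF s(1,2)] rw_pos[OF s(1,2), of a b] z by (intro exI conjI) auto
  qed
  then have pos: "E x2 > 0" using E0[of x3] x2 by simp
  have Em: "(E \<longlongrightarrow> Im z * (Im (cnj (P0 z) * P1 z - cnj (P1 z) * P0 z) / 2)) (at_right (-1))"
  \<comment> \<open>For b >= 0 the product of the conjugate of psi with psi^[1] need not converge at
    -1. Its imaginary part does, being half the imaginary part of the Wronskian of the conjugate of
    psi with psi.\<close>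
  proof -
    have eq: "E x = Im z * (Im (wrk (\<lambda>x. cnj (psi z x)) (\<lambda>x. cnj (psig z x)) (psi z) (psig z) x) / 2)" for x
      by (simp add: E_def wrk_def algebra_simps)
    show ?thesis unfolding eq[abs_def] 
      by (intro tendsto_mult tendsto_divide tendsto_const tendsto_Im wrk_tendsto_m1[OF regular_at_m1_cnj[OF regular_at_m1_psi] regular_at_m1_psi]) auto
  qed
  have "E x2 \<le> Im z * (Im (cnj (P0 z) * P1 z - cnj (P1 z) * P0 z) / 2)"
  proof (rule tendsto_lowerbound[OF Em])
    have "\<forall>\<^sub>F y in at_right (-1). -1 < y \<and> y < x2" using x2 by (intro eventually_at_rightI[of _ x2]) auto
    then show "\<forall>\<^sub>F y in at_right (-1). E x2 \<le> E y" by eventually_elim (use mono x2 in auto)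
  qed auto
  also have "Im (cnj (P0 z) * P1 z - cnj (P1 z) * P0 z) / 2 = Im (cnj (P0 z) * P1 z)" by simp
  finally show ?thesis using pos by linarith
qed

end

lemma l2norm_cong: "(\<And>x. x \<in> S \<Longrightarrow> f x = g x) \<Longrightarrow> l2norm w S f = l2norm w S g"
  unfolding l2norm_def by (intro arg_cong[where f = sqrt] integral_cong) simp

lemma l2norm_cmult: "l2norm w S (\<lambda>x. c * f x) = cmod c * l2norm w S f"
proof -
  have "integral S (\<lambda>x. (cmod (c * f x))\<^sup>2 * w x) = (cmod c)\<^sup>2 * integral S (\<lambda>x. (cmod (f x))\<^sup>2 * w x)"
    by (simp add: norm_mult power_mult_distrib mult.assoc)
  then show ?thesis by (simp add: l2norm_def real_sqrt_mult)
qed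

lemma L2w_cong:
  assumes f: "L2w w S f" and S: "S \<in> sets lebesgue" and eq: "\<And>x. x \<in> S \<Longrightarrow> f x = g x"
  shows "L2w w S g"
proof -
  note L = f[unfolded L2w_iff[OF S]]
  have "g \<in> borel_measurable (lebesgue_on S)"
    using L measurable_cong[of "lebesgue_on S" f g borel] eq by simp
  moreover have "(\<lambda>x. (cmod (g x))\<^sup>2 * w x) integrable_on S"
    by (rule integrable_eq[OF conjunct2[OF L]]) (simp add: eq)
  ultimately show ?thesis unfolding L2w_iff[OF S] by simp
qed

text \<open>On a small circle around a zero of order $n$ the argument of $\overline{D}N$ runs through
  $n$ full turns, while its imaginary part keeps its sign on each half; hence $n \le 1$.\<close>
lemma herglotz_simple_zero:
  assumes DN: "D holomorphic_on UNIV" "N holomorphic_on UNIV"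
    and H: "\<And>z. Im z \<noteq> 0 \<Longrightarrow> Im z * Im (cnj (D z) * N z) > 0"
    and z0: "D z0 = 0" "N z0 \<noteq> 0"
  obtains r g where "r > 0" "g holomorphic_on ball z0 r" "\<And>w. w \<in> ball z0 r \<Longrightarrow> D w = g w * (w - z0) \<and> g w \<noteq> 0"
proof -
  have D\<i>: "D \<i> \<noteq> 0" using H[of \<i>] by auto
  define n where "n = nat (zorder D z0)"
  define g where "g = zor_poly D z0"
  have "(if D z0 = 0 then zorder D z0 > 0 else zorder D z0 = 0) \<and> (\<exists>r. r > 0 \<and> cball z0 r \<subseteq> UNIV \<and> g holomorphic_on cball z0 r
    \<and> (\<forall>w\<in>cball z0 r. D w = g w * (w - z0) ^ n \<and> g w \<noteq> 0))"
    unfolding g_def n_def by (rule zorder_exist_zero[OF DN(1)]) (use D\<i> in auto)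
  then obtain r where n: "zorder D z0 > 0" and r: "r > 0" "g holomorphic_on cball z0 r"
    "\<And>w. w \<in> cball z0 r \<Longrightarrow> D w = g w * (w - z0) ^ n \<and> g w \<noteq> 0"
    using z0 by auto
  have n0: "n > 0" using n by (simp add: n_def)
  have rz: "Im z0 = 0" using H[of z0] z0 by auto
  define k0 where "k0 = cnj (g z0) * N z0"
  have k0: "k0 \<noteq> 0" using r(3)[of z0] r(1) z0 by (simp add: k0_def)
  have gc: "isCont g z0" using holomorphic_on_imp_continuous_on[OF r(2)] r(1)
    by (intro continuous_on_interior[of "cball z0 r"]) auto
  have Nc: "isCont N z0" using holomorphic_on_imp_continuous_on[OF DN(2)] by (simp add: continuous_on_eq_continuous_at)
  have lim: "((\<lambda>\<epsilon>. sin \<theta> * Im (cnj (cis \<theta> ^ n) * (cnj (g (z0 + of_real \<epsilon> * cis \<theta>)) * N (z0 + of_real \<epsilon> * cis \<theta>)))) \<longlongrightarrow> sin \<theta> * Im (cnj (cis \<theta> ^ n) * k0)) (at_right 0)" for \<theta>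
  proof -
    have "((\<lambda>\<epsilon>. z0 + of_real \<epsilon> * cis \<theta>) \<longlongrightarrow> z0 + of_real 0 * cis \<theta>) (at_right 0)" by (intro tendsto_intros)
    then have l: "((\<lambda>\<epsilon>. z0 + of_real \<epsilon> * cis \<theta>) \<longlongrightarrow> z0) (at_right 0)" by simp
    show ?thesis unfolding k0_def
      by (intro tendsto_mult tendsto_const tendsto_Im tendsto_cnj isCont_tendsto_compose[OF gc l] isCont_tendsto_compose[OF Nc l])
  qed
  have sgn: "sin \<theta> * Im (cnj (cis \<theta> ^ n) * k0) \<ge> 0" if s: "sin \<theta> \<noteq> 0" for \<theta>
  proof (rule tendsto_lowerbound[OF lim])
    have "\<forall>\<^sub>F \<epsilon> in at_right (0::real). 0 < \<epsilon> \<and> \<epsilon> < r" using r(1) by (intro eventually_at_rightI[of 0 r]) auto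
    then show "\<forall>\<^sub>F \<epsilon> in at_right 0. 0 \<le> sin \<theta> * Im (cnj (cis \<theta> ^ n) * (cnj (g (z0 + of_real \<epsilon> * cis \<theta>)) * N (z0 + of_real \<epsilon> * cis \<theta>)))"
    proof eventually_elim
      case (elim \<epsilon>)
      define w where "w = z0 + of_real \<epsilon> * cis \<theta>"
      have wz: "w - z0 = of_real \<epsilon> * cis \<theta>" by (simp add: w_def)
      have "dist z0 w = \<epsilon>" using elim by (simp add: w_def dist_norm norm_mult)
      then have Dw: "D w = g w * (of_real \<epsilon> * cis \<theta>) ^ n" using r(3)[of w] elim unfolding wz by simp
      have Iw: "Im w = \<epsilon> * sin \<theta>" by (simp add: w_def rz)
      have "cnj (D w) * N w = of_real (\<epsilon> ^ n) * (cnj (cis \<theta> ^ n) * (cnj (g w) * N w))"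
        unfolding Dw by (simp add: power_mult_distrib mult_ac)
      then have "Im (cnj (D w) * N w) = \<epsilon> ^ n * Im (cnj (cis \<theta> ^ n) * (cnj (g w) * N w))"
        by (simp only: Im_complex_of_real times_complex.sel Re_complex_of_real mult_zero_left add_0_right)
      moreover have "Im w * Im (cnj (D w) * N w) > 0" using Iw elim s by (intro H) auto
      ultimately have "0 < (\<epsilon> * \<epsilon> ^ n) * (sin \<theta> * Im (cnj (cis \<theta> ^ n) * (cnj (g w) * N w)))"
        unfolding Iw by (simp only: mult_ac)
      moreover have "\<epsilon> * \<epsilon> ^ n > 0" using elim by simp
      ultimately show ?case unfolding w_def[symmetric] using zero_less_mult_pos less_imp_le by blast
    qed
  qed auto
  have "n = 1"
  proof (rule ccontr)
    assume "n \<noteq> 1"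
    with n0 have n2: "real n \<ge> 2" by simp
    have zero: "Im (cnj (cis \<phi>) * k0) = 0" if \<phi>: "0 < \<phi>" "\<phi> < pi" for \<phi>
    proof -
      \<comment> \<open>Arguments of two n-th roots of \<open>cis \<phi>\<close>. For n >= 2 one
        lies in the upper and one in the lower open half-plane, so the same imaginary part is both
        nonnegative and nonpositive.\<close>
      define \<theta>1 \<theta>2 where "\<theta>1 = \<phi> / real n" and "\<theta>2 = (\<phi> - 2 * pi) / real n"
      have c1: "cis \<theta>1 ^ n = cis \<phi>" and c2: "cis \<theta>2 ^ n = cis \<phi>"
      proof -
        show "cis \<theta>1 ^ n = cis \<phi>" unfolding Complex.DeMoivre using n0 by (simp add: \<theta>1_def)
        have "cis \<theta>2 ^ n = cis (\<phi> - 2 * pi)" unfolding Complex.DeMoivre using n0 by (simp add: \<theta>2_def)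
        then show "cis \<theta>2 ^ n = cis \<phi>" by (simp add: cis_divide[symmetric])
      qed
      have "\<phi> < pi * real n" using \<phi> n2 pi_gt_zero by (smt (verit) mult_le_cancel_left1)
      then have "\<theta>1 > 0" "\<theta>1 < pi" using \<phi> n2 by (auto simp: \<theta>1_def field_simps)
      then have s1: "sin \<theta>1 > 0" by (rule sin_gt_zero)
      have "2 * pi - \<phi> < pi * real n"
      proof -
        have "pi * 2 \<le> pi * real n" using n2 by (intro mult_left_mono) auto
        then show ?thesis using \<phi> by linarith
      qed
      then have "- \<theta>2 > 0" "- \<theta>2 < pi" using \<phi> n2 pi_gt_zero by (auto simp: \<theta>2_def field_simps)
      then have "sin (- \<theta>2) > 0" by (rule sin_gt_zero)
      then have s2: "sin \<theta>2 < 0" by simp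
      have "Im (cnj (cis \<phi>) * k0) \<ge> 0" using sgn[of \<theta>1] s1 unfolding c1 by (simp only: zero_le_mult_iff) auto
      moreover have "Im (cnj (cis \<phi>) * k0) \<le> 0" using sgn[of \<theta>2] s2 unfolding c2 by (simp only: zero_le_mult_iff) auto
      ultimately show ?thesis by linarith
    qed
    \<comment> \<open>Two angles that are linearly independent as directions: a number real after
      both rotations is 0.\<close>
    have "Im (cnj (cis (pi / 2)) * k0) = 0" by (rule zero) (use pi_gt_zero in linarith)+
    then have R: "Re k0 = 0" by (simp add: cis.simps)
    have "Im (cnj (cis (pi / 3)) * k0) = 0" by (rule zero) (use pi_gt_zero in linarith)+
    then have "Im k0 = 0" using R by (simp add: cis.simps cos_60)
    with R show False using k0 by (simp add: complex_eq_iff)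
  qed
  show ?thesis
  proof (rule that[of r g])
    show "g holomorphic_on ball z0 r" by (rule holomorphic_on_subset[OF r(2)]) auto
    show "D w = g w * (w - z0) \<and> g w \<noteq> 0" if "w \<in> ball z0 r" for w
      using r(3)[of w] that \<open>n = 1\<close> by auto
  qed (rule r(1))
qed

context jacobi begin

section \<open>Solutions determined by their boundary values, and solutions square integrable at
  1\<close>

lemma wrk_const:
  assumes s: "solg a b z f g" "solg a b z u h" and xy: "-1 < x" "x \<le> y" "y < 1"
  shows "wrk f g u h y = wrk f g u h x"
  using lagrange_identity(2)[OF solg_tpair[OF s(1)] s(2) xy] by simp

lemma wrk_bv:
  assumes s: "solg a b z f g" "solg a b z u h" and bv: "bv a b f g v0 v1" "bv a b u h w0 w1" and x: "-1 < x" "x < 1"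
  shows "wrk f g u h x = v0 * w1 - v1 * w0"
proof (rule tendsto_unique)
  show "(wrk f g u h \<longlongrightarrow> v0 * w1 - v1 * w0) (at_right (-1))"
    by (rule wrk_tendsto_m1[OF regular_at_m1_solg[OF s(1) bv(1)] regular_at_m1_solg[OF s(2) bv(2)]])
  have "\<forall>\<^sub>F y in at_right (-1). -1 < y \<and> y < x" using x by (intro eventually_at_rightI[of _ x]) auto
  then have "\<forall>\<^sub>F y in at_right (-1). wrk f g u h x = wrk f g u h y"
    by eventually_elim (use wrk_const[OF s] x in auto)
  then show "(wrk f g u h \<longlongrightarrow> wrk f g u h x) (at_right (-1))"
    by (rule Lim_transform_eventually[OF tendsto_const])
qed auto

lemma basis_at_m1:
  obtains \<theta> g\<theta> \<phi> g\<phi> where "solg a b z \<theta> g\<theta>" "solg a b z \<phi> g\<phi>" "bv a b \<theta> g\<theta> 1 0" "bv a b \<phi> g\<phi> 0 1"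
proof -
  obtain u g where u: "solg a b z u g" "bv a b u g (if b < 0 then 1 else 0) (if b < 0 then 0 else 1)"
    using regular_solution_at_m1[OF b, of a z] by metis
  obtain u' g' where u': "solg a b z u' g'" "bv a b u' g' (if b < 0 then 0 else 1) (if b < 0 then 1 else 0)"
    using singular_solution_at_m1[OF b, of a z] by metis
  show ?thesis
  proof (cases "b < 0")
    case True
    with u u' show ?thesis by (intro that[of u g u' g']) simp_all
  next
    case False
    with u u' show ?thesis by (intro that[of u' g' u g]) simp_all
  qed
qed

text \<open>Uniqueness at a singular endpoint without an initial value theorem: the Wronskians with
  both basis solutions vanish, and the basis has Wronskian 1, so Cramer's rule gives f = 0.\<close>

lemma sol_zero:
  assumes s: "solg a b z f g" and bv: "bv a b f g 0 0" and x: "-1 < x" "x < 1"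
  shows "f x = 0"
proof -
  obtain \<theta> g\<theta> \<phi> g\<phi> where B: "solg a b z \<theta> g\<theta>" "solg a b z \<phi> g\<phi>" "bv a b \<theta> g\<theta> 1 0" "bv a b \<phi> g\<phi> 0 1"
    by (rule basis_at_m1)
  have "f x * g\<theta> x - \<theta> x * g x = 0" using wrk_bv[OF s B(1) bv B(3) x] by (simp add: wrk_def)
  moreover have "f x * g\<phi> x - \<phi> x * g x = 0" using wrk_bv[OF s B(2) bv B(4) x] by (simp add: wrk_def)
  moreover have "\<theta> x * g\<phi> x - \<phi> x * g\<theta> x = 1" using wrk_bv[OF B(1,2) B(3,4) x] by (simp add: wrk_def)
  ultimately show ?thesis by algebra
qed

lemma psi_not_zero: "\<exists>c d. -1 < c \<and> c < d \<and> d < 1 \<and> (\<forall>x. c \<le> x \<and> x \<le> d \<longrightarrow> psi z x \<noteq> 0)"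
proof -
  have "\<forall>\<^sub>F x in at_left 1. dist (wv z x) 1 < 1" by (intro tendstoD wv_tendsto) auto
  then obtain x1 where x1: "x1 < 1" "\<And>x. x1 < x \<Longrightarrow> x < 1 \<Longrightarrow> dist (wv z x) 1 < 1"
    unfolding eventually_at_left_field by blast
  define c where "c = (max x1 0 + 1) / 2"
  define d where "d = (c + 1) / 2"
  have cd: "x1 < c" "0 < c" "c < d" "d < 1" using x1 by (auto simp: c_def d_def)
  have "psi z x \<noteq> 0" if "c \<le> x" "x \<le> d" for x
  proof -
    have "wv z x \<noteq> 0" using x1(2)[of x] that cd by auto
    then show ?thesis using kf_pos[of x] that cd by (simp add: psi_wv)
  qed
  then show ?thesis using cd by (intro exI[of _ c] exI[of _ d]) auto
qed

lemma P_nonzero: "P0 z \<noteq> 0 \<or> P1 z \<noteq> 0"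
proof (rule ccontr)
  assume "\<not> ?thesis"
  then have "bv a b (psi z) (psig z) 0 0" using bv_psi[of z] by simp
  note zero = sol_zero[OF solg_psi this]
  obtain c d where "-1 < c" "c < d" "d < 1" "\<And>x. c \<le> x \<and> x \<le> d \<Longrightarrow> psi z x \<noteq> 0" using psi_not_zero by metis
  then show False using zero[of c] by simp
qed

lemma l2norm_psi: "l2norm (rw a b) {-1<..<1} (psi z) \<noteq> 0"
proof
  obtain c d where cd: "-1 < c" "c < d" "d < 1" "\<And>x. c \<le> x \<and> x \<le> d \<Longrightarrow> psi z x \<noteq> 0" using psi_not_zero by metis
  let ?F = "\<lambda>x. (cmod (psi z x))\<^sup>2 * rw a b x"
  have Fi: "?F integrable_on {-1<..<1}" using L2w_psi[of z] by (simp add: L2w_def)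
  assume "l2norm (rw a b) {-1<..<1} (psi z) = 0"
  then have I0: "integral {-1<..<1} ?F = 0" by (simp add: l2norm_def)
  have pc: "continuous_on {c..d} (psi z)" by (rule qpair_continuous_on[OF solg_qpair[OF solg_psi] cd(1,3)])
  have rc: "continuous_on {c..d} (rw a b)" by (rule continuous_on_subset[OF continuous_on_pw_rw(2)]) (use cd in auto)
  have Fc: "continuous_on {c..d} ?F" by (intro continuous_intros pc rc)
  have F0: "?F x \<ge> 0" for x by (simp add: rw_nonneg)
  have "integral {c..d} ?F \<le> integral {-1<..<1} ?F"
    using cd F0 by (intro integral_subset_le Fi integrable_continuous_real Fc) auto
  moreover have "integral {c..d} ?F \<ge> 0" by (intro integral_nonneg integrable_continuous_real Fc F0)
  ultimately have "integral {c..d} ?F = 0" using I0 by linarith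
  then have "(?F has_integral 0) (cbox c d)" using integrable_integral[OF integrable_continuous_real[OF Fc]] by simp
  from has_integral_0_cbox_imp_0[of c d ?F, OF _ F0 this] have "?F c = 0" using Fc cd by simp
  moreover have "rw a b c > 0" using cd by (intro rw_pos) auto
  ultimately show False using cd(4)[of c] cd(2) by simp
qed

text \<open>The Wronskian of two solutions is constant, so the oscillation bound in
  \<open>wrk_bound_at_1\<close> is M = 0 and the Wronskian with psi vanishes. The boundary values
  are then proportional, and uniqueness at -1 extends this to the functions.\<close>

lemma L2_solution_multiple:
  assumes s: "solg a b z f g" and bv: "bv a b f g v0 v1" and c: "-1 < c" "c < 1" and L: "L2w (rw a b) {c<..<1} f"
  shows "v0 * P1 z = v1 * P0 z" "\<exists>k. v0 = k * P0 z \<and> v1 = k * P1 z \<and> (\<forall>x\<in>{-1<..<1}. f x = k * psi z x)"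
proof -
  have W0: "norm (wrk f g (psi z) (psig z) 0) \<le> 0"
  proof (rule wrk_bound_at_1[OF solg_qpair[OF s] c L])
    fix x y :: real assume xy: "-1 < x" "x < 1" "-1 < y" "y < 1"
    have "wrk f g (psi z) (psig z) y = wrk f g (psi z) (psig z) x"
    proof (cases "x \<le> y")
      case True
      then show ?thesis using xy by (intro wrk_const[OF s solg_psi])
    next
      case False
      then show ?thesis using xy by (intro wrk_const[OF s solg_psi, symmetric]) auto
    qed
    then show "norm (wrk f g (psi z) (psig z) y - wrk f g (psi z) (psig z) x) \<le> 0" by simp
  qed auto
  then have "v0 * P1 z - v1 * P0 z = 0" using wrk_bv[OF s solg_psi bv bv_psi, of 0] by simp
  then show e: "v0 * P1 z = v1 * P0 z" by simp
  \<comment> \<open>Divides by whichever of the two boundary values of psi is nonzero; they never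
    vanish together.\<close>
  define k where "k = (if P0 z = 0 then v1 / P1 z else v0 / P0 z)"
  have k: "v0 = k * P0 z" "v1 = k * P1 z"
  proof -
    show "v0 = k * P0 z" using e P_nonzero[of z] by (auto simp: k_def)
    show "v1 = k * P1 z" using e P_nonzero[of z] by (auto simp: k_def field_simps)
  qed
  have bv0: "bv a b (\<lambda>x. f x + - k * psi z x) (\<lambda>x. g x + - k * psig z x) (v0 + - k * P0 z) (v1 + - k * P1 z)"
    by (intro bv_add bv bv_cmult bv_psi)
  have s0: "solg a b z (\<lambda>x. f x + - k * psi z x) (\<lambda>x. g x + - k * psig z x)"
    by (intro solg_add s solg_cmult solg_psi)
  have "bv a b (\<lambda>x. f x + - k * psi z x) (\<lambda>x. g x + - k * psig z x) 0 0" using bv0 k by simp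
  note zero = sol_zero[OF s0 this]
  have "f x = k * psi z x" if "x \<in> {-1<..<1}" for x
    using zero[of x] that by simp
  with k show "\<exists>k. v0 = k * P0 z \<and> v1 = k * P1 z \<and> (\<forall>x\<in>{-1<..<1}. f x = k * psi z x)" by blast
qed

section \<open>The m-function and the spectrum\<close>

definition m_denom :: "real \<Rightarrow> complex \<Rightarrow> complex" where
  "m_denom gam z = of_real (cos gam) * P0 z + of_real (sin gam) * P1 z"
definition m_num :: "real \<Rightarrow> complex \<Rightarrow> complex" where
  "m_num gam z = of_real (cos gam) * P1 z - of_real (sin gam) * P0 z"

lemma of_real_cos_sin_squared: "complex_of_real (cos t) * of_real (cos t) + of_real (sin t) * of_real (sin t) = 1"
proof -
  have "cos t * cos t + sin t * sin t = 1" using sin_cos_squared_add2[of t] by simp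
  then show ?thesis by (simp only: flip: of_real_mult of_real_add) simp
qed

lemma m_denom_m_num:
  "of_real (cos t) * m_denom t z - of_real (sin t) * m_num t z = P0 z"
  "of_real (sin t) * m_denom t z + of_real (cos t) * m_num t z = P1 z"
  using of_real_cos_sin_squared[of t] unfolding m_denom_def m_num_def by algebra+

lemma L2w_psi_right: "-1 < c \<Longrightarrow> L2w (rw a b) {c<..<1} (psi z)"
  by (rule L2w_subset[OF L2w_psi]) (auto simp: rw_nonneg)

text \<open>Existence: with m = N/D the combination theta + m phi has the boundary values of psi/D,
  hence equals it and is square integrable at 1. Uniqueness: any admissible combination has boundary
  values proportional to those of psi, which is a linear equation for m with leading coefficient
  D.\<close>

lemma mfun_eq:
  assumes D: "m_denom gam z \<noteq> 0"
  shows "mfun gam a b z = m_num gam z / m_denom gam z"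
  unfolding mfun_def
proof (rule the_equality)
  let ?c = "complex_of_real (cos gam)" and ?s = "complex_of_real (sin gam)"
  obtain \<theta> g\<theta> \<phi> g\<phi> where B: "solg a b z \<theta> g\<theta>" "solg a b z \<phi> g\<phi>" "bv a b \<theta> g\<theta> 1 0" "bv a b \<phi> g\<phi> 0 1"
    by (rule basis_at_m1)
  let ?m = "m_num gam z / m_denom gam z"
  define f gf where "f x = ?c * \<phi> x + - ?s * \<theta> x" and "gf x = ?c * g\<phi> x + - ?s * g\<theta> x" for x
  define t gt where "t x = ?c * \<theta> x + ?s * \<phi> x" and "gt x = ?c * g\<theta> x + ?s * g\<phi> x" for x
  have sf: "solg a b z f gf" and st: "solg a b z t gt"
    unfolding f_def[abs_def] gf_def[abs_def] t_def[abs_def] gt_def[abs_def] by (intro solg_add solg_cmult B)+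
  have "bv a b f gf (?c * 0 + - ?s * 1) (?c * 1 + - ?s * 0)" "bv a b t gt (?c * 1 + ?s * 0) (?c * 0 + ?s * 1)"
    unfolding f_def[abs_def] gf_def[abs_def] t_def[abs_def] gt_def[abs_def] by (intro bv_add bv_cmult B)+
  then have bf: "bv a b f gf (- ?s) ?c" and bt: "bv a b t gt ?c ?s" by simp_all
  have L: "L2w (rw a b) {c<..<1} (\<lambda>x. t x + ?m * f x)" if c: "c \<in> {-1<..<1}" for c
  proof -
    define k where "k = - (1 / m_denom gam z)"
    have s0: "solg a b z (\<lambda>x. (t x + ?m * f x) + k * psi z x) (\<lambda>x. (gt x + ?m * gf x) + k * psig z x)"
      by (intro solg_add solg_cmult sf st solg_psi)
    have b0: "bv a b (\<lambda>x. (t x + ?m * f x) + k * psi z x) (\<lambda>x. (gt x + ?m * gf x) + k * psig z x)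
       ((?c + ?m * - ?s) + k * P0 z) ((?s + ?m * ?c) + k * P1 z)"
      by (intro bv_add bv_cmult bf bt bv_psi)
    have "(?c + ?m * - ?s) + k * P0 z = (?c * m_denom gam z - ?s * m_num gam z - P0 z) / m_denom gam z"
      "(?s + ?m * ?c) + k * P1 z = (?s * m_denom gam z + ?c * m_num gam z - P1 z) / m_denom gam z"
      using D by (simp_all add: k_def field_simps)
    then have "(?c + ?m * - ?s) + k * P0 z = 0" "(?s + ?m * ?c) + k * P1 z = 0" unfolding m_denom_m_num by simp_all
    with b0 have "bv a b (\<lambda>x. (t x + ?m * f x) + k * psi z x) (\<lambda>x. (gt x + ?m * gf x) + k * psig z x) 0 0" by (simp only:)
    note zero = sol_zero[OF s0 this]
    have "L2w (rw a b) {c<..<1} (\<lambda>x. - k * psi z x)" using c by (intro L2w_cmult L2w_psi_right) auto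
    then show ?thesis
    proof (rule L2w_cong)
      fix x assume "x \<in> {c<..<1}"
      then have "-1 < x" "x < 1" using c by auto
      from zero[OF this] show "- k * psi z x = t x + ?m * f x" by (simp add: add_eq_0_iff)
    qed simp
  qed
  have gf: "gbv a b f (- ?s) ?c" "gbv a b t ?c ?s"
    using bf bt gbv_iff_bv[OF solg_qpair[OF sf]] gbv_iff_bv[OF solg_qpair[OF st]] by blast+
  have "sol a b z f" "sol a b z t" using sf st unfolding sol_iff by blast+
  with gf L show "\<exists>\<phi> \<theta>. sol a b z \<phi> \<and> sol a b z \<theta> \<and> gbv a b \<phi> (- ?s) ?c \<and> gbv a b \<theta> ?c ?s \<and>
      (\<forall>c\<in>{-1<..<1}. L2w (rw a b) {c<..<1} (\<lambda>x. \<theta> x + ?m * \<phi> x))" by blast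
next
  let ?c = "complex_of_real (cos gam)" and ?s = "complex_of_real (sin gam)"
  fix m assume "\<exists>\<phi> \<theta>. sol a b z \<phi> \<and> sol a b z \<theta> \<and> gbv a b \<phi> (- ?s) ?c \<and> gbv a b \<theta> ?c ?s \<and>
      (\<forall>c\<in>{-1<..<1}. L2w (rw a b) {c<..<1} (\<lambda>x. \<theta> x + m * \<phi> x))"
  then obtain f t where ft: "sol a b z f" "sol a b z t" "gbv a b f (- ?s) ?c" "gbv a b t ?c ?s"
    and L: "\<forall>c\<in>{-1<..<1}. L2w (rw a b) {c<..<1} (\<lambda>x. t x + m * f x)" by blast
  obtain gf gt where g: "solg a b z f gf" "solg a b z t gt" using ft(1,2) unfolding sol_iff by blast
  have bf: "bv a b f gf (- ?s) ?c" and bt: "bv a b t gt ?c ?s"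
    using ft(3,4) gbv_iff_bv[OF solg_qpair[OF g(1)]] gbv_iff_bv[OF solg_qpair[OF g(2)]] by blast+
  have s: "solg a b z (\<lambda>x. t x + m * f x) (\<lambda>x. gt x + m * gf x)" by (intro solg_add solg_cmult g)
  have bb: "bv a b (\<lambda>x. t x + m * f x) (\<lambda>x. gt x + m * gf x) (?c + m * - ?s) (?s + m * ?c)" by (intro bv_add bv_cmult bf bt)
  have "L2w (rw a b) {0<..<1} (\<lambda>x. t x + m * f x)" using L by simp
  from L2_solution_multiple(1)[OF s bb _ _ this] have "(?c + m * - ?s) * P1 z = (?s + m * ?c) * P0 z" by simp
  then have "m * m_denom gam z = m_num gam z" unfolding m_denom_def m_num_def by algebra
  then show "m = m_num gam z / m_denom gam z" using D by (simp add: eq_divide_eq)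
qed

section \<open>The operator: eigenvalues and resolvent set\<close>

lemma Tgam_iff:
  "(f, h) \<in> Tgam gam a b \<longleftrightarrow> L2w (rw a b) {-1<..<1} f \<and> L2w (rw a b) {-1<..<1} h \<and>
     (\<exists>g v0 v1. tpair a b f g h \<and> bv a b f g v0 v1 \<and> of_real (sin gam) * v1 + of_real (cos gam) * v0 = 0)"
proof -
  have "gbv a b f v0 v1 \<longleftrightarrow> bv a b f g v0 v1" if "tpair a b f g h" for g v0 v1
    using that unfolding tpair_def by (intro gbv_iff_bv) simp
  then show ?thesis unfolding Tgam_def mem_Collect_eq case_prod_conv Tmax_iff by blast
qed

lemma psi_Tgam: "m_denom gam z = 0 \<Longrightarrow> (psi z, \<lambda>x. z * psi z x) \<in> Tgam gam a b"
  unfolding Tgam_iff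
  by (intro conjI exI[of _ "psig z"] exI[of _ "P0 z"] exI[of _ "P1 z"] L2w_psi L2w_cmult solg_tpair[OF solg_psi] bv_psi)
    (simp_all add: m_denom_def add.commute)

lemma eigen_multiple:
  assumes "(f, \<lambda>x. z * f x) \<in> Tgam gam a b"
  shows "\<exists>k. (\<forall>x\<in>{-1<..<1}. f x = k * psi z x) \<and> k * m_denom gam z = 0"
proof -
  obtain g v0 v1 where f: "L2w (rw a b) {-1<..<1} f" "tpair a b f g (\<lambda>x. z * f x)" "bv a b f g v0 v1"
    "of_real (sin gam) * v1 + of_real (cos gam) * v0 = 0"
    using assms unfolding Tgam_iff by blast
  have "L2w (rw a b) {0<..<1} f" by (rule L2w_subset[OF f(1)]) (auto simp: rw_nonneg)
  from L2_solution_multiple(2)[OF tpair_solg[OF f(2)] f(3) _ _ this]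
  obtain k where k: "v0 = k * P0 z" "v1 = k * P1 z" "\<forall>x\<in>{-1<..<1}. f x = k * psi z x" by auto
  have "k * m_denom gam z = 0" using f(4) unfolding k(1,2) m_denom_def by algebra
  with k(3) show ?thesis by blast
qed

lemma eigfun_multiple:
  assumes "eigfun (Tgam gam a b) (rw a b) z f"
  shows "\<exists>k. k \<noteq> 0 \<and> (\<forall>x\<in>{-1<..<1}. f x = k * psi z x)" "m_denom gam z = 0"
proof -
  obtain k where k: "\<forall>x\<in>{-1<..<1}. f x = k * psi z x" "k * m_denom gam z = 0"
    using eigen_multiple[of f z gam] assms unfolding eigfun_def by blast
  have "l2norm (rw a b) {-1<..<1} f = cmod k * l2norm (rw a b) {-1<..<1} (psi z)"
    unfolding l2norm_cmult[symmetric] using k by (intro l2norm_cong) blast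
  then have "k \<noteq> 0" using assms unfolding eigfun_def by auto
  with k show "\<exists>k. k \<noteq> 0 \<and> (\<forall>x\<in>{-1<..<1}. f x = k * psi z x)" "m_denom gam z = 0" by auto
qed

lemma eigvals_iff: "z \<in> eigvals (Tgam gam a b) (rw a b) \<longleftrightarrow> m_denom gam z = 0"
proof
  assume "z \<in> eigvals (Tgam gam a b) (rw a b)"
  then show "m_denom gam z = 0" using eigfun_multiple(2) unfolding eigvals_def by blast
next
  assume "m_denom gam z = 0"
  then have "eigfun (Tgam gam a b) (rw a b) z (psi z)" unfolding eigfun_def using psi_Tgam l2norm_psi by blast
  then show "z \<in> eigvals (Tgam gam a b) (rw a b)" unfolding eigvals_def by blast
qed

lemma zero_Tgam: "(\<lambda>x. 0, \<lambda>x. z * 0 + 0) \<in> Tgam gam a b"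
proof -
  have "solg a b 0 (\<lambda>x. 0) (\<lambda>x. 0)" using solg_cmult[OF solg_psi[of 0], of 0] by simp
  from solg_tpair[OF this] have "tpair a b (\<lambda>x. 0) (\<lambda>x. 0) (\<lambda>x. 0)" by simp
  moreover have "bv a b (\<lambda>x. 0) (\<lambda>x. 0) 0 0" using bv_cmult[OF bv_psi[of 0], of 0] by simp
  moreover have "L2w (rw a b) {-1<..<1} (\<lambda>x. 0)" using L2w_cmult[OF L2w_psi[of 0], of 0] by simp
  ultimately show ?thesis unfolding Tgam_iff mult_zero_right add_0_right
    by (intro conjI exI[of _ "\<lambda>x. 0"] exI[of _ 0]) simp_all
qed

text \<open>At a zero of the denominator both psi and 0 solve the resolvent equation with right-hand
  side 0, which contradicts the uniqueness clause of \<open>rset\<close>.\<close>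

lemma rset_m_denom:
  assumes "z \<in> rset (Tgam gam a b) (rw a b)"
  shows "m_denom gam z \<noteq> 0"
proof
  assume "m_denom gam z = 0"
  then have "(psi z, \<lambda>x. z * psi z x + 0) \<in> Tgam gam a b" using psi_Tgam by simp
  moreover have "\<forall>h f1 f2. (f1, \<lambda>x. z * f1 x + h x) \<in> Tgam gam a b \<and> (f2, \<lambda>x. z * f2 x + h x) \<in> Tgam gam a b \<longrightarrow>
         l2norm (rw a b) {-1<..<1} (\<lambda>x. f1 x - f2 x) = 0" using assms unfolding rset_def by blast
  ultimately have "l2norm (rw a b) {-1<..<1} (\<lambda>x. psi z x - 0) = 0"
    using zero_Tgam[of z gam] by (elim allE[where x = "\<lambda>x. 0"] allE[where x = "psi z"]) blast
  then show False using l2norm_psi[of z] by simp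
qed

lemma Tgam_diff:
  assumes "(f1, \<lambda>x. z * f1 x + h x) \<in> Tgam gam a b" "(f2, \<lambda>x. z * f2 x + h x) \<in> Tgam gam a b" and D: "m_denom gam z \<noteq> 0"
    and x: "x \<in> {-1<..<1}"
  shows "f1 x = f2 x"
proof -
  obtain g v0 v1 where f: "L2w (rw a b) {-1<..<1} f1" "tpair a b f1 g (\<lambda>x. z * f1 x + h x)" "bv a b f1 g v0 v1"
    "of_real (sin gam) * v1 + of_real (cos gam) * v0 = 0" using assms(1) unfolding Tgam_iff by blast
  obtain g' w0 w1 where f': "L2w (rw a b) {-1<..<1} f2" "tpair a b f2 g' (\<lambda>x. z * f2 x + h x)" "bv a b f2 g' w0 w1"
    "of_real (sin gam) * w1 + of_real (cos gam) * w0 = 0" using assms(2) unfolding Tgam_iff by blast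
  let ?d = "\<lambda>x. f1 x + - 1 * f2 x"
  have S: "{-1<..<1::real} \<in> sets lebesgue" by simp
  have L: "L2w (rw a b) {-1<..<1} ?d"
    by (rule L2w_add(1)[OF f(1) L2w_cmult[OF f'(1) S] S borel_measurable_rw[OF S subset_refl] rw_nonneg])
  have "tpair a b ?d (\<lambda>x. g x + - 1 * g' x) (\<lambda>x. (z * f1 x + h x) + - 1 * (z * f2 x + h x))" by (rule tpair_add_cmult[OF f(2) f'(2)])
  moreover have "(\<lambda>x. (z * f1 x + h x) + - 1 * (z * f2 x + h x)) = (\<lambda>x. z * ?d x)" by (simp add: fun_eq_iff algebra_simps)
  ultimately have t: "tpair a b ?d (\<lambda>x. g x + - 1 * g' x) (\<lambda>x. z * ?d x)" by simp
  have bv: "bv a b ?d (\<lambda>x. g x + - 1 * g' x) (v0 + - 1 * w0) (v1 + - 1 * w1)" by (intro bv_add bv_cmult f f')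
  have "of_real (sin gam) * (v1 + - 1 * w1) + of_real (cos gam) * (v0 + - 1 * w0) = 0" using f(4) f'(4) by algebra
  with L L2w_cmult[OF L S, of z] t bv have "(?d, \<lambda>x. z * ?d x) \<in> Tgam gam a b" unfolding Tgam_iff by blast
  from eigen_multiple[OF this] obtain k where "\<forall>x\<in>{-1<..<1}. ?d x = k * psi z x" "k * m_denom gam z = 0" by blast
  then show ?thesis using D x by simp
qed

text \<open>By the boundary condition, v0 D is sin gamma times the boundary Wronskian of f with psi.
  That Wronskian has oscillation at most the product of the norms of psi and h, and the limit point
  property turns oscillation into size. The bound controls the correction term in
  \<open>rset_transfer\<close>.\<close>

lemma boundary_functional_bound:
  assumes f: "(f, \<lambda>x. z * f x + h x) \<in> Tgam gam a b" and h: "L2w (rw a b) {-1<..<1} h" and bv: "tpair a b f g (\<lambda>x. z * f x + h x)"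
    "bv a b f g v0 v1" "of_real (sin gam) * v1 + of_real (cos gam) * v0 = 0"
  shows "cmod v0 * cmod (m_denom gam z) \<le> l2norm (rw a b) {-1<..<1} (psi z) * l2norm (rw a b) {-1<..<1} h"
proof -
  let ?M = "l2norm (rw a b) {-1<..<1} (psi z) * l2norm (rw a b) {-1<..<1} h" and ?W = "wrk f g (psi z) (psig z)"
  have fL: "L2w (rw a b) {-1<..<1} f" "L2w (rw a b) {-1<..<1} (\<lambda>x. z * f x + h x)" using f unfolding Tgam_iff by blast+
  have h': "L2w (rw a b) {-1<..<1} (\<lambda>x. z * f x + h x - z * f x)" using h by simp
  have "L2w (rw a b) {0<..<1} f" by (rule L2w_subset[OF fL(1)]) (auto simp: rw_nonneg)
  then have W: "norm (?W x) \<le> ?M" if "-1 < x" "x < 1" for x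
  proof (rule wrk_bound_at_1[rotated 3])
    show "qpair a b f g" using bv(1) by (simp add: tpair_def)
    show "norm (?W y - ?W x) \<le> ?M" if "-1 < x" "x < 1" "-1 < y" "y < 1" for x y
      using wrk_diff_bound[OF bv(1) solg_psi L2w_psi h' that] by simp
  qed (use that in auto)
  have "L2w (rw a b) {-1<..0} (\<lambda>x. z * f x + h x)" by (rule L2w_subset[OF fL(2)]) (auto simp: rw_nonneg)
  from wrk_tendsto_m1[OF regular_at_m1I[OF bv(1) this b bv(2)] regular_at_m1_psi]
  have "((\<lambda>x. norm (?W x)) \<longlongrightarrow> norm (v0 * P1 z - v1 * P0 z)) (at_right (-1))" by (rule tendsto_norm)
  then have le: "norm (v0 * P1 z - v1 * P0 z) \<le> ?M"
    by (rule tendsto_upperbound) (use eventually_at_right_m1 W in \<open>auto elim: eventually_mono\<close>)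
  have "v0 * m_denom gam z = of_real (sin gam) * (v0 * P1 z - v1 * P0 z)"
    using bv(3) unfolding m_denom_def by algebra
  then have "cmod v0 * cmod (m_denom gam z) = \<bar>sin gam\<bar> * norm (v0 * P1 z - v1 * P0 z)" by (simp flip: norm_mult) (simp add: norm_mult)
  also have "\<dots> \<le> 1 * norm (v0 * P1 z - v1 * P0 z)" by (intro mult_right_mono) auto
  finally show ?thesis using le by simp
qed

text \<open>The two resolvents differ by an operator of rank one: a suitable multiple of psi carries
  the boundary condition for gamma to that for 0, provided P0 is nonzero. This converse of
  \<open>rset_m_denom\<close> for gamma = 0 matches the case distinction of the theorem with the
  vanishing of P0.\<close>

lemma rset_transfer:
  assumes z: "z \<in> rset (Tgam gam a b) (rw a b)" and P: "P0 z \<noteq> 0"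
  shows "z \<in> rset (Tgam 0 a b) (rw a b)"
proof -
  let ?S = "{-1<..<1::real}" and ?r = "rw a b"
  have S: "?S \<in> sets lebesgue" by simp
  have D: "m_denom gam z \<noteq> 0" by (rule rset_m_denom[OF z])
  have D0: "m_denom 0 z \<noteq> 0" using P by (simp add: m_denom_def)
  obtain C where C: "\<And>h f. L2w ?r ?S h \<Longrightarrow> (f, \<lambda>x. z * f x + h x) \<in> Tgam gam a b \<Longrightarrow> l2norm ?r ?S f \<le> C * l2norm ?r ?S h"
    using z unfolding rset_def by blast
  define \<Psi> where "\<Psi> = l2norm ?r ?S (psi z)"
  \<comment> \<open>C bounds the solution for gamma; the second summand bounds the norm of the added
    multiple of psi; sqrt 2 comes from the triangle estimate \<open>L2w_add\<close>.\<close>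
  define C' where "C' = sqrt 2 * (C + \<Psi> / cmod (m_denom gam z) / cmod (P0 z) * \<Psi>)"
  have \<Psi>: "\<Psi> \<ge> 0" unfolding \<Psi>_def l2norm_def using L2w_psi[of z] by (auto intro!: integral_nonneg simp: L2w_def rw_nonneg)
  have ex: "\<exists>f. (f, \<lambda>x. z * f x + h x) \<in> Tgam 0 a b \<and> l2norm ?r ?S f \<le> C' * l2norm ?r ?S h" if h: "L2w ?r ?S h" for h
  proof -
    obtain f where f: "(f, \<lambda>x. z * f x + h x) \<in> Tgam gam a b" using z h unfolding rset_def by blast
    then obtain g v0 v1 where t: "L2w ?r ?S f" "L2w ?r ?S (\<lambda>x. z * f x + h x)" "tpair a b f g (\<lambda>x. z * f x + h x)" "bv a b f g v0 v1"
      "of_real (sin gam) * v1 + of_real (cos gam) * v0 = 0" unfolding Tgam_iff by blast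
    \<comment> \<open>The multiple that cancels the first boundary value, which is the boundary
      condition for gamma = 0.\<close>
    define c where "c = - v0 / P0 z"
    let ?f = "\<lambda>x. f x + c * psi z x"
    note add = L2w_add[OF t(1) L2w_cmult[OF L2w_psi[of z] S, of c] S borel_measurable_rw[OF S subset_refl] rw_nonneg]
    have "tpair a b ?f (\<lambda>x. g x + c * psig z x) (\<lambda>x. (z * f x + h x) + c * (z * psi z x))"
      by (rule tpair_add_cmult[OF t(3) solg_tpair[OF solg_psi]])
    moreover have eq: "(\<lambda>x. (z * f x + h x) + c * (z * psi z x)) = (\<lambda>x. z * ?f x + h x)" by (simp add: fun_eq_iff algebra_simps)
    moreover have "L2w ?r ?S (\<lambda>x. z * ?f x + h x)"
      by (rule L2w_add(1)[OF L2w_cmult[OF add(1) S] h S borel_measurable_rw[OF S subset_refl] rw_nonneg])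
    moreover have "bv a b ?f (\<lambda>x. g x + c * psig z x) (v0 + c * P0 z) (v1 + c * P1 z)" by (intro bv_add bv_cmult t bv_psi)
    moreover have "of_real (sin 0) * (v1 + c * P1 z) + of_real (cos 0) * (v0 + c * P0 z) = 0" using P by (simp add: c_def)
    ultimately have T: "(?f, \<lambda>x. z * ?f x + h x) \<in> Tgam 0 a b" unfolding Tgam_iff using add(1) by (simp only:) blast
    have "cmod v0 * cmod (m_denom gam z) \<le> \<Psi> * l2norm ?r ?S h"
      unfolding \<Psi>_def by (rule boundary_functional_bound[OF f h t(3-5)])
    then have "cmod v0 \<le> \<Psi> * l2norm ?r ?S h / cmod (m_denom gam z)" using D by (simp add: pos_le_divide_eq)
    then have "cmod v0 / cmod (P0 z) \<le> \<Psi> * l2norm ?r ?S h / cmod (m_denom gam z) / cmod (P0 z)" by (intro divide_right_mono) auto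
    then have c: "cmod c * \<Psi> \<le> \<Psi> * l2norm ?r ?S h / cmod (m_denom gam z) / cmod (P0 z) * \<Psi>"
      using \<Psi> by (intro mult_right_mono) (auto simp: c_def norm_divide)
    have "l2norm ?r ?S ?f \<le> sqrt 2 * (l2norm ?r ?S f + cmod c * \<Psi>)"
      using add(2) unfolding l2norm_cmult \<Psi>_def .
    also have "\<dots> \<le> sqrt 2 * (C * l2norm ?r ?S h + \<Psi> * l2norm ?r ?S h / cmod (m_denom gam z) / cmod (P0 z) * \<Psi>)"
      by (intro mult_left_mono add_mono C[OF h f] c) auto
    also have "\<dots> = C' * l2norm ?r ?S h" unfolding C'_def by (simp add: field_simps)
    finally show ?thesis using T by blast
  qed
  have uniq: "f1 x = f2 x" if "(f1, \<lambda>x. z * f1 x + h x) \<in> Tgam 0 a b" "(f2, \<lambda>x. z * f2 x + h x) \<in> Tgam 0 a b" "x \<in> ?S" for f1 f2 h x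
    by (rule Tgam_diff[OF that(1,2) D0 that(3)])
  have ex': "\<forall>h. L2w ?r ?S h \<longrightarrow> (\<exists>f. (f, \<lambda>x. z * f x + h x) \<in> Tgam 0 a b)" using ex by blast
  have uniq': "l2norm ?r ?S (\<lambda>x. f1 x - f2 x) = 0"
    if "(f1, \<lambda>x. z * f1 x + h x) \<in> Tgam 0 a b \<and> (f2, \<lambda>x. z * f2 x + h x) \<in> Tgam 0 a b" for h f1 f2
  proof -
    have "l2norm ?r ?S (\<lambda>x. f1 x - f2 x) = l2norm ?r ?S (\<lambda>x. 0)" by (intro l2norm_cong) (use uniq that in force)
    then show ?thesis by (simp add: l2norm_def)
  qed
  have bdd: "l2norm ?r ?S f \<le> C' * l2norm ?r ?S h" if hf: "L2w ?r ?S h \<and> (f, \<lambda>x. z * f x + h x) \<in> Tgam 0 a b" for h f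
  proof -
    obtain f' where f': "(f', \<lambda>x. z * f' x + h x) \<in> Tgam 0 a b" "l2norm ?r ?S f' \<le> C' * l2norm ?r ?S h" using ex hf by blast
    have "l2norm ?r ?S f = l2norm ?r ?S f'" by (intro l2norm_cong uniq[OF _ f'(1)]) (use hf in auto)
    with f' show ?thesis by simp
  qed
  show ?thesis
    unfolding rset_def mem_Collect_eq
  proof (intro conjI)
    show "\<forall>h f1 f2. (f1, \<lambda>x. z * f1 x + h x) \<in> Tgam 0 a b \<and> (f2, \<lambda>x. z * f2 x + h x) \<in> Tgam 0 a b \<longrightarrow>
         l2norm ?r ?S (\<lambda>x. f1 x - f2 x) = 0" using uniq' by blast
    show "\<exists>C. \<forall>h f. L2w ?r ?S h \<and> (f, \<lambda>x. z * f x + h x) \<in> Tgam 0 a b \<longrightarrow> l2norm ?r ?S f \<le> C * l2norm ?r ?S h"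
      using bdd by blast
  qed (rule ex')
qed

section \<open>Zeros of the denominator and poles of the m-function\<close>

lemma holomorphic_m_denom: "m_denom gam holomorphic_on S" and holomorphic_m_num: "m_num gam holomorphic_on S"
  unfolding m_denom_def[abs_def] m_num_def[abs_def] by (intro holomorphic_intros holomorphic_P0 holomorphic_P1)+

lemma Im_cnj_rotation:
  "Im (cnj (of_real c * p + of_real s * q) * (of_real c * q - of_real s * p)) = (c * c + s * s) * Im (cnj p * q)"
  by (simp add: algebra_simps)

lemma herglotz_m_denom_m_num:
  assumes "Im z \<noteq> 0"
  shows "Im z * Im (cnj (m_denom gam z) * m_num gam z) > 0"
proof -
  have "Im (cnj (m_denom gam z) * m_num gam z) = (cos gam * cos gam + sin gam * sin gam) * Im (cnj (P0 z) * P1 z)"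
    unfolding m_denom_def m_num_def by (rule Im_cnj_rotation)
  also have "cos gam * cos gam + sin gam * sin gam = 1" using sin_cos_squared_add2[of gam] by simp
  finally show ?thesis using herglotz[OF assms] by simp
qed

text \<open>The sign condition shows that the entire function D is nonzero at \<open>\<i>\<close>,
  so it is not identically zero and its zeros are isolated.\<close>

lemma m_denom_eventually_nonzero: "\<forall>\<^sub>F w in at z. m_denom gam w \<noteq> 0"
proof -
  have "m_denom gam \<i> \<noteq> 0" using herglotz_m_denom_m_num[of \<i> gam] by auto
  from non_zero_neighbour_alt[OF holomorphic_m_denom open_UNIV connected_UNIV UNIV_I UNIV_I this]
  show ?thesis by (rule eventually_mono) auto
qed

text \<open>At a zero of D the definite description behind \<open>mfun\<close> is out of control.
  Being a pole and having a given order depend only on a punctured neighbourhood, where the quotient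
  is valid.\<close>

lemma mfun_eventually: "\<forall>\<^sub>F w in at z. mfun gam a b w = m_num gam w / m_denom gam w"
  using m_denom_eventually_nonzero by (rule eventually_mono) (rule mfun_eq)

lemma m_num_nonzero: "m_denom gam z = 0 \<Longrightarrow> m_num gam z \<noteq> 0"
  using m_denom_m_num[of gam z] P_nonzero[of z] by auto

lemma is_pole_mfun_iff: "is_pole (mfun gam a b) z \<longleftrightarrow> m_denom gam z = 0"
proof -
  have cD: "isCont (m_denom gam) z" and cN: "isCont (m_num gam) z"
    using holomorphic_on_imp_continuous_on[OF holomorphic_m_denom[of gam UNIV]] holomorphic_on_imp_continuous_on[OF holomorphic_m_num[of gam UNIV]]
    by (simp_all add: continuous_on_eq_continuous_at)
  have "is_pole (mfun gam a b) z \<longleftrightarrow> is_pole (\<lambda>w. m_num gam w / m_denom gam w) z"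
    by (rule is_pole_cong[OF mfun_eventually refl])
  also have "\<dots> \<longleftrightarrow> m_denom gam z = 0"
  proof
    assume D: "m_denom gam z = 0"
    have "filterlim (m_denom gam) (at 0) (at z)"
      unfolding filterlim_at using cD m_denom_eventually_nonzero[of gam z] D by (auto simp: isCont_def elim: eventually_mono)
    then show "is_pole (\<lambda>w. m_num gam w / m_denom gam w) z" by (rule is_pole_divide[OF cN _ m_num_nonzero[OF D]])
  next
    assume p: "is_pole (\<lambda>w. m_num gam w / m_denom gam w) z"
    show "m_denom gam z = 0"
    proof (rule ccontr)
      assume "m_denom gam z \<noteq> 0"
      then have "((\<lambda>w. m_num gam w / m_denom gam w) \<longlongrightarrow> m_num gam z / m_denom gam z) (at z)"
        using cD cN unfolding isCont_def by (intro tendsto_divide)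
      then show False using p not_tendsto_and_filterlim_at_infinity[of "at z"] unfolding is_pole_def by auto
    qed
  qed
  finally show ?thesis .
qed

lemma zorder_mfun:
  assumes "m_denom gam z = 0"
  shows "zorder (mfun gam a b) z = -1"
proof -
  obtain r g where r: "r > 0" "g holomorphic_on ball z r" "\<And>w. w \<in> ball z r \<Longrightarrow> m_denom gam w = g w * (w - z) \<and> g w \<noteq> 0"
    using herglotz_simple_zero[OF holomorphic_m_denom holomorphic_m_num herglotz_m_denom_m_num assms m_num_nonzero[OF assms]] by metis
  show ?thesis
  proof (rule zorder_eqI[where S = "ball z r" and g = "\<lambda>w. m_num gam w / g w"])
    show "(\<lambda>w. m_num gam w / g w) holomorphic_on ball z r" using r by (intro holomorphic_on_divide holomorphic_m_num) auto
    show "m_num gam z / g z \<noteq> 0" using r(3)[of z] r(1) m_num_nonzero[OF assms] by simp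
    fix w assume w: "w \<in> ball z r" "w \<noteq> z"
    then have "m_denom gam w \<noteq> 0" using r(3)[of w] by simp
    then show "mfun gam a b w = m_num gam w / g w * (w - z) powi - 1"
      using r(3)[OF w(1)] by (simp add: mfun_eq power_int_minus divide_inverse)
  qed (use r in auto)
qed

text \<open>If z is regular for gamma but not for 0, then P0 vanishes and P1 does not, so N/D
  reduces to cos/sin. This is the limit of the fractional linear expression at a pole of the
  function for gamma = 0.\<close>

lemma mfun_rset_eq:
  assumes z: "z \<in> rset (Tgam gam a b) (rw a b)"
  shows "mfun gam a b z =
    (if z \<in> rset (Tgam 0 a b) (rw a b)
     then (- of_real (sin gam) + of_real (cos gam) * mfun 0 a b z) / (of_real (cos gam) + of_real (sin gam) * mfun 0 a b z)
     else of_real (cos gam) / of_real (sin gam))"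
proof (cases "z \<in> rset (Tgam 0 a b) (rw a b)")
  case True
  have P: "P0 z \<noteq> 0" using rset_m_denom[OF True] by (simp add: m_denom_def)
  have m0: "mfun 0 a b z = P1 z / P0 z" using mfun_eq[of 0 z] P by (simp add: m_denom_def m_num_def)
  have "mfun gam a b z = m_num gam z / m_denom gam z" by (rule mfun_eq[OF rset_m_denom[OF z]])
  also have "\<dots> = (m_num gam z / P0 z) / (m_denom gam z / P0 z)" using P by simp
  also have "m_num gam z / P0 z = - of_real (sin gam) + of_real (cos gam) * mfun 0 a b z"
    using P by (simp add: m_num_def m0 diff_divide_distrib)
  also have "m_denom gam z / P0 z = of_real (cos gam) + of_real (sin gam) * mfun 0 a b z"
    using P by (simp add: m_denom_def m0 add_divide_distrib)
  finally show ?thesis using True by simp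
next
  case False
  then have P: "P0 z = 0" using rset_transfer[OF z] by blast
  then have "P1 z \<noteq> 0" using P_nonzero[of z] by simp
  then show ?thesis using False mfun_eq[OF rset_m_denom[OF z]] P by (simp add: m_denom_def m_num_def)
qed

lemma mfun_0_rset_eq:
  assumes "z \<in> rset (Tgam 0 a b) (rw a b)"
  shows "mfun 0 a b z = m0_formula a b z"
proof -
  have P: "P0 z \<noteq> 0" using rset_m_denom[OF assms] by (simp add: m_denom_def)
  have "mfun 0 a b z = P1 z / P0 z" using mfun_eq[of 0 z] P by (simp add: m_denom_def m_num_def)
  then show ?thesis using m0_formula_eq[OF P] by simp
qed

lemma eigfun_unique:
  assumes "eigfun (Tgam gam a b) (rw a b) z f1" "eigfun (Tgam gam a b) (rw a b) z f2"
  shows "\<exists>c. \<forall>x\<in>{-1<..<1}. f1 x = c * f2 x"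
proof -
  obtain k1 where "\<forall>x\<in>{-1<..<1}. f1 x = k1 * psi z x" using eigfun_multiple(1)[OF assms(1)] by blast
  moreover obtain k2 where "k2 \<noteq> 0" "\<forall>x\<in>{-1<..<1}. f2 x = k2 * psi z x" using eigfun_multiple(1)[OF assms(2)] by blast
  ultimately show ?thesis by (intro exI[of _ "k1 / k2"]) simp
qed

end

theorem theorem6p1:
  fixes gam a b :: real
  assumes "0 \<le> gam" and "gam < pi"
    and "a \<le> -1 \<or> 1 \<le> a"
    and "-1 < b" and "b < 1"
  shows
    "(\<forall>z\<in>rset (Tgam gam a b) (rw a b).
        mfun gam a b z =
          (if z \<in> rset (Tgam 0 a b) (rw a b)
           then (- of_real (sin gam) + of_real (cos gam) * mfun 0 a b z) /
                (of_real (cos gam) + of_real (sin gam) * mfun 0 a b z)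
           else of_real (cos gam) / of_real (sin gam)))
     \<and> (\<forall>z\<in>rset (Tgam 0 a b) (rw a b). mfun 0 a b z = m0_formula a b z)
     \<and> (\<forall>z. is_pole (mfun gam a b) z \<longleftrightarrow> z \<in> eigvals (Tgam gam a b) (rw a b))
     \<and> (\<forall>z. is_pole (mfun gam a b) z \<longrightarrow> zorder (mfun gam a b) z = -1)
     \<and> (\<forall>z f1 f2. eigfun (Tgam gam a b) (rw a b) z f1 \<and> eigfun (Tgam gam a b) (rw a b) z f2 \<longrightarrow>
          (\<exists>c. \<forall>x\<in>{-1<..<1}. f1 x = c * f2 x))"
proof -
  interpret jacobi a b using assms by unfold_locales auto
  show ?thesis
  proof (intro conjI)
    show "\<forall>z. is_pole (mfun gam a b) z \<longleftrightarrow> z \<in> eigvals (Tgam gam a b) (rw a b)"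
      using is_pole_mfun_iff eigvals_iff by blast
    show "\<forall>z. is_pole (mfun gam a b) z \<longrightarrow> zorder (mfun gam a b) z = -1"
      using is_pole_mfun_iff zorder_mfun by blast
    show "\<forall>z f1 f2. eigfun (Tgam gam a b) (rw a b) z f1 \<and> eigfun (Tgam gam a b) (rw a b) z f2 \<longrightarrow>
        (\<exists>c. \<forall>x\<in>{-1<..<1}. f1 x = c * f2 x)"
      using eigfun_unique by blast
  qed (rule ballI, erule mfun_rset_eq mfun_0_rset_eq)+
qed

end
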